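(* Let $(M,g)$ be a connected, geodesically complete $d$-dimensional Riemannian manifold, let $\delta>0$, and let $h:[0,\infty)\to[0,1]$ be measurable and non-increasing. Let $\xi$ be the Poisson graph process on $M$ with intensity measure $\delta\lambda_g$ connected by the kernel $(x,y)\mapsto h(d_g(x,y))$. For any $c>0$, let $\xi'$ be obtained from $\xi$ by the transformation $$g'=c^2 g,\qquad \delta'=c^{-d}\delta,\qquad h'(r)=h(r/c),$$ that is, $\xi'$ is the Poisson graph process on $M$ with intensity measure $\delta'\lambda_{g'}$ connected by the kernel $(x,y)\mapsto h'(d_{g'}(x,y))$. Then $\xi'\overset{d}{=}\xi$.
   Context: $d_g$ is the Riemannian distance and $\lambda_g$ the Riemannian volume measure of $(M,g)$; manifolds are second-countable and Hausdorff. The Poisson graph process on $M$ with intensity measure $\mu$ (locally finite, i.e. finite on bounded Borel sets) connected by a symmetric measurable kernel $W:M^2\to[0,1]$ is the random measure $$\sum_{i,j\le N}\delta_{(S_i,S_j,A_{ij})}\quad\text{on } M^2\times\{0,1\},$$ where $\sum_{i\le N}\delta_{S_i}$ is a Poisson process on $M$ with intensity measure $\mu$ ($N\in\{0,1,\dots\}\cup\{\infty\}$, the $S_i$ a.s. distinct) and, conditionally on $(N,(S_k))$, $A_{ii}=0$, the $A_{ij}$ with $i<j$ are independent with $A_{ij}\sim\mathrm{Bernoulli}(W(S_i,S_j))$, and $A_{ji}=A_{ij}$. Equality in distribution is as random measures. *)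

theory Defs
  imports "HOL-Probability.Probability"
begin

section \<open>Smooth manifolds given by an atlas\<close>

primrec Ck_on :: "nat \<Rightarrow> ('a::real_normed_vector \<Rightarrow> 'b::real_normed_vector) \<Rightarrow> 'a set \<Rightarrow> bool" where
  "Ck_on 0 f S \<longleftrightarrow> continuous_on S f"
| "Ck_on (Suc k) f S \<longleftrightarrow> (\<forall>x\<in>S. f differentiable (at x)) \<and>
     (\<forall>v. Ck_on k (\<lambda>x. frechet_derivative f (at x) v) S)"

text \<open>Only used for open \<open>S\<close>.\<close>

definition smooth_on :: "('a::real_normed_vector \<Rightarrow> 'b::real_normed_vector) \<Rightarrow> 'a set \<Rightarrow> bool" where
  "smooth_on f S \<longleftrightarrow> (\<forall>k. Ck_on k f S)"

text \<open>A chart is a pair \<open>(U, \<phi>)\<close>; the values of \<open>\<phi>\<close> outside \<open>U\<close> are irrelevant.\<close>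

type_synonym ('a, 'n) chart = "'a set \<times> ('a \<Rightarrow> real ^ 'n)"

text \<open>
  The manifold is the whole type \<open>'a\<close>; its topology is that of the type, its dimension
  is \<open>CARD('n)\<close>. The atlas need not be maximal: any atlas determines the smooth structure.
\<close>

definition smooth_atlas ::
  "('a::{second_countable_topology, t2_space}, 'n::finite) chart set \<Rightarrow> bool" where
  "smooth_atlas A \<longleftrightarrow>
     (\<forall>(U, \<phi>)\<in>A. open U \<and> open (\<phi> ` U) \<and> homeomorphism U (\<phi> ` U) \<phi> (inv_into U \<phi>)) \<and>
     (\<Union>(U, \<phi>)\<in>A. U) = UNIV \<and>
     (\<forall>(U, \<phi>)\<in>A. \<forall>(V, \<psi>)\<in>A. smooth_on (\<psi> \<circ> inv_into U \<phi>) (\<phi> ` (U \<inter> V)))"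

section \<open>Riemannian metrics\<close>

text \<open>
  A 2-tensor field is given by its matrix of components in every chart, as a function of
  the coordinates.
\<close>

type_synonym ('a, 'n) tensor2 = "('a, 'n) chart \<Rightarrow> real ^ 'n \<Rightarrow> real ^ 'n ^ 'n"

definition riemannian_metric ::
  "('a::{second_countable_topology, t2_space}, 'n::finite) chart set \<Rightarrow> ('a, 'n) tensor2 \<Rightarrow> bool" where
  "riemannian_metric A g \<longleftrightarrow>
     (\<forall>(U, \<phi>)\<in>A. smooth_on (g (U, \<phi>)) (\<phi> ` U) \<and>
        (\<forall>x\<in>\<phi> ` U. transpose (g (U, \<phi>) x) = g (U, \<phi>) x \<and>
                     (\<forall>v. v \<noteq> 0 \<longrightarrow> 0 < v \<bullet> (g (U, \<phi>) x *v v)))) \<and>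
     (\<forall>(U, \<phi>)\<in>A. \<forall>(V, \<psi>)\<in>A. \<forall>p\<in>U \<inter> V.
        (let J = matrix (frechet_derivative (\<psi> \<circ> inv_into U \<phi>) (at (\<phi> p)))
         in g (U, \<phi>) (\<phi> p) = transpose J ** g (V, \<psi>) (\<psi> p) ** J))"

subsection \<open>Riemannian distance\<close>

text \<open>
  The chart selected below does not matter, by the transformation law of the metric.
\<close>

definition speed ::
  "('a, 'n::finite) chart set \<Rightarrow> ('a, 'n) tensor2 \<Rightarrow> (real \<Rightarrow> 'a) \<Rightarrow> real \<Rightarrow> real" where
  "speed A g \<gamma> t =
     (let (U, \<phi>) = (SOME k. k \<in> A \<and> \<gamma> t \<in> fst k);
          v = vector_derivative (\<phi> \<circ> \<gamma>) (at t)
      in sqrt (v \<bullet> (g (U, \<phi>) (\<phi> (\<gamma> t)) *v v)))"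

definition C1_curve_on ::
  "('a::topological_space, 'n::finite) chart set \<Rightarrow> real set \<Rightarrow> (real \<Rightarrow> 'a) \<Rightarrow> bool" where
  "C1_curve_on A I \<gamma> \<longleftrightarrow> continuous_on I \<gamma> \<and>
     (\<forall>(U, \<phi>)\<in>A. \<exists>v. continuous_on {t\<in>I. \<gamma> t \<in> U} v \<and>
        (\<forall>t\<in>{t\<in>I. \<gamma> t \<in> U}. ((\<phi> \<circ> \<gamma>) has_vector_derivative v t) (at t within I)))"

definition piecewise_C1_curve ::
  "('a::topological_space, 'n::finite) chart set \<Rightarrow> (real \<Rightarrow> 'a) \<Rightarrow> bool" where
  "piecewise_C1_curve A \<gamma> \<longleftrightarrow>
     (\<exists>m (s::nat \<Rightarrow> real). s 0 = 0 \<and> s m = 1 \<and>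
        (\<forall>i<m. s i < s (Suc i) \<and> C1_curve_on A {s i..s (Suc i)} \<gamma>))"

definition curve_length ::
  "('a, 'n::finite) chart set \<Rightarrow> ('a, 'n) tensor2 \<Rightarrow> (real \<Rightarrow> 'a) \<Rightarrow> ennreal" where
  "curve_length A g \<gamma> = (\<integral>\<^sup>+ t\<in>{0..1}. ennreal (speed A g \<gamma> t) \<partial>lborel)"

text \<open>On a connected manifold the infimum is finite.\<close>

definition riemannian_dist ::
  "('a::topological_space, 'n::finite) chart set \<Rightarrow> ('a, 'n) tensor2 \<Rightarrow> 'a \<Rightarrow> 'a \<Rightarrow> real" where
  "riemannian_dist A g p q =
     enn2real (INF \<gamma>\<in>{\<gamma>. piecewise_C1_curve A \<gamma> \<and> \<gamma> 0 = p \<and> \<gamma> 1 = q}. curve_length A g \<gamma>)"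

subsection \<open>Geodesic completeness\<close>

definition christoffel ::
  "(real ^ 'n \<Rightarrow> real ^ 'n ^ 'n) \<Rightarrow> real ^ 'n \<Rightarrow> 'n::finite \<Rightarrow> 'n \<Rightarrow> 'n \<Rightarrow> real" where
  "christoffel G x k i j =
     (let D = (\<lambda>a b c. frechet_derivative G (at x) (axis a 1) $ b $ c)
      in (1 / 2) * (\<Sum>l\<in>UNIV. matrix_inv (G x) $ k $ l * (D i j l + D j i l - D l i j)))"

definition geodesic_on ::
  "('a::topological_space, 'n::finite) chart set \<Rightarrow> ('a, 'n) tensor2 \<Rightarrow> real set \<Rightarrow> (real \<Rightarrow> 'a) \<Rightarrow> bool"
where
  "geodesic_on A g I \<gamma> \<longleftrightarrow> continuous_on I \<gamma> \<and>
     (\<forall>(U, \<phi>)\<in>A. \<exists>v. \<forall>t\<in>{t\<in>I. \<gamma> t \<in> U}.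
        ((\<phi> \<circ> \<gamma>) has_vector_derivative v t) (at t) \<and>
        (v has_vector_derivative
           (\<chi> k. - (\<Sum>i\<in>UNIV. \<Sum>j\<in>UNIV. christoffel (g (U, \<phi>)) (\<phi> (\<gamma> t)) k i j * v t $ i * v t $ j)))
          (at t))"

text \<open>Every geodesic on an open interval extends to all of \<open>\<real>\<close>.\<close>

definition geodesically_complete ::
  "('a::topological_space, 'n::finite) chart set \<Rightarrow> ('a, 'n) tensor2 \<Rightarrow> bool" where
  "geodesically_complete A g \<longleftrightarrow>
     (\<forall>I \<gamma>. open I \<and> is_interval I \<and> I \<noteq> {} \<and> geodesic_on A g I \<gamma> \<longrightarrow>
        (\<exists>\<gamma>'. geodesic_on A g UNIV \<gamma>' \<and> (\<forall>t\<in>I. \<gamma>' t = \<gamma> t)))"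

subsection \<open>Riemannian volume measure\<close>

definition riemannian_volume ::
  "('a::topological_space, 'n::finite) chart set \<Rightarrow> ('a, 'n) tensor2 \<Rightarrow> 'a measure" where
  "riemannian_volume A g =
     (THE \<nu>. sets \<nu> = sets borel \<and>
        (\<forall>(U, \<phi>)\<in>A. \<forall>B\<in>sets borel. B \<subseteq> U \<longrightarrow>
           emeasure \<nu> B = (\<integral>\<^sup>+ x\<in>\<phi> ` B. ennreal (sqrt (det (g (U, \<phi>) x))) \<partial>lborel)))"

section \<open>Random measures and Poisson graph processes\<close>

text \<open>
  The space of all measures on \<open>K\<close> with the \<open>\<sigma>\<close>-algebra generated by the evaluations at
  measurable sets (as in \<^const>\<open>subprob_algebra\<close>, but without the bound on the total mass).
\<close>

definition measure_algebra :: "'a measure \<Rightarrow> 'a measure measure" where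
  "measure_algebra K =
     (SUP B \<in> sets K. vimage_algebra {\<nu>. sets \<nu> = sets K} (\<lambda>\<nu>. emeasure \<nu> B) borel)"

text \<open>The sum of the Dirac measures at the points \<open>x i\<close>, \<open>i \<in> I\<close>.\<close>

definition dirac_sum :: "'a measure \<Rightarrow> 'i set \<Rightarrow> ('i \<Rightarrow> 'a) \<Rightarrow> 'a measure" where
  "dirac_sum K I x = distr (count_space I) K x"

text \<open>With the convention that a Poisson variable of mean \<open>\<infinity>\<close> equals \<open>\<infinity>\<close> almost surely.\<close>

definition poisson_process ::
  "'w measure \<Rightarrow> 'a::topological_space measure \<Rightarrow> ('w \<Rightarrow> 'a measure) \<Rightarrow> bool" where
  "poisson_process P \<mu> \<eta> \<longleftrightarrow>
     \<eta> \<in> P \<rightarrow>\<^sub>M measure_algebra borel \<and>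
     (\<forall>B\<in>sets borel. emeasure \<mu> B < \<infinity> \<longrightarrow>
        (\<forall>k::nat. measure P {\<omega>\<in>space P. emeasure (\<eta> \<omega>) B = of_nat k} =
                  exp (- measure \<mu> B) * measure \<mu> B ^ k / fact k)) \<and>
     (\<forall>B\<in>sets borel. emeasure \<mu> B = \<infinity> \<longrightarrow> (AE \<omega> in P. emeasure (\<eta> \<omega>) B = \<infinity>)) \<and>
     (\<forall>(m::nat) B. (\<forall>i<m. B i \<in> sets borel) \<and> disjoint_family_on B {..<m} \<longrightarrow>
        prob_space.indep_vars P (\<lambda>_. borel) (\<lambda>i \<omega>. emeasure (\<eta> \<omega>) (B i)) {..<m})"

definition locally_finite_measure :: "('a::topological_space \<Rightarrow> 'a \<Rightarrow> real) \<Rightarrow> 'a measure \<Rightarrow> bool" where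
  "locally_finite_measure d \<mu> \<longleftrightarrow> sets \<mu> = sets borel \<and>
     (\<forall>B\<in>sets borel. (\<exists>x r. \<forall>y\<in>B. d x y \<le> r) \<longrightarrow> emeasure \<mu> B < \<infinity>)"

definition symmetric_kernel :: "('a::topological_space \<Rightarrow> 'a \<Rightarrow> real) \<Rightarrow> bool" where
  "symmetric_kernel W \<longleftrightarrow>
     (\<lambda>(x, y). W x y) \<in> borel_measurable (borel \<Otimes>\<^sub>M borel) \<and>
     (\<forall>x y. 0 \<le> W x y \<and> W x y \<le> 1 \<and> W x y = W y x)"

text \<open>The measurable space \<open>M\<^sup>2 \<times> {0,1}\<close>, with \<open>bool\<close> for \<open>{0,1}\<close>.\<close>

abbreviation edge_space :: "('a::topological_space \<times> 'a \<times> bool) measure" where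
  "edge_space \<equiv> borel \<Otimes>\<^sub>M (borel \<Otimes>\<^sub>M count_space UNIV)"

definition point_sigma :: "'w measure \<Rightarrow> ('w \<Rightarrow> enat) \<Rightarrow> (nat \<Rightarrow> 'w \<Rightarrow> 'a::topological_space) \<Rightarrow> 'w measure"
where
  "point_sigma P N S = vimage_algebra (space P) (\<lambda>\<omega>. (N \<omega>, \<lambda>i. S i \<omega>))
     (count_space UNIV \<Otimes>\<^sub>M Pi\<^sub>M UNIV (\<lambda>_. borel))"

text \<open>
  Indices start at 0, so the points are \<open>S i\<close> for \<open>i < N\<close>; the \<open>S i\<close> with \<open>i \<ge> N\<close> are
  placeholders that do not enter the process (take them constant, say). The last clause says
  that conditionally on \<open>(N, S)\<close> the \<open>A i j\<close> with \<open>i < j < N\<close> are independent Bernoulli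
  variables with parameters \<open>W (S i) (S j)\<close>, expressed through the conditional probabilities
  of the joint values \<open>a\<close> on finite index sets \<open>F\<close>.
\<close>

definition poisson_graph_process ::
  "('a::topological_space \<Rightarrow> 'a \<Rightarrow> real) \<Rightarrow> 'w measure \<Rightarrow> 'a measure \<Rightarrow> ('a \<Rightarrow> 'a \<Rightarrow> real) \<Rightarrow>
   ('w \<Rightarrow> ('a \<times> 'a \<times> bool) measure) \<Rightarrow> bool" where
  "poisson_graph_process d P \<mu> W \<xi> \<longleftrightarrow>
     prob_space P \<and> locally_finite_measure d \<mu> \<and> symmetric_kernel W \<and>
     (\<exists>N S A.
        N \<in> P \<rightarrow>\<^sub>M count_space UNIV \<and>
        (\<forall>i. S i \<in> P \<rightarrow>\<^sub>M borel) \<and>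
        (\<forall>i j. A i j \<in> P \<rightarrow>\<^sub>M count_space UNIV) \<and>
        (\<forall>\<omega>\<in>space P. \<xi> \<omega> =
           dirac_sum edge_space {(i, j). enat i < N \<omega> \<and> enat j < N \<omega>}
             (\<lambda>(i, j). (S i \<omega>, S j \<omega>, A i j \<omega>))) \<and>
        poisson_process P \<mu> (\<lambda>\<omega>. dirac_sum borel {i. enat i < N \<omega>} (\<lambda>i. S i \<omega>)) \<and>
        (AE \<omega> in P. \<forall>i j. enat i < N \<omega> \<and> enat j < N \<omega> \<and> i \<noteq> j \<longrightarrow> S i \<omega> \<noteq> S j \<omega>) \<and>
        (\<forall>\<omega>\<in>space P. \<forall>i j. \<not> A i i \<omega> \<and> A j i \<omega> = A i j \<omega>) \<and>
        (\<forall>F a. finite F \<and> F \<subseteq> {(i, j). i < j} \<longrightarrow>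
           (AE \<omega> in P. (\<forall>(i, j)\<in>F. enat j < N \<omega>) \<longrightarrow>
              real_cond_exp P (point_sigma P N S)
                (indicator {\<omega>\<in>space P. \<forall>(i, j)\<in>F. A i j \<omega> = a i j}) \<omega> =
              (\<Prod>(i, j)\<in>F. pmf (bernoulli_pmf (W (S i \<omega>) (S j \<omega>))) (a i j)))))"

end

theory Submission
  imports Defs
begin

text \<open>
  Replacing \<open>g\<close> by \<open>c\<^sup>2 g\<close> multiplies the speed of every curve by \<open>c\<close>, hence all distances by \<open>c\<close>, and
  multiplies the volume density \<open>sqrt (det g)\<close> by \<open>c\<^sup>d\<close>. The choices of \<open>\<delta>'\<close> and \<open>h'\<close> undo both
  effects: the new process has the same intensity measure and the same kernel, as a function on
  \<open>M\<^sup>2\<close>, as the old one. So the theorem reduces to two facts: the scaling of distance and volume,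
  and the uniqueness in law of the Poisson graph process with given intensity and kernel. The
  second is a real statement, since the two processes may live on different probability spaces and
  enumerate their points in different, random ways.

  The volume measure is given by a definite description, so its scaling (lemma
  \<open>riemannian_volume_scale\<close>) requires that exactly one measure has the prescribed values inside
  charts. Uniqueness follows by cutting a Borel set along a countable partition subordinate to
  charts. For existence one adds up the push-forwards of the densities over such a partition; that
  the sum has the right values in every chart is the substitution rule for integrals combined with
  the transformation law of the metric (lemma \<open>volume_integral_chart_independent\<close>). The density is
  bounded on suitable bounded pieces of charts, so the volume is \<open>\<sigma>\<close>-finite.

  Uniqueness in law (lemma \<open>poisson_graph_process_law_unique\<close>) is proved with Laplace functionals
  \<open>E exp (- \<integral> f d\<xi>)\<close> for bounded functions \<open>f\<close> with values in the natural numbers. They determine the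
  law of a random measure whose values are natural numbers or \<open>\<infinity>\<close>, because the distribution of such
  a variable \<open>X\<close> can be read off from the numbers \<open>E exp (- t X)\<close>: the event \<open>X = 0\<close> dominates as
  \<open>t \<rightarrow> \<infinity>\<close>, then \<open>X = 1\<close>, and so on. For a Poisson process the functional factorises over the level
  sets of \<open>f\<close>, so the law of the point process \<open>\<eta>\<close> is determined by its intensity. For the graph
  process, integrating out the independent edge marks for fixed points \<open>S\<^sub>0, S\<^sub>1, \<dots>\<close> yields
  \<open>E exp (- \<integral> f d\<xi>) = E exp (- \<Sum>\<^sub>i\<^sub>,\<^sub>j u (S\<^sub>i, S\<^sub>j)) = E exp (- \<integral>\<integral> u d\<eta> d\<eta>)\<close>, where \<open>u\<close> depends only on \<open>f\<close>
  and the kernel (lemma \<open>poisson_graph_process_Laplace\<close>). The right-hand side no longer refers to the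
  enumeration of the points, and it is determined by the law of \<open>\<eta>\<close>.
\<close>

section \<open>Scaling of the Riemannian distance\<close>

text \<open>
  The speed of a curve involves an arbitrary choice of a chart at each time, so the rule has to cover
  functions \<open>f\<close> that need not be measurable. For a finite constant \<open>c > 0\<close> multiplication by \<open>c\<close> is a
  bijection between the simple functions below \<open>f\<close> and those below \<open>c f\<close>; it suffices to prove one inequality for all
  constants and to apply it to \<open>c\<close> and to \<open>1 / c\<close>.
\<close>

lemma nn_integral_cmult_pos:
  assumes "0 < c"
  shows "(\<integral>\<^sup>+x. ennreal c * f x \<partial>M) = ennreal c * (\<integral>\<^sup>+x. f x \<partial>M)"
proof -
  have le: "ennreal b * (\<integral>\<^sup>+x. h x \<partial>M) \<le> (\<integral>\<^sup>+x. ennreal b * h x \<partial>M)" for b h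
  proof -
    have "ennreal b * (\<integral>\<^sup>+x. h x \<partial>M) =
          (SUP g\<in>{g. simple_function M g \<and> g \<le> h}. ennreal b * integral\<^sup>S M g)"
      unfolding nn_integral_def by (rule SUP_mult_left_ennreal)
    also have "\<dots> \<le> (\<integral>\<^sup>+x. ennreal b * h x \<partial>M)"
    proof (rule SUP_least)
      fix g assume "g \<in> {g. simple_function M g \<and> g \<le> h}"
      then have g: "simple_function M g" "\<And>x. g x \<le> h x" by (auto simp: le_fun_def)
      have "ennreal b * integral\<^sup>S M g = (\<integral>\<^sup>Sx. ennreal b * g x \<partial>M)"
        by (rule simple_integral_mult[OF g(1), symmetric])
      also have "\<dots> = (\<integral>\<^sup>+x. ennreal b * g x \<partial>M)"
        by (rule nn_integral_eq_simple_integral[symmetric]) (intro simple_function_mult g(1) simple_function_const)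
      also have "\<dots> \<le> (\<integral>\<^sup>+x. ennreal b * h x \<partial>M)"
        by (intro nn_integral_mono mult_left_mono g) simp
      finally show "ennreal b * integral\<^sup>S M g \<le> (\<integral>\<^sup>+x. ennreal b * h x \<partial>M)" .
    qed
    finally show ?thesis .
  qed
  have cancel: "ennreal c * (ennreal (1 / c) * y) = y" "ennreal (1 / c) * (ennreal c * y) = y" for y
    using assms by (simp_all add: mult.assoc[symmetric] ennreal_mult[symmetric])
  have "(\<integral>\<^sup>+x. ennreal c * f x \<partial>M) =
        ennreal c * (ennreal (1 / c) * (\<integral>\<^sup>+x. ennreal c * f x \<partial>M))"
    by (simp add: cancel)
  also have "\<dots> \<le> ennreal c * (\<integral>\<^sup>+x. f x \<partial>M)"
    using le[of "1 / c" "\<lambda>x. ennreal c * f x"] by (intro mult_left_mono) (simp_all add: cancel)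
  finally show ?thesis
    using le[of c f] by (intro antisym)
qed

lemma INF_cmult_pos:
  assumes "0 < c"
  shows "(INF i\<in>I. ennreal c * f i) = ennreal c * (INF i\<in>I. f i)"
proof -
  have le: "ennreal b * (INF i\<in>I. h i) \<le> (INF i\<in>I. ennreal b * h i)" for b h
    by (intro INF_greatest mult_left_mono INF_lower) simp_all
  have cancel: "ennreal c * (ennreal (1 / c) * y) = y" "ennreal (1 / c) * (ennreal c * y) = y" for y
    using assms by (simp_all add: mult.assoc[symmetric] ennreal_mult[symmetric])
  have "(INF i\<in>I. ennreal c * f i) = ennreal c * (ennreal (1 / c) * (INF i\<in>I. ennreal c * f i))"
    by (simp add: cancel)
  also have "\<dots> \<le> ennreal c * (INF i\<in>I. f i)"
    using le[of "1 / c" "\<lambda>i. ennreal c * f i"] by (intro mult_left_mono) (simp_all add: cancel)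
  finally show ?thesis
    using le[of c f] by (intro antisym)
qed

lemma speed_scale:
  assumes "0 < c"
  shows "speed A (\<lambda>k x. c\<^sup>2 *\<^sub>R g k x) \<gamma> t = c * speed A g \<gamma> t"
  using assms
  by (simp add: speed_def Let_def split_beta scaleR_matrix_vector_assoc[symmetric] real_sqrt_mult)

text \<open>
  The curves joining two points, and the chart chosen at each time, do not depend on the metric, so
  lengths and their infimum scale like the speed.
\<close>

lemma riemannian_dist_scale:
  assumes "0 < c"
  shows "riemannian_dist A (\<lambda>k x. c\<^sup>2 *\<^sub>R g k x) p q = c * riemannian_dist A g p q"
proof -
  have "curve_length A (\<lambda>k x. c\<^sup>2 *\<^sub>R g k x) \<gamma> = ennreal c * curve_length A g \<gamma>" for \<gamma>
    unfolding curve_length_def nn_integral_cmult_pos[OF assms, symmetric]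
    using assms by (simp add: speed_scale ennreal_mult' mult.assoc)
  then show ?thesis
    using assms by (simp add: riemannian_dist_def INF_cmult_pos enn2real_mult)
qed

section \<open>The substitution rule in coordinates\<close>

lemma set_nn_integral_eq_iff_absolutely_integrable:
  fixes F :: "'a::euclidean_space \<Rightarrow> real"
  assumes nonneg: "\<And>x. x \<in> \<Omega> \<Longrightarrow> 0 \<le> F x"
    and meas: "(\<lambda>x. indicator \<Omega> x * F x) \<in> borel_measurable lebesgue"
    and "0 \<le> r"
  shows "(\<integral>\<^sup>+x\<in>\<Omega>. ennreal (F x) \<partial>lborel) = ennreal r \<longleftrightarrow>
         F absolutely_integrable_on \<Omega> \<and> integral \<Omega> F = r"
proof -
  have restr: "(\<lambda>x. indicator \<Omega> x * F x) = (\<lambda>x. if x \<in> \<Omega> then F x else 0)"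
    by (auto simp: indicator_def)
  have "(\<integral>\<^sup>+x\<in>\<Omega>. ennreal (F x) \<partial>lborel) = (\<integral>\<^sup>+x. ennreal (indicator \<Omega> x * F x) \<partial>lebesgue)"
    unfolding nn_integral_completion by (intro nn_integral_cong) (auto simp: indicator_def)
  also have "\<dots> = ennreal r \<longleftrightarrow> ((\<lambda>x. indicator \<Omega> x * F x) has_integral r) UNIV"
    by (subst has_integral_iff_nn_integral_lebesgue) (use assms in \<open>auto simp: indicator_def\<close>)
  also have "\<dots> \<longleftrightarrow> (F has_integral r) \<Omega>"
    unfolding restr by (rule has_integral_restrict_UNIV)
  also have "\<dots> \<longleftrightarrow> F absolutely_integrable_on \<Omega> \<and> integral \<Omega> F = r"
    using nonneg nonnegative_absolutely_integrable_1[of F \<Omega>]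
    by (metis has_integral_iff set_lebesgue_integral_eq_integral(1))
  finally show ?thesis .
qed

text \<open>
  For nonnegative functions the substitution rule holds with values in \<open>[0, \<infinity>]\<close>: having a given
  finite integral is the same as being absolutely integrable with that integral, so the rule for
  absolutely integrable functions shows that both sides attain the same finite values.
\<close>

lemma nn_integral_change_of_variables_wellorder:
  fixes T :: "real^'m::{finite,wellorder} \<Rightarrow> real^'m::_" and f :: "real^'m::_ \<Rightarrow> real"
  assumes S: "S \<in> sets lebesgue"
    and der: "\<And>x. x \<in> S \<Longrightarrow> (T has_derivative T' x) (at x within S)"
    and inj: "inj_on T S"
    and nonneg: "\<And>y. y \<in> T ` S \<Longrightarrow> 0 \<le> f y"
    and meas: "(\<lambda>y. indicator (T ` S) y * f y) \<in> borel_measurable lebesgue"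
    and meas': "(\<lambda>x. indicator S x * (\<bar>det (matrix (T' x))\<bar> * f (T x))) \<in> borel_measurable lebesgue"
  shows "(\<integral>\<^sup>+y\<in>T ` S. ennreal (f y) \<partial>lborel) =
         (\<integral>\<^sup>+x\<in>S. ennreal (\<bar>det (matrix (T' x))\<bar> * f (T x)) \<partial>lborel)" (is "?L = ?R")
proof -
  have iff: "?L = ennreal r \<longleftrightarrow> ?R = ennreal r" if "0 \<le> r" for r
  proof -
    have "f absolutely_integrable_on T ` S \<and> integral (T ` S) f = r \<longleftrightarrow>
        (\<lambda>y. vec (f y) :: real^1) absolutely_integrable_on T ` S \<and>
        integral (T ` S) (\<lambda>y. vec (f y) :: real^1) = vec r"
      by (simp add: absolutely_integrable_on_1_iff integral_on_1_eq)
    also have "\<dots> \<longleftrightarrow>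
        (\<lambda>x. \<bar>det (matrix (T' x))\<bar> *\<^sub>R (vec (f (T x)) :: real^1)) absolutely_integrable_on S \<and>
        integral S (\<lambda>x. \<bar>det (matrix (T' x))\<bar> *\<^sub>R (vec (f (T x)) :: real^1)) = vec r"
      by (rule has_absolute_integral_change_of_variables[OF S der inj, symmetric])
    also have "\<dots> \<longleftrightarrow>
        (\<lambda>x. \<bar>det (matrix (T' x))\<bar> * f (T x)) absolutely_integrable_on S \<and>
        integral S (\<lambda>x. \<bar>det (matrix (T' x))\<bar> * f (T x)) = r"
      by (simp add: absolutely_integrable_on_1_iff integral_on_1_eq)
    finally show ?thesis
      using set_nn_integral_eq_iff_absolutely_integrable[OF nonneg meas that]
        set_nn_integral_eq_iff_absolutely_integrable[OF _ meas' that] nonneg by simp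
  qed
  show ?thesis
  proof (cases ?L)
    case (real r)
    then show ?thesis using iff[of r] by simp
  next
    case L: top
    show ?thesis
    proof (cases ?R)
      case (real r)
      then show ?thesis using iff[of r] by simp
    next
      case top
      then show ?thesis using L by simp
    qed
  qed
qed

text \<open>
  A copy of the index type \<open>'n\<close> that carries a well-order. Relabelling the coordinates along a
  bijection with this copy preserves Lebesgue measure and determinants, so the substitution rule
  passes from well-ordered index types to all finite ones.
\<close>

typedef 'n ord_index = "{..<CARD('n::finite)}"
  by (rule exI[of _ 0]) simp

instantiation ord_index :: (finite) linorder
begin
definition "a < b \<longleftrightarrow> Rep_ord_index a < Rep_ord_index b"
definition "a \<le> b \<longleftrightarrow> Rep_ord_index a \<le> Rep_ord_index b"
instance
  by intro_classes (auto simp: less_ord_index_def less_eq_ord_index_def Rep_ord_index_inject)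
end

instance ord_index :: (finite) finite
proof
  show "finite (UNIV :: 'a ord_index set)"
    unfolding type_definition.Abs_image[OF type_definition_ord_index, symmetric] by simp
qed

instance ord_index :: (finite) wellorder
proof -
  have "wf {(x :: 'a ord_index, y). x < y}"
    by (auto simp: trancl_def tranclp_less intro!: finite_acyclic_wf acyclicI)
  then show "OFCLASS('a ord_index, wellorder_class)"
    by (rule wf_wellorderI) intro_classes
qed

lemma CARD_ord_index: "CARD('n::finite ord_index) = CARD('n)"
  by (simp add: type_definition.card[OF type_definition_ord_index])

text \<open>
  Transporting permutations along \<open>\<sigma>\<close> is a bijection that preserves signs.
\<close>

lemma det_reindex:
  fixes A :: "real^'n^'n" and \<sigma> :: "'m::finite \<Rightarrow> 'n::finite"
  assumes "bij \<sigma>"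
  shows "det (\<chi> i j. A $ \<sigma> i $ \<sigma> j) = det A"
proof -
  have inj: "inj \<sigma>" and surj: "range \<sigma> = UNIV"
    using assms by (auto simp: bij_def)
  have bij: "bij_betw (map_permutation UNIV \<sigma>) {p. p permutes UNIV} {p. p permutes UNIV}"
  proof (rule bij_betw_byWitness[where f' = "map_permutation UNIV (inv \<sigma>)"])
    show "\<forall>p\<in>{p. p permutes UNIV}. map_permutation UNIV (inv \<sigma>) (map_permutation UNIV \<sigma> p) = p"
      using assms inj by (auto intro!: map_permutation_compose_inv)
    show "\<forall>p\<in>{p. p permutes UNIV}. map_permutation UNIV \<sigma> (map_permutation UNIV (inv \<sigma>) p) = p"
      using assms surj by (auto intro!: map_permutation_compose_inv bij_imp_bij_inv simp: surj_f_inv_f)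
    show "map_permutation UNIV \<sigma> ` {p. p permutes UNIV} \<subseteq> {p. p permutes UNIV}"
      using map_permutation_permutes[of \<sigma> UNIV UNIV] assms by auto
    show "map_permutation UNIV (inv \<sigma>) ` {p. p permutes UNIV} \<subseteq> {p. p permutes UNIV}"
      using map_permutation_permutes[of "inv \<sigma>" UNIV UNIV] assms by (auto simp: bij_imp_bij_inv)
  qed
  have "det A = (\<Sum>p | p permutes UNIV. of_int (sign (map_permutation UNIV \<sigma> p)) *
                 (\<Prod>i\<in>UNIV. A $ i $ map_permutation UNIV \<sigma> p i))"
    unfolding det_def by (rule sum.reindex_bij_betw[OF bij, symmetric])
  also have "\<dots> = (\<Sum>p | p permutes UNIV. of_int (sign p) * (\<Prod>i\<in>UNIV. A $ \<sigma> i $ \<sigma> (p i)))"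
  proof (rule sum.cong[OF refl])
    fix p :: "'m \<Rightarrow> 'm" assume p: "p \<in> {p. p permutes UNIV}"
    have "(\<Prod>i\<in>UNIV. A $ i $ map_permutation UNIV \<sigma> p i) =
          (\<Prod>i\<in>UNIV. A $ \<sigma> i $ map_permutation UNIV \<sigma> p (\<sigma> i))"
      by (rule prod.reindex_bij_betw[OF assms, symmetric])
    also have "\<dots> = (\<Prod>i\<in>UNIV. A $ \<sigma> i $ \<sigma> (p i))"
      by (simp add: map_permutation_apply[OF inj])
    finally show "of_int (sign (map_permutation UNIV \<sigma> p)) * (\<Prod>i\<in>UNIV. A $ i $ map_permutation UNIV \<sigma> p i)
        = of_int (sign p) * (\<Prod>i\<in>UNIV. A $ \<sigma> i $ \<sigma> (p i))"
      using p by (simp add: sign_map_permutation[OF inj])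
  qed
  finally show ?thesis
    by (simp add: det_def)
qed

lemma lborel_distr_reindex:
  fixes \<sigma> :: "'m::finite \<Rightarrow> 'n::finite"
  assumes "bij \<sigma>"
  shows "distr lborel borel (\<lambda>x::real^'n. \<chi> i. x $ \<sigma> i) = lborel"
proof (rule lborel_eqI[symmetric])
  let ?P = "\<lambda>x::real^'n. (\<chi> i. x $ \<sigma> i) :: real^'m"
  have [measurable]: "?P \<in> borel_measurable borel"
    by (intro borel_measurable_continuous_onI continuous_intros)
  fix l u :: "real^'m" assume le: "\<And>b. b \<in> Basis \<Longrightarrow> l \<bullet> b \<le> u \<bullet> b"
  let ?Q = "\<lambda>x::real^'m. (\<chi> i. x $ inv \<sigma> i) :: real^'n"
  have le': "l $ i \<le> u $ i" for i
    using le[of "axis i 1"] by (simp add: inner_axis)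
  have "x \<in> ?P -` box l u \<longleftrightarrow> x \<in> box (?Q l) (?Q u)" for x
    unfolding vimage_eq mem_box_cart
    using assms by (auto simp: bij_def) (metis inv_f_f surj_f_inv_f)+
  then have "?P -` box l u = box (?Q l) (?Q u)"
    by blast
  then have "emeasure (distr lborel borel ?P) (box l u) = emeasure lborel (box (?Q l) (?Q u))"
    by (simp add: emeasure_distr)
  also have "\<dots> = ennreal (\<Prod>b\<in>Basis. (?Q u - ?Q l) \<bullet> b)"
    by (rule emeasure_lborel_box) (use le' in \<open>auto simp: Basis_vec_def inner_axis\<close>)
  also have "(\<Prod>b\<in>Basis. (?Q u - ?Q l) \<bullet> b) = (\<Prod>i\<in>UNIV. u $ inv \<sigma> i - l $ inv \<sigma> i)"
    by (simp add: Basis_vec_def UNION_singleton_eq_range prod.reindex inj_on_def axis_eq_axis inner_axis)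
  also have "\<dots> = (\<Prod>i\<in>UNIV. u $ i - l $ i)"
    by (rule prod.reindex_bij_betw[OF bij_imp_bij_inv[OF assms]])
  also have "\<dots> = (\<Prod>b\<in>Basis. (u - l) \<bullet> b)"
    by (simp add: Basis_vec_def UNION_singleton_eq_range prod.reindex inj_on_def axis_eq_axis inner_axis)
  finally show "emeasure (distr lborel borel ?P) (box l u) = ennreal (\<Prod>b\<in>Basis. (u - l) \<bullet> b)" .
qed simp

lemma nn_integral_change_of_variables:
  fixes T :: "real^'n::finite \<Rightarrow> real^'n" and f :: "real^'n \<Rightarrow> real"
  assumes S: "S \<in> sets borel" and TS: "T ` S \<in> sets borel"
    and der: "\<And>x. x \<in> S \<Longrightarrow> (T has_derivative T' x) (at x within S)"
    and inj: "inj_on T S"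
    and nonneg: "\<And>y. y \<in> T ` S \<Longrightarrow> 0 \<le> f y"
    and meas: "(\<lambda>y. indicator (T ` S) y * f y) \<in> borel_measurable borel"
    and meas': "(\<lambda>x. indicator S x * (\<bar>det (matrix (T' x))\<bar> * f (T x))) \<in> borel_measurable borel"
  shows "(\<integral>\<^sup>+y\<in>T ` S. ennreal (f y) \<partial>lborel) =
         (\<integral>\<^sup>+x\<in>S. ennreal (\<bar>det (matrix (T' x))\<bar> * f (T x)) \<partial>lborel)"
proof -
  obtain \<sigma> :: "'n ord_index \<Rightarrow> 'n" where \<sigma>: "bij \<sigma>"
    using finite_same_card_bij[of "UNIV :: 'n ord_index set" "UNIV :: 'n set"]
    by (auto simp: CARD_ord_index)
  define P :: "real^'n \<Rightarrow> real^'n ord_index" where "P x = (\<chi> i. x $ \<sigma> i)" for x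
  define Q :: "real^'n ord_index \<Rightarrow> real^'n" where "Q x = (\<chi> i. x $ inv \<sigma> i)" for x
  have QP [simp]: "Q (P x) = x" and PQ [simp]: "P (Q y) = y" for x y
    using \<sigma> by (auto simp: P_def Q_def vec_eq_iff bij_def surj_f_inv_f)
  have lin: "linear P" "linear Q"
    by (auto intro!: linearI simp: P_def Q_def vec_eq_iff)
  then have bl: "bounded_linear P" "bounded_linear Q"
    by (auto simp: linear_conv_bounded_linear)
  have P_meas [measurable]: "P \<in> borel_measurable borel" and Q_meas [measurable]: "Q \<in> borel_measurable borel"
    using bl by (auto intro!: borel_measurable_continuous_onI linear_continuous_on)
  have distr_Q: "distr lborel borel Q = lborel"
    unfolding Q_def[abs_def] by (rule lborel_distr_reindex[OF bij_imp_bij_inv[OF \<sigma>]])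
  have PQ_image: "P ` X = Q -` X" for X
    by (auto simp: image_iff) (metis PQ)
  have ind_Q: "indicator X (Q y) = indicator (P ` X) y" for X y
    by (auto simp: indicator_def PQ_image)

  define T\<^sub>o where "T\<^sub>o = P \<circ> T \<circ> Q"
  define D where "D y = P \<circ> T' (Q y) \<circ> Q" for y
  have T\<^sub>o_image: "T\<^sub>o ` P ` S = P ` T ` S"
    by (simp add: T\<^sub>o_def image_comp o_def)
  have det_D: "det (matrix (D y)) = det (matrix (T' (Q y)))" for y
  proof -
    have Q_axis: "Q (axis j 1) = axis (\<sigma> j) 1" for j
      using \<sigma> by (auto simp: Q_def vec_eq_iff axis_def bij_def surj_f_inv_f)
    have "matrix (D y) = (\<chi> i j. matrix (T' (Q y)) $ \<sigma> i $ \<sigma> j)"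
      by (simp add: matrix_def D_def Q_axis vec_eq_iff P_def)
    then show ?thesis
      by (simp add: det_reindex[OF \<sigma>])
  qed
  have [measurable]: "S \<in> sets borel" "T ` S \<in> sets borel"
    by fact+
  have PS: "P ` S \<in> sets borel"
    using measurable_sets[OF Q_meas S] by (simp add: PQ_image)
  note [measurable] = meas meas'
  have "(\<integral>\<^sup>+y\<in>T ` S. ennreal (f y) \<partial>lborel) = (\<integral>\<^sup>+y. ennreal (indicator (T ` S) y * f y) \<partial>distr lborel borel Q)"
    unfolding distr_Q by (intro nn_integral_cong) (auto simp: indicator_def)
  also have "\<dots> = (\<integral>\<^sup>+y. ennreal (indicator (T ` S) (Q y) * f (Q y)) \<partial>lborel)"
    by (subst nn_integral_distr) simp_all
  also have "\<dots> = (\<integral>\<^sup>+y\<in>T\<^sub>o ` P ` S. ennreal (f (Q y)) \<partial>lborel)"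
    unfolding ind_Q T\<^sub>o_image by (intro nn_integral_cong) (auto simp: indicator_def)
  also have "\<dots> = (\<integral>\<^sup>+x\<in>P ` S. ennreal (\<bar>det (matrix (D x))\<bar> * f (Q (T\<^sub>o x))) \<partial>lborel)"
  proof (rule nn_integral_change_of_variables_wellorder)
    show "P ` S \<in> sets lebesgue"
      using PS by (simp add: sets_completionI_sets)
    show "(T\<^sub>o has_derivative D y) (at y within P ` S)" if "y \<in> P ` S" for y
    proof -
      from that obtain x where x: "x \<in> S" "y = P x" by blast
      have "Q ` P ` S = S"
        by (simp add: image_comp o_def)
      then have "(T has_derivative T' (Q y)) (at (Q y) within Q ` P ` S)"
        using der[of x] x by simp
      moreover have "(Q has_derivative Q) (at y within P ` S)"
        by (rule bounded_linear_imp_has_derivative[OF bl(2)])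
      ultimately have "(T \<circ> Q has_derivative T' (Q y) \<circ> Q) (at y within P ` S)"
        by (intro diff_chain_within)
      then have "(P \<circ> (T \<circ> Q) has_derivative P \<circ> (T' (Q y) \<circ> Q)) (at y within P ` S)"
        by (rule diff_chain_within) (rule bounded_linear_imp_has_derivative[OF bl(1)])
      then show ?thesis
        by (simp add: T\<^sub>o_def D_def comp_assoc)
    qed
    show "inj_on T\<^sub>o (P ` S)"
    proof (rule inj_onI)
      fix x y assume "x \<in> P ` S" "y \<in> P ` S" "T\<^sub>o x = T\<^sub>o y"
      then obtain a b where ab: "a \<in> S" "b \<in> S" "x = P a" "y = P b" "P (T a) = P (T b)"
        by (auto simp: T\<^sub>o_def)
      then have "T a = T b"
        by (metis QP)
      then show "x = y"
        using ab inj by (auto simp: inj_on_def)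
    qed
    show "0 \<le> f (Q y)" if "y \<in> T\<^sub>o ` P ` S" for y
      using that nonneg by (auto simp: T\<^sub>o_image)
    have "(\<lambda>y. indicator (T ` S) (Q y) * f (Q y)) \<in> borel_measurable borel"
      by (rule measurable_compose[OF Q_meas meas])
    then have "(\<lambda>y. indicator (T\<^sub>o ` P ` S) y * f (Q y)) \<in> borel_measurable lborel"
      by (simp add: ind_Q T\<^sub>o_image)
    then show "(\<lambda>y. indicator (T\<^sub>o ` P ` S) y * f (Q y)) \<in> borel_measurable lebesgue"
      by (rule measurable_completion)
    have "(\<lambda>y. indicator S (Q y) * (\<bar>det (matrix (T' (Q y)))\<bar> * f (T (Q y)))) \<in> borel_measurable borel"
      by (rule measurable_compose[OF Q_meas meas'])
    then have "(\<lambda>y. indicator (P ` S) y * (\<bar>det (matrix (D y))\<bar> * f (Q (T\<^sub>o y)))) \<in> borel_measurable lborel"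
      by (simp add: ind_Q det_D T\<^sub>o_def)
    then show "(\<lambda>y. indicator (P ` S) y * (\<bar>det (matrix (D y))\<bar> * f (Q (T\<^sub>o y)))) \<in> borel_measurable lebesgue"
      by (rule measurable_completion)
  qed
  also have "\<dots> = (\<integral>\<^sup>+x. ennreal (indicator S (Q x) * (\<bar>det (matrix (T' (Q x)))\<bar> * f (T (Q x)))) \<partial>lborel)"
    unfolding ind_Q det_D by (intro nn_integral_cong) (auto simp: T\<^sub>o_def indicator_def)
  also have "\<dots> = (\<integral>\<^sup>+x. ennreal (indicator S x * (\<bar>det (matrix (T' x))\<bar> * f (T x))) \<partial>distr lborel borel Q)"
    by (subst nn_integral_distr) simp_all
  also have "\<dots> = (\<integral>\<^sup>+x\<in>S. ennreal (\<bar>det (matrix (T' x))\<bar> * f (T x)) \<partial>lborel)"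
    unfolding distr_Q by (intro nn_integral_cong) (auto simp: indicator_def)
  finally show ?thesis .
qed

section \<open>The Riemannian volume measure\<close>

text \<open>
  The property that the definite description \<^const>\<open>riemannian_volume\<close> refers to.
\<close>

definition is_riemannian_volume ::
  "('a::topological_space, 'n::finite) chart set \<Rightarrow> ('a, 'n) tensor2 \<Rightarrow> 'a measure \<Rightarrow> bool" where
  "is_riemannian_volume A g \<nu> \<longleftrightarrow> sets \<nu> = sets borel \<and>
     (\<forall>(U, \<phi>)\<in>A. \<forall>B\<in>sets borel. B \<subseteq> U \<longrightarrow>
        emeasure \<nu> B = (\<integral>\<^sup>+ x\<in>\<phi> ` B. ennreal (sqrt (det (g (U, \<phi>) x))) \<partial>lborel))"

lemma is_riemannian_volumeD:
  assumes "is_riemannian_volume A g \<nu>"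
  shows "sets \<nu> = sets borel" and "space \<nu> = UNIV"
    and "(U, \<phi>) \<in> A \<Longrightarrow> B \<in> sets borel \<Longrightarrow> B \<subseteq> U \<Longrightarrow>
      emeasure \<nu> B = (\<integral>\<^sup>+ x\<in>\<phi> ` B. ennreal (sqrt (det (g (U, \<phi>) x))) \<partial>lborel)"
  using assms sets_eq_imp_space_eq[of \<nu> borel] by (auto simp: is_riemannian_volume_def)

lemma smooth_atlasD:
  assumes "smooth_atlas A" "(U, \<phi>) \<in> A"
  shows "open U" "open (\<phi> ` U)" "homeomorphism U (\<phi> ` U) \<phi> (inv_into U \<phi>)" "inj_on \<phi> U"
    and "(V, \<psi>) \<in> A \<Longrightarrow> smooth_on (\<psi> \<circ> inv_into U \<phi>) (\<phi> ` (U \<inter> V))"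
proof -
  show *: "open U" "open (\<phi> ` U)" "homeomorphism U (\<phi> ` U) \<phi> (inv_into U \<phi>)"
    "(V, \<psi>) \<in> A \<Longrightarrow> smooth_on (\<psi> \<circ> inv_into U \<phi>) (\<phi> ` (U \<inter> V))"
    using assms by (auto simp: smooth_atlas_def)
  show "inj_on \<phi> U"
    by (rule inj_on_inverseI[of _ "inv_into U \<phi>"]) (use *(3) in \<open>auto simp: homeomorphism_def\<close>)
qed

lemma chart_image_borel:
  assumes "smooth_atlas A" "(U, \<phi>) \<in> A" "B \<in> sets borel" "B \<subseteq> U"
  shows "\<phi> ` B \<in> sets borel"
proof -
  note ch = smooth_atlasD[OF assms(1,2)]
  have "inv_into U \<phi> \<in> borel_measurable (restrict_space borel (\<phi> ` U))"
    using ch(3) by (intro borel_measurable_continuous_on_restrict) (auto simp: homeomorphism_def)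
  from measurable_sets[OF this assms(3)]
  have "inv_into U \<phi> -` B \<inter> \<phi> ` U \<in> sets (restrict_space borel (\<phi> ` U))"
    by (simp add: space_restrict_space)
  moreover have "inv_into U \<phi> -` B \<inter> \<phi> ` U = \<phi> ` B"
    using ch(4) assms(4) by (auto simp: inv_into_f_f)
  ultimately show ?thesis
    using ch(2) by (simp add: sets_restrict_space_iff)
qed

text \<open>
  Second countability reduces the atlas to countably many chart domains; each point is then assigned
  to the first of them that contains it.
\<close>

lemma countable_borel_partition_by_charts:
  fixes A :: "('a::{second_countable_topology, t2_space}, 'n::finite) chart set"
  assumes "smooth_atlas A"
  obtains U \<phi> D where "\<And>n::nat. (U n, \<phi> n) \<in> A" "\<And>n. D n \<in> sets borel" "\<And>n. D n \<subseteq> U n"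
    "disjoint_family D" "(\<Union>n. D n) = UNIV"
proof -
  have "open S" if "S \<in> fst ` A" for S
    using that smooth_atlasD(1)[OF assms] by auto
  then obtain F where F: "F \<subseteq> fst ` A" "countable F" "\<Union>F = \<Union>(fst ` A)"
    using Lindelof[of "fst ` A"] by blast
  have cover: "\<Union>F = UNIV"
    using assms F(3) by (auto simp: smooth_atlas_def split_beta)
  define U where "U = from_nat_into F"
  have range_U: "range U = F"
    unfolding U_def using F(2) cover by (intro range_from_nat_into) auto
  have "\<exists>\<phi>. (U n, \<phi>) \<in> A" for n
  proof -
    have "U n \<in> fst ` A"
      using range_U F(1) by blast
    then show ?thesis
      by (metis imageE prod.collapse)
  qed
  then obtain \<phi> where \<phi>: "\<And>n. (U n, \<phi> n) \<in> A" by metis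
  have U_open: "open (U n)" for n
    using smooth_atlasD(1)[OF assms \<phi>] .
  show thesis
  proof (rule that[OF \<phi>])
    show "disjointed U n \<in> sets borel" for n
      using U_open by (auto simp: disjointed_def)
    show "disjointed U n \<subseteq> U n" for n by (rule disjointed_subset)
    show "disjoint_family (disjointed U)" by (rule disjoint_family_disjointed)
    show "(\<Union>n. disjointed U n) = UNIV"
      using range_U cover by (simp add: UN_disjointed_eq)
  qed
qed

text \<open>
  The pieces \<open>B \<inter> D n\<close> lie in chart domains, where the value of the measure is prescribed.
\<close>

lemma is_riemannian_volume_unique:
  fixes A :: "('a::{second_countable_topology, t2_space}, 'n::finite) chart set"
  assumes "smooth_atlas A" "is_riemannian_volume A g \<nu>" "is_riemannian_volume A g \<nu>'"
  shows "\<nu> = \<nu>'"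
proof (rule measure_eqI)
  note v = is_riemannian_volumeD[OF assms(2)] and v' = is_riemannian_volumeD[OF assms(3)]
  show "sets \<nu> = sets \<nu>'" by (simp add: v v')
  fix B assume "B \<in> sets \<nu>"
  then have B: "B \<in> sets borel" by (simp add: v)
  obtain U \<phi> D where D: "\<And>n::nat. (U n, \<phi> n) \<in> A" "\<And>n. D n \<in> sets borel" "\<And>n. D n \<subseteq> U n"
    "disjoint_family D" "(\<Union>n. D n) = UNIV"
    using countable_borel_partition_by_charts[OF assms(1)] by blast
  have disj: "disjoint_family (\<lambda>n. B \<inter> D n)"
    using D(4) by (auto simp: disjoint_family_on_def)
  have un: "(\<Union>n. B \<inter> D n) = B"
    using D(5) by auto
  have "emeasure \<nu> (B \<inter> D n) = emeasure \<nu>' (B \<inter> D n)" for n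
    using B D(2,3) by (subst v(3)[OF D(1)[of n]] v'(3)[OF D(1)[of n]]; auto)+
  then have "(\<Sum>n. emeasure \<nu> (B \<inter> D n)) = (\<Sum>n. emeasure \<nu>' (B \<inter> D n))"
    by simp
  then show "emeasure \<nu> B = emeasure \<nu>' B"
    using B D(2) disj by (subst (asm) (1 2) suminf_emeasure) (auto simp: v v' un simp del: Int_UN_distrib UN_simps)
qed

lemma riemannian_volume_eqI:
  fixes A :: "('a::{second_countable_topology, t2_space}, 'n::finite) chart set"
  assumes "smooth_atlas A" "is_riemannian_volume A g \<nu>"
  shows "riemannian_volume A g = \<nu>"
  unfolding riemannian_volume_def is_riemannian_volume_def[symmetric]
  using assms is_riemannian_volume_unique[OF assms(1)] by (intro the_equality) auto

lemma continuous_on_det: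
  fixes M :: "'x::topological_space \<Rightarrow> real^'n::finite^'n"
  shows "continuous_on S M \<Longrightarrow> continuous_on S (\<lambda>x. det (M x))"
  unfolding det_def by (intro continuous_intros)

lemma continuous_on_volume_density:
  assumes "riemannian_metric A g" "(U, \<phi>) \<in> A"
  shows "continuous_on (\<phi> ` U) (\<lambda>x. sqrt (det (g (U, \<phi>) x)))"
proof -
  have "smooth_on (g (U, \<phi>)) (\<phi> ` U)"
    using assms unfolding riemannian_metric_def by blast
  then have "Ck_on 0 (g (U, \<phi>)) (\<phi> ` U)"
    unfolding smooth_on_def by blast
  then have "continuous_on (\<phi> ` U) (g (U, \<phi>))"
    by simp
  then show ?thesis
    by (intro continuous_on_real_sqrt continuous_on_det)
qed

lemma volume_density_measurable:
  assumes "smooth_atlas A" "riemannian_metric A g" "(U, \<phi>) \<in> A" "B \<in> sets borel" "B \<subseteq> U"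
  shows "(\<lambda>x. indicator (\<phi> ` B) x * sqrt (det (g (U, \<phi>) x))) \<in> borel_measurable borel"
proof -
  have "continuous_on (\<phi> ` B) (\<lambda>x. sqrt (det (g (U, \<phi>) x)))"
    by (rule continuous_on_subset[OF continuous_on_volume_density[OF assms(2,3)]])
      (use assms(5) in blast)
  from borel_measurable_continuous_on_indicator[OF chart_image_borel[OF assms(1,3-5)] this]
  show ?thesis by simp
qed

text \<open>
  The transformation law \<open>g\<^sub>\<phi> = J\<^sup>T g\<^sub>\<psi> J\<close>, with \<open>J\<close> the Jacobian of the transition map \<open>T = \<psi> \<circ> \<phi>\<^sup>-\<^sup>1\<close>,
  gives \<open>sqrt (det g\<^sub>\<phi>) = \<bar>det J\<bar> sqrt (det g\<^sub>\<psi>)\<close>, which is the Jacobian factor of the substitution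
  rule for \<open>T\<close>.
\<close>

lemma volume_integral_chart_independent:
  fixes A :: "('a::{second_countable_topology, t2_space}, 'n::finite) chart set"
  assumes A: "smooth_atlas A" and g: "riemannian_metric A g"
    and U: "(U, \<phi>) \<in> A" and V: "(V, \<psi>) \<in> A"
    and B: "B \<in> sets borel" "B \<subseteq> U \<inter> V"
  shows "(\<integral>\<^sup>+x\<in>\<psi> ` B. ennreal (sqrt (det (g (V, \<psi>) x))) \<partial>lborel) =
         (\<integral>\<^sup>+x\<in>\<phi> ` B. ennreal (sqrt (det (g (U, \<phi>) x))) \<partial>lborel)"
proof -
  note chU = smooth_atlasD[OF A U] and chV = smooth_atlasD[OF A V]
  define T where "T = \<psi> \<circ> inv_into U \<phi>"
  define J where "J x = frechet_derivative T (at x)" for x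
  have T\<phi>: "T (\<phi> p) = \<psi> p" if "p \<in> U" for p
    using that chU(4) by (simp add: T_def inv_into_f_f)
  have T_image: "T ` \<phi> ` B = \<psi> ` B"
    using B(2) T\<phi> by (force simp: image_image)
  have "Ck_on (Suc 0) T (\<phi> ` (U \<inter> V))"
    using chU(5)[OF V] unfolding smooth_on_def T_def by blast
  then have T_deriv: "(T has_derivative J x) (at x)" if "x \<in> \<phi> ` B" for x
    using that B(2) unfolding J_def by (auto simp: frechet_derivative_works[symmetric])
  \<comment> \<open>the truncation makes the density nonnegative everywhere without changing its integral, which
    ignores negative values\<close>
  define w where "w k x = max 0 (sqrt (det (g k x)))" for k x
  have ennreal_w: "ennreal (sqrt (det (g k x))) = ennreal (w k x)" for k x
    by (simp add: w_def max_def ennreal_neg)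
  have w_meas: "(\<lambda>x. indicator (\<theta> ` B) x * w (X, \<theta>) x) \<in> borel_measurable borel"
    if "(X, \<theta>) \<in> A" "B \<subseteq> X" for X \<theta>
  proof -
    note volume_density_measurable[OF A g that(1) B(1) that(2), measurable]
    have "(\<lambda>x. max 0 (indicator (\<theta> ` B) x * sqrt (det (g (X, \<theta>) x)))) \<in> borel_measurable borel"
      by measurable
    also have "(\<lambda>x. max 0 (indicator (\<theta> ` B) x * sqrt (det (g (X, \<theta>) x)))) =
        (\<lambda>x. indicator (\<theta> ` B) x * w (X, \<theta>) x)"
      by (auto simp: w_def indicator_def)
    finally show ?thesis .
  qed
  have dens: "\<bar>det (matrix (J x))\<bar> * w (V, \<psi>) (T x) = w (U, \<phi>) x" if "x \<in> \<phi> ` B" for x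
  proof -
    from that B(2) obtain p where p: "p \<in> U \<inter> V" "x = \<phi> p" by blast
    have "g (U, \<phi>) x = transpose (matrix (J x)) ** g (V, \<psi>) (\<psi> p) ** matrix (J x)"
      using g U V p unfolding riemannian_metric_def J_def T_def Let_def by blast
    then have "det (g (U, \<phi>) x) = (det (matrix (J x)))\<^sup>2 * det (g (V, \<psi>) (T x))"
      using p by (simp add: det_mul T\<phi> power2_eq_square)
    then show ?thesis
      by (simp add: w_def real_sqrt_mult max_mult_distrib_left)
  qed
  have BU: "B \<subseteq> U" and BV: "B \<subseteq> V"
    using B by auto
  have "(\<integral>\<^sup>+x\<in>T ` \<phi> ` B. ennreal (w (V, \<psi>) x) \<partial>lborel) =
        (\<integral>\<^sup>+x\<in>\<phi> ` B. ennreal (\<bar>det (matrix (J x))\<bar> * w (V, \<psi>) (T x)) \<partial>lborel)"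
  proof (rule nn_integral_change_of_variables)
    show "\<phi> ` B \<in> sets borel"
      by (rule chart_image_borel[OF A U B(1) BU])
    show "T ` \<phi> ` B \<in> sets borel"
      unfolding T_image by (rule chart_image_borel[OF A V B(1) BV])
    show "(T has_derivative J x) (at x within \<phi> ` B)" if "x \<in> \<phi> ` B" for x
      using T_deriv[OF that] by (rule has_derivative_at_withinI)
    show "inj_on T (\<phi> ` B)"
    proof (rule inj_onI)
      fix x y assume "x \<in> \<phi> ` B" "y \<in> \<phi> ` B" and eq: "T x = T y"
      then obtain p q where pq: "p \<in> B" "q \<in> B" "x = \<phi> p" "y = \<phi> q"
        by blast
      then have "\<psi> p = \<psi> q"
        using eq BU T\<phi>[of p] T\<phi>[of q] by (metis subsetD)
      then show "x = y"
        using pq BV inj_onD[OF chV(4)] by auto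
    qed
    show "0 \<le> w (V, \<psi>) y" for y
      by (simp add: w_def)
    show "(\<lambda>y. indicator (T ` \<phi> ` B) y * w (V, \<psi>) y) \<in> borel_measurable borel"
      unfolding T_image by (rule w_meas[OF V BV])
    have "(\<lambda>x. indicator (\<phi> ` B) x * (\<bar>det (matrix (J x))\<bar> * w (V, \<psi>) (T x))) =
          (\<lambda>x. indicator (\<phi> ` B) x * w (U, \<phi>) x)"
      using dens by (auto simp: indicator_def)
    then show "(\<lambda>x. indicator (\<phi> ` B) x * (\<bar>det (matrix (J x))\<bar> * w (V, \<psi>) (T x)))
        \<in> borel_measurable borel"
      using w_meas[OF U BU] by simp
  qed
  also have "\<dots> = (\<integral>\<^sup>+x\<in>\<phi> ` B. ennreal (w (U, \<phi>) x) \<partial>lborel)"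
    using dens by (intro nn_integral_cong) (auto simp: indicator_def)
  finally show ?thesis
    by (simp add: T_image ennreal_w)
qed

lemma measure_of_series:
  fixes m :: "nat \<Rightarrow> 'a measure"
  assumes sets: "\<And>n. sets (m n) = sets M"
  obtains \<nu> where "sets \<nu> = sets M" "\<And>B. B \<in> sets M \<Longrightarrow> emeasure \<nu> B = (\<Sum>n. emeasure (m n) B)"
proof -
  define \<nu> where "\<nu> = measure_of (space M) (sets M) (\<lambda>B. \<Sum>n. emeasure (m n) B)"
  show thesis
  proof (rule that[of \<nu>])
    show "sets \<nu> = sets M"
      by (simp add: \<nu>_def)
    fix B assume B: "B \<in> sets M"
    show "emeasure \<nu> B = (\<Sum>n. emeasure (m n) B)"
      unfolding \<nu>_def
    proof (rule emeasure_measure_of_sigma[OF sets.sigma_algebra_axioms _ _ B])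
      show "positive (sets M) (\<lambda>B. \<Sum>n. emeasure (m n) B)"
        by (simp add: positive_def)
      show "countably_additive (sets M) (\<lambda>B. \<Sum>n. emeasure (m n) B)"
      proof (rule countably_additiveI)
        fix C :: "nat \<Rightarrow> 'a set" assume C: "range C \<subseteq> sets M" "disjoint_family C"
        have "(\<Sum>i. \<Sum>n. emeasure (m n) (C i)) = (\<Sum>i. \<integral>\<^sup>+n. emeasure (m n) (C i) \<partial>count_space UNIV)"
          by (simp add: nn_integral_count_space_nat)
        also have "\<dots> = (\<integral>\<^sup>+n. (\<Sum>i. emeasure (m n) (C i)) \<partial>count_space UNIV)"
          by (rule nn_integral_suminf[symmetric]) simp
        also have "\<dots> = (\<Sum>n. \<Sum>i. emeasure (m n) (C i))"
          by (simp add: nn_integral_count_space_nat)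
        also have "\<dots> = (\<Sum>n. emeasure (m n) (\<Union>i. C i))"
          using C by (simp add: suminf_emeasure sets)
        finally show "(\<Sum>i. \<Sum>n. emeasure (m n) (C i)) = (\<Sum>n. emeasure (m n) (\<Union> (range C)))" .
      qed
    qed
  qed
qed

text \<open>
  The part of the volume carried by a piece \<open>D\<close> of a chart domain: the density on the image of \<open>D\<close>,
  pushed forward along the inverse of the chart.
\<close>

lemma chart_volume_measure:
  fixes A :: "('a::{second_countable_topology, t2_space}, 'n::finite) chart set"
  assumes A: "smooth_atlas A" and g: "riemannian_metric A g" and U: "(U, \<phi>) \<in> A"
    and D: "D \<in> sets borel" "D \<subseteq> U"
  obtains m where "sets m = sets (borel :: 'a measure)"
    "\<And>B. B \<in> sets borel \<Longrightarrow>
      emeasure m B = (\<integral>\<^sup>+ x\<in>\<phi> ` (B \<inter> D). ennreal (sqrt (det (g (U, \<phi>) x))) \<partial>lborel)"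
proof -
  note ch = smooth_atlasD[OF A U]
  define w where "w x = indicator (\<phi> ` D) x * sqrt (det (g (U, \<phi>) x))" for x
  have w [measurable]: "w \<in> borel_measurable borel"
    unfolding w_def by (rule volume_density_measurable[OF A g U D])
  define \<theta> where "\<theta> x = (if x \<in> \<phi> ` U then inv_into U \<phi> x else undefined)" for x
  have \<theta> [measurable]: "\<theta> \<in> borel_measurable borel"
    unfolding \<theta>_def using ch
    by (intro borel_measurable_continuous_on_if) (auto simp: homeomorphism_def continuous_on_const)
  define m where "m = distr (density lborel (\<lambda>x. ennreal (w x))) borel \<theta>"
  show thesis
  proof (rule that)
    show "sets m = sets borel" by (simp add: m_def)
    fix B :: "'a set" assume B [measurable]: "B \<in> sets borel"
    have "emeasure m B = (\<integral>\<^sup>+x. ennreal (w x) * indicator (\<theta> -` B) x \<partial>lborel)"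
      using measurable_sets[OF \<theta> B]
      by (simp add: m_def emeasure_distr emeasure_density)
    also have "\<dots> = (\<integral>\<^sup>+ x\<in>\<phi> ` (B \<inter> D). ennreal (sqrt (det (g (U, \<phi>) x))) \<partial>lborel)"
    proof (rule nn_integral_cong)
      fix x
      have "x \<in> \<phi> ` (B \<inter> D) \<longleftrightarrow> x \<in> \<phi> ` D \<and> \<theta> x \<in> B"
        using D(2) ch(4) by (auto simp: \<theta>_def inv_into_f_f subset_iff)
      then show "ennreal (w x) * indicator (\<theta> -` B) x =
          ennreal (sqrt (det (g (U, \<phi>) x))) * indicator (\<phi> ` (B \<inter> D)) x"
        by (auto simp: w_def indicator_def)
    qed
    finally show "emeasure m B = (\<integral>\<^sup>+ x\<in>\<phi> ` (B \<inter> D). ennreal (sqrt (det (g (U, \<phi>) x))) \<partial>lborel)" .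
  qed
qed

text \<open>
  The sum of the volumes carried by the pieces of a countable partition has the prescribed values on
  every chart domain, since the part carried by a piece \<open>D n\<close> may be computed in any chart.
\<close>

lemma riemannian_volume_exists:
  fixes A :: "('a::{second_countable_topology, t2_space}, 'n::finite) chart set"
  assumes A: "smooth_atlas A" and g: "riemannian_metric A g"
  shows "\<exists>\<nu>. is_riemannian_volume A g \<nu>"
proof -
  obtain U \<phi> D where D: "\<And>n::nat. (U n, \<phi> n) \<in> A" "\<And>n. D n \<in> sets borel" "\<And>n. D n \<subseteq> U n"
    "disjoint_family D" "(\<Union>n. D n) = UNIV"
    using countable_borel_partition_by_charts[OF A] by blast
  define vol where "vol k B = (\<integral>\<^sup>+ x\<in>snd k ` B. ennreal (sqrt (det (g k x))) \<partial>lborel)"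
    for k :: "('a, 'n) chart" and B
  have "\<exists>m. sets m = sets borel \<and> (\<forall>B\<in>sets borel. emeasure m B = vol (U n, \<phi> n) (B \<inter> D n))" for n
    unfolding vol_def snd_conv by (rule chart_volume_measure[OF A g D(1-3)[of n]]) blast
  then have "\<exists>m. \<forall>n. sets (m n) = sets borel \<and>
      (\<forall>B\<in>sets borel. emeasure (m n) B = vol (U n, \<phi> n) (B \<inter> D n))"
    by (intro choice allI)
  then obtain m where ex_m: "\<forall>n. sets (m n) = sets (borel :: 'a measure) \<and>
      (\<forall>B\<in>sets borel. emeasure (m n) B = vol (U n, \<phi> n) (B \<inter> D n))" ..
  have m: "sets (m n) = sets (borel :: 'a measure)"
    "B \<in> sets borel \<Longrightarrow> emeasure (m n) B = vol (U n, \<phi> n) (B \<inter> D n)" for n B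
    by (simp_all add: ex_m)
  obtain \<nu> where \<nu>: "sets \<nu> = sets borel" "\<And>B. B \<in> sets borel \<Longrightarrow> emeasure \<nu> B = (\<Sum>n. emeasure (m n) B)"
    by (rule measure_of_series[of m borel, OF m(1)]) blast
  have "emeasure \<nu> B = vol (V, \<psi>) B" if V: "(V, \<psi>) \<in> A" and B: "B \<in> sets borel" "B \<subseteq> V" for V \<psi> B
  proof -
    have VB: "V \<in> sets borel" using smooth_atlasD(1)[OF A V] by simp
    obtain mV where mV: "sets mV = sets borel"
      "\<And>C. C \<in> sets borel \<Longrightarrow> emeasure mV C = vol (V, \<psi>) (C \<inter> V)"
      unfolding vol_def snd_conv by (rule chart_volume_measure[OF A g V VB order_refl]) blast
    have "emeasure (m n) B = emeasure mV (B \<inter> D n)" for n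
    proof -
      have BD: "B \<inter> D n \<in> sets borel" "B \<inter> D n \<subseteq> V \<inter> U n" "B \<inter> D n \<inter> V = B \<inter> D n"
        using B D(2,3)[of n] by auto
      show ?thesis
        unfolding mV(2)[OF BD(1)] m(2)[OF B(1)] BD(3)
        using volume_integral_chart_independent[OF A g V D(1) BD(1,2)] by (simp add: vol_def)
    qed
    then have "emeasure \<nu> B = (\<Sum>n. emeasure mV (B \<inter> D n))"
      by (simp add: \<nu> B)
    also have "\<dots> = emeasure mV (\<Union>n. B \<inter> D n)"
    proof (rule suminf_emeasure)
      show "range (\<lambda>n. B \<inter> D n) \<subseteq> sets mV"
        using B D(2) by (auto simp: mV)
      show "disjoint_family (\<lambda>n. B \<inter> D n)"
        by (rule disjoint_family_on_bisimulation[OF D(4)]) auto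
    qed
    also have "(\<Union>n. B \<inter> D n) = B"
      using D(5) by auto
    also have "emeasure mV B = vol (V, \<psi>) B"
      using B by (simp add: mV Int_absorb2)
    finally show ?thesis .
  qed
  with \<nu>(1) show ?thesis
    unfolding is_riemannian_volume_def vol_def by auto
qed

text \<open>
  The part of a chart domain where the coordinates and the density are bounded by \<open>k\<close> has volume at
  most \<open>k\<close> times that of a Euclidean ball of radius \<open>k\<close>.
\<close>

lemma sigma_finite_riemannian_volume:
  fixes A :: "('a::{second_countable_topology, t2_space}, 'n::finite) chart set"
  assumes A: "smooth_atlas A" and g: "riemannian_metric A g" and \<nu>: "is_riemannian_volume A g \<nu>"
  shows "sigma_finite_measure \<nu>"
proof
  note v = is_riemannian_volumeD[OF \<nu>]
  obtain U \<phi> D where D: "\<And>n::nat. (U n, \<phi> n) \<in> A" "\<And>n. D n \<in> sets borel" "\<And>n. D n \<subseteq> U n"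
    "disjoint_family D" "(\<Union>n. D n) = UNIV"
    using countable_borel_partition_by_charts[OF A] by blast
  define w where "w n x = sqrt (det (g (U n, \<phi> n) x))" for n x
  define E where "E n k = {p \<in> U n. norm (\<phi> n p) \<le> real k \<and> w n (\<phi> n p) \<le> real k}" for n k :: nat
  have EU: "E n k \<subseteq> U n" for n k by (auto simp: E_def)
  have E_borel: "E n k \<in> sets borel" for n k
  proof -
    note ch = smooth_atlasD[OF A D(1)[of n]]
    have \<phi>: "continuous_on (U n) (\<phi> n)"
      using ch(3) by (simp add: homeomorphism_def)
    moreover have "continuous_on (U n) (\<lambda>p. w n (\<phi> n p))"
      unfolding w_def
      by (rule continuous_on_compose2[OF continuous_on_volume_density[OF g D(1)] \<phi>]) simp
    ultimately have [measurable]: "\<phi> n \<in> borel_measurable (restrict_space borel (U n))"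
      "(\<lambda>p. w n (\<phi> n p)) \<in> borel_measurable (restrict_space borel (U n))"
      by (auto intro: borel_measurable_continuous_on_restrict)
    have "{p \<in> space (restrict_space borel (U n)). norm (\<phi> n p) \<le> real k \<and> w n (\<phi> n p) \<le> real k}
        \<in> sets (restrict_space borel (U n))"
      by measurable
    then show ?thesis
      using ch(1) by (simp add: sets_restrict_space_iff space_restrict_space E_def)
  qed
  have E_finite: "emeasure \<nu> (E n k) < \<infinity>" for n k
  proof -
    have "emeasure \<nu> (E n k) = (\<integral>\<^sup>+x\<in>\<phi> n ` E n k. ennreal (w n x) \<partial>lborel)"
      unfolding w_def by (rule v(3)[OF D(1) E_borel EU])
    also have "\<dots> \<le> (\<integral>\<^sup>+x. ennreal (real k) * indicator (cball (0 :: real^'n) (real k)) x \<partial>lborel)"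
      by (rule nn_integral_mono) (auto simp: indicator_def E_def intro: ennreal_leI)
    also have "\<dots> = ennreal (real k) * emeasure lborel (cball (0 :: real^'n) (real k))"
      by (rule nn_integral_cmult_indicator) simp
    also have "\<dots> < \<infinity>"
      using emeasure_bounded_finite[OF bounded_cball, of "0 :: real^'n" "real k"]
      by (simp add: ennreal_mult_less_top)
    finally show ?thesis .
  qed
  have "p \<in> \<Union>(range (case_prod E))" for p
  proof -
    from D(3,5) obtain n where "p \<in> U n" by blast
    moreover obtain k :: nat where "max (norm (\<phi> n p)) (w n (\<phi> n p)) \<le> real k"
      using real_arch_simple by blast
    ultimately have "p \<in> E n k" by (simp add: E_def)
    then show ?thesis by force
  qed
  then show "\<exists>C. countable C \<and> C \<subseteq> sets \<nu> \<and> \<Union> C = space \<nu> \<and> (\<forall>a\<in>C. emeasure \<nu> a \<noteq> \<infinity>)"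
    using E_borel E_finite by (intro exI[of _ "range (case_prod E)"]) (auto simp: v less_top)
qed

lemma is_riemannian_volume_scale:
  fixes A :: "('a::{second_countable_topology, t2_space}, 'n::finite) chart set"
  assumes "0 < c" "is_riemannian_volume A g \<nu>"
  shows "is_riemannian_volume A (\<lambda>k x. c\<^sup>2 *\<^sub>R g k x) (scale_measure (ennreal (c ^ CARD('n))) \<nu>)"
proof -
  have "sqrt (det (c\<^sup>2 *\<^sub>R M)) = c ^ CARD('n) * sqrt (det M)" for M :: "real^'n^'n"
  proof -
    have "c\<^sup>2 *\<^sub>R M = (\<chi> i. c\<^sup>2 *s M $ i)"
      by (simp add: vec_eq_iff)
    then have "det (c\<^sup>2 *\<^sub>R M) = (c\<^sup>2) ^ CARD('n) * det M"
      by (simp add: det_rows_mul)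
    also have "(c\<^sup>2) ^ CARD('n) = (c ^ CARD('n))\<^sup>2"
      by (simp add: power_mult[symmetric] mult.commute)
    finally show ?thesis
      using assms(1) by (simp add: real_sqrt_mult)
  qed
  moreover have "(\<integral>\<^sup>+x\<in>X. ennreal (c ^ CARD('n) * f x) \<partial>lborel) =
      ennreal (c ^ CARD('n)) * (\<integral>\<^sup>+x\<in>X. ennreal (f x) \<partial>lborel)"
    for X :: "(real^'n) set" and f
    using assms(1) nn_integral_cmult_pos[of "c ^ CARD('n)" lborel "\<lambda>x. ennreal (f x) * indicator X x"]
    by (simp add: ennreal_mult' mult.assoc)
  ultimately show ?thesis
    using assms(2) unfolding is_riemannian_volume_def by (auto split: prod.splits)
qed

lemma riemannian_volume_scale:
  fixes A :: "('a::{second_countable_topology, t2_space}, 'n::finite) chart set"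
  assumes "smooth_atlas A" "riemannian_metric A g" "0 < c"
  shows "riemannian_volume A (\<lambda>k x. c\<^sup>2 *\<^sub>R g k x) =
    scale_measure (ennreal (c ^ CARD('n))) (riemannian_volume A g)"
proof -
  obtain \<nu> where \<nu>: "is_riemannian_volume A g \<nu>"
    using riemannian_volume_exists[OF assms(1,2)] by blast
  show ?thesis
    using riemannian_volume_eqI[OF assms(1) \<nu>]
      riemannian_volume_eqI[OF assms(1) is_riemannian_volume_scale[OF assms(3) \<nu>]] by simp
qed

section \<open>Laws of random measures\<close>

lemma space_measure_algebra: "space (measure_algebra K) = {\<nu>. sets \<nu> = sets K}"
  by (auto simp: measure_algebra_def space_Sup_eq_UN)

lemma measurable_emeasure_measure_algebra [measurable]:
  "B \<in> sets K \<Longrightarrow> (\<lambda>\<nu>. emeasure \<nu> B) \<in> borel_measurable (measure_algebra K)"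
  by (auto intro!: measurable_Sup1 measurable_vimage_algebra1 simp: measure_algebra_def)

lemma measurable_measure_algebra:
  assumes "\<And>\<omega>. \<omega> \<in> space M \<Longrightarrow> sets (X \<omega>) = sets K"
    and "\<And>B. B \<in> sets K \<Longrightarrow> (\<lambda>\<omega>. emeasure (X \<omega>) B) \<in> borel_measurable M"
  shows "X \<in> M \<rightarrow>\<^sub>M measure_algebra K"
  using assms by (auto intro!: measurable_Sup2 measurable_vimage_algebra2 simp: measure_algebra_def)

lemma measurable_measure_algebraD:
  assumes "X \<in> M \<rightarrow>\<^sub>M measure_algebra K"
  shows "\<omega> \<in> space M \<Longrightarrow> sets (X \<omega>) = sets K"
    and "B \<in> sets K \<Longrightarrow> (\<lambda>\<omega>. emeasure (X \<omega>) B) \<in> borel_measurable M"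
  using measurable_space[OF assms] measurable_compose[OF assms measurable_emeasure_measure_algebra]
  by (auto simp: space_measure_algebra)

text \<open>
  A generator that is closed under intersections: conditions on finitely many evaluations.
\<close>

lemma sets_measure_algebra:
  "sets (measure_algebra K) = sigma_sets {\<nu>. sets \<nu> = sets K}
     {{\<nu>. sets \<nu> = sets K \<and> (\<forall>i<m. emeasure \<nu> (B i) \<in> C i)} | m B C.
        (\<forall>i<m::nat. B i \<in> sets K \<and> C i \<in> sets borel)}" (is "_ = sigma_sets ?\<Omega> ?G")
proof
  have "sets (measure_algebra K) = sigma_sets ?\<Omega>
      (\<Union>B\<in>sets K. sets (vimage_algebra ?\<Omega> (\<lambda>\<nu>. emeasure \<nu> B) borel))"
    unfolding measure_algebra_def by (subst sets_Sup_eq[where X = ?\<Omega>]) auto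
  also have "\<dots> \<subseteq> sigma_sets ?\<Omega> ?G"
  proof (rule sigma_sets_mono, clarify)
    fix X B assume B: "B \<in> sets K" and "X \<in> sets (vimage_algebra ?\<Omega> (\<lambda>\<nu>. emeasure \<nu> B) borel)"
    then obtain C where C: "C \<in> sets borel" "X = (\<lambda>\<nu>. emeasure \<nu> B) -` C \<inter> ?\<Omega>"
      by (subst (asm) sets_vimage_algebra2) auto
    then have "X = {\<nu>. sets \<nu> = sets K \<and> (\<forall>i<Suc 0. emeasure \<nu> B \<in> C)}"
      by auto
    with B C(1) have "X \<in> ?G"
      by (intro CollectI exI[of _ "Suc 0"] exI[of _ "\<lambda>_. B"] exI[of _ "\<lambda>_. C"]) simp
    then show "X \<in> sigma_sets ?\<Omega> ?G" by (rule sigma_sets.Basic)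
  qed
  finally show "sets (measure_algebra K) \<subseteq> sigma_sets ?\<Omega> ?G" .
  have "G \<in> sets (measure_algebra K)" if "G \<in> ?G" for G
  proof -
    from that obtain m :: nat and B C where BC: "\<And>i. i < m \<Longrightarrow> B i \<in> sets K" "\<And>i. i < m \<Longrightarrow> C i \<in> sets borel"
      "G = {\<nu>. sets \<nu> = sets K \<and> (\<forall>i<m. emeasure \<nu> (B i) \<in> C i)}"
      by blast
    have [measurable]: "Measurable.pred (measure_algebra K) (\<lambda>\<nu>. emeasure \<nu> (B i) \<in> C i)" if "i < m" for i
      using BC(1,2)[OF that] by measurable
    have "{\<nu> \<in> space (measure_algebra K). \<forall>i\<in>{..<m}. emeasure \<nu> (B i) \<in> C i} \<in> sets (measure_algebra K)"
      by measurable
    then show ?thesis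
      by (simp add: BC(3) space_measure_algebra Ball_def)
  qed
  moreover have "space (measure_algebra K) = ?\<Omega>" by (rule space_measure_algebra)
  ultimately show "sigma_sets ?\<Omega> ?G \<subseteq> sets (measure_algebra K)"
    using sets.sigma_sets_subset[of ?G "measure_algebra K"] by (simp add: subset_iff)
qed

lemma distr_measure_algebra_eqI:
  assumes P: "prob_space P" and P': "prob_space P'"
    and X [measurable]: "X \<in> P \<rightarrow>\<^sub>M measure_algebra K" and X' [measurable]: "X' \<in> P' \<rightarrow>\<^sub>M measure_algebra K"
    and eq: "\<And>m B C. (\<And>i::nat. i < m \<Longrightarrow> B i \<in> sets K) \<Longrightarrow> (\<And>i. i < m \<Longrightarrow> C i \<in> sets borel) \<Longrightarrow>
      measure P {\<omega>\<in>space P. \<forall>i<m. emeasure (X \<omega>) (B i) \<in> C i} =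
      measure P' {\<omega>\<in>space P'. \<forall>i<m. emeasure (X' \<omega>) (B i) \<in> C i}"
  shows "distr P (measure_algebra K) X = distr P' (measure_algebra K) X'"
proof -
  interpret P: prob_space P by fact
  interpret P': prob_space P' by fact
  let ?G = "{{\<nu>. sets \<nu> = sets K \<and> (\<forall>i<m. emeasure \<nu> (B i) \<in> C i)} | m B C.
        (\<forall>i<m::nat. B i \<in> sets K \<and> C i \<in> sets borel)}"
  let ?\<Omega> = "{\<nu>. sets \<nu> = sets K}"
  have G_sets: "G \<in> sets (measure_algebra K)" if "G \<in> ?G" for G
    using that unfolding sets_measure_algebra by (rule sigma_sets.Basic)
  have space: "sets (X \<omega>) = sets K" if "\<omega> \<in> space P" for \<omega>
    using measurable_measure_algebraD(1)[OF X that] .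
  have space': "sets (X' \<omega>) = sets K" if "\<omega> \<in> space P'" for \<omega>
    using measurable_measure_algebraD(1)[OF X' that] .
  show ?thesis
  proof (rule measure_eqI_generator_eq[where \<Omega> = ?\<Omega> and E = ?G and A = "\<lambda>_. ?\<Omega>"])
    show "Int_stable ?G"
    proof (rule Int_stableI)
      fix G H assume "G \<in> ?G" "H \<in> ?G"
      then obtain m B C m' B' C' where
        G: "G = {\<nu>. sets \<nu> = sets K \<and> (\<forall>i<m. emeasure \<nu> (B i) \<in> C i)}"
          "\<And>i::nat. i < m \<Longrightarrow> B i \<in> sets K \<and> C i \<in> sets borel" and
        H: "H = {\<nu>. sets \<nu> = sets K \<and> (\<forall>i<m'. emeasure \<nu> (B' i) \<in> C' i)}"
          "\<And>i::nat. i < m' \<Longrightarrow> B' i \<in> sets K \<and> C' i \<in> sets borel"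
        by blast
      define B2 where "B2 i = (if i < m then B i else B' (i - m))" for i
      define C2 where "C2 i = (if i < m then C i else C' (i - m))" for i
      have "(\<forall>i<m + m'. emeasure \<nu> (B2 i) \<in> C2 i) \<longleftrightarrow>
          (\<forall>i<m. emeasure \<nu> (B i) \<in> C i) \<and> (\<forall>i<m'. emeasure \<nu> (B' i) \<in> C' i)" for \<nu>
      proof (intro iffI conjI allI impI)
        fix i assume a: "\<forall>i<m + m'. emeasure \<nu> (B2 i) \<in> C2 i"
        show "emeasure \<nu> (B i) \<in> C i" if "i < m"
          using a[rule_format, of i] that by (simp add: B2_def C2_def)
        show "emeasure \<nu> (B' i) \<in> C' i" if "i < m'"
          using a[rule_format, of "m + i"] that by (simp add: B2_def C2_def)
      next
        fix i assume "(\<forall>i<m. emeasure \<nu> (B i) \<in> C i) \<and> (\<forall>i<m'. emeasure \<nu> (B' i) \<in> C' i)"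
          and "i < m + m'"
        then show "emeasure \<nu> (B2 i) \<in> C2 i"
          by (simp add: B2_def C2_def)
      qed
      then have "G \<inter> H = {\<nu>. sets \<nu> = sets K \<and> (\<forall>i<m + m'. emeasure \<nu> (B2 i) \<in> C2 i)}"
        unfolding G H by auto
      moreover have "\<forall>i<m + m'. B2 i \<in> sets K \<and> C2 i \<in> sets borel"
        using G(2) H(2) by (auto simp: B2_def C2_def)
      ultimately show "G \<inter> H \<in> ?G"
        by (intro CollectI exI[of _ "m + m'"] exI[of _ B2] exI[of _ C2]) simp
    qed
    show "?G \<subseteq> Pow ?\<Omega>" by auto
    show "emeasure (distr P (measure_algebra K) X) G = emeasure (distr P' (measure_algebra K) X') G"
      if "G \<in> ?G" for G
    proof -
      note G_sets[OF that, measurable]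
      from that obtain m B C where
        G: "G = {\<nu>. sets \<nu> = sets K \<and> (\<forall>i<m. emeasure \<nu> (B i) \<in> C i)}"
          "\<And>i::nat. i < m \<Longrightarrow> B i \<in> sets K \<and> C i \<in> sets borel"
        by blast
      have "X -` G \<inter> space P = {\<omega>\<in>space P. \<forall>i<m. emeasure (X \<omega>) (B i) \<in> C i}"
        using space by (auto simp: G)
      moreover have "X' -` G \<inter> space P' = {\<omega>\<in>space P'. \<forall>i<m. emeasure (X' \<omega>) (B i) \<in> C i}"
        using space' by (auto simp: G)
      ultimately show ?thesis
        using eq[of m B C] G(2) by (simp add: emeasure_distr P.emeasure_eq_measure P'.emeasure_eq_measure)
    qed
    show "sets (distr P (measure_algebra K) X) = sigma_sets ?\<Omega> ?G"
      "sets (distr P' (measure_algebra K) X') = sigma_sets ?\<Omega> ?G"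
      by (simp_all add: sets_measure_algebra)
    have "?\<Omega> \<in> ?G"
      by (intro CollectI exI[of _ "0::nat"] exI[of _ "\<lambda>_. {}"]) simp
    then show "range (\<lambda>_::nat. ?\<Omega>) \<subseteq> ?G"
      by simp
    show "emeasure (distr P (measure_algebra K) X) ?\<Omega> \<noteq> \<infinity>"
      using finite_measure.emeasure_finite[OF P.finite_measure_distr[OF X]] by simp
  qed auto
qed

text \<open>
  Real-valued, so that Laplace functionals are expectations of bounded real random variables.
\<close>

definition exp_neg :: "ennreal \<Rightarrow> real" where
  "exp_neg x = (if x = top then 0 else exp (- enn2real x))"

lemma exp_neg_ennreal [simp]: "0 \<le> r \<Longrightarrow> exp_neg (ennreal r) = exp (- r)"
  by (simp add: exp_neg_def)

lemma exp_neg_of_nat [simp]: "exp_neg (of_nat n) = exp (- real n)"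
  by (simp add: ennreal_of_nat_eq_real_of_nat)

lemma exp_neg_top [simp]: "exp_neg top = 0"
  by (simp add: exp_neg_def)

lemma exp_neg_0 [simp]: "exp_neg 0 = 1"
  by (simp add: exp_neg_def)

lemma exp_neg_bounds: "0 \<le> exp_neg x" "exp_neg x \<le> 1"
  by (simp_all add: exp_neg_def)

lemma abs_exp_neg_le [simp]: "\<bar>exp_neg x\<bar> \<le> 1"
  using exp_neg_bounds[of x] by simp

lemma measurable_exp_neg [measurable]: "exp_neg \<in> borel_measurable borel"
  unfolding exp_neg_def by measurable

lemma exp_neg_add: "exp_neg (x + y) = exp_neg x * exp_neg y"
  by (cases x; cases y) (auto simp: ennreal_plus[symmetric] exp_add[symmetric] simp del: ennreal_plus)

lemma exp_neg_sum: "exp_neg (\<Sum>i\<in>I. x i) = (\<Prod>i\<in>I. exp_neg (x i))"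
  by (induction I rule: infinite_finite_induct) (simp_all add: exp_neg_add)

lemma exp_neg_of_nat_mult: "exp_neg (of_nat n * x) = exp_neg x ^ n"
  by (induction n) (simp_all add: exp_neg_add distrib_right)

lemma tendsto_exp_neg:
  assumes "x \<longlonglongrightarrow> y"
  shows "(\<lambda>n. exp_neg (x n)) \<longlonglongrightarrow> exp_neg y"
proof (cases y)
  case (real r)
  have "(\<lambda>n. enn2real (x n)) \<longlonglongrightarrow> r"
    using assms real by (intro tendsto_enn2real) auto
  moreover have "eventually (\<lambda>n. x n < top) sequentially"
    using assms real by (intro order_tendstoD(2)) auto
  ultimately have "(\<lambda>n. exp (- enn2real (x n))) \<longlonglongrightarrow> exp (- r)"
    "eventually (\<lambda>n. exp (- enn2real (x n)) = exp_neg (x n)) sequentially"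
    by (auto intro!: tendsto_intros simp: exp_neg_def elim: eventually_mono)
  then show ?thesis
    using real by (auto intro: Lim_transform_eventually)
next
  case top
  show ?thesis
  proof (rule LIMSEQ_I)
    fix e :: real assume e: "0 < e"
    have "eventually (\<lambda>n. ennreal (max 0 (- ln e)) < x n) sequentially"
      using assms top by (intro order_tendstoD(1)) auto
    then obtain n0 where n0: "\<And>n. n \<ge> n0 \<Longrightarrow> ennreal (max 0 (- ln e)) < x n"
      by (auto simp: eventually_sequentially)
    have "exp_neg (x n) < e" if "n \<ge> n0" for n
    proof (cases "x n")
      case (real s)
      then have "\<not> s \<le> - ln e"
        using n0[OF that] ennreal_leI[of s "- ln e"] by (auto simp: not_le[symmetric])
      then have "- s < ln e" by simp
      then have "exp (- s) < exp (ln e)" by (simp only: exp_less_mono)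
      then show ?thesis
        using real e by simp
    qed (use e in simp)
    then show "\<exists>n0. \<forall>n\<ge>n0. norm (exp_neg (x n) - exp_neg y) < e"
      using top exp_neg_bounds(1) by auto
  qed
qed

text \<open>
  How the weights \<open>E (Z 1\<^bsub>X = k\<^esub>)\<close> of the points \<open>k = 0, 1, \<dots>\<close> are recovered, one after the other,
  from the numbers \<open>E (Z exp (- t X))\<close>: once the contributions of the values \<open>l < k\<close> are removed,
  what remains is \<open>exp (- k t) E (Z 1\<^bsub>X = k\<^esub>)\<close> up to terms of smaller order. The weight \<open>Z\<close> allows
  applying this to the components of a random vector in turn.
\<close>

lemma exp_neg_moment_limit:
  assumes P: "prob_space P" and X [measurable]: "X \<in> borel_measurable P"
    and vals: "\<And>\<omega>. \<omega> \<in> space P \<Longrightarrow> X \<omega> \<in> insert top (range of_nat)"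
    and Z [measurable]: "Z \<in> borel_measurable P" and Z_bound: "\<And>\<omega>. \<bar>Z \<omega>\<bar> \<le> (1::real)"
  shows "(\<lambda>t. exp (real k * real t) * ((\<integral>\<omega>. Z \<omega> * exp_neg (X \<omega>) ^ t \<partial>P) -
      (\<Sum>l<k. exp (- (real l * real t)) * (\<integral>\<omega>. Z \<omega> * indicator {of_nat l} (X \<omega>) \<partial>P))))
    \<longlonglongrightarrow> (\<integral>\<omega>. Z \<omega> * indicator {of_nat k} (X \<omega>) \<partial>P)"
proof -
  interpret P: prob_space P by fact
  \<comment> \<open>\<open>D t\<close> converges boundedly to the indicator of \<open>k\<close> on the natural numbers and \<open>\<infinity>\<close>\<close>
  define D where "D t x = exp (real k * real t) * (exp_neg x ^ t -
      (\<Sum>l<k. exp (- (real l * real t)) * indicator {of_nat l} x))" for t :: nat and x :: ennreal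
  have D_top: "D t top = (if t = 0 then 1 else 0)" for t
    by (simp add: D_def)
  have D_nat: "D t (of_nat j) = (if j < k then 0 else exp (- real (j - k)) ^ t)" for t j
  proof -
    have "(\<Sum>l<k. exp (- (real l * real t)) * indicator {of_nat l} (of_nat j :: ennreal)) =
        (\<Sum>l<k. if j = l then exp (- (real l * real t)) else 0)"
      by (intro sum.cong) (auto simp: indicator_def)
    also have "\<dots> = (if j < k then exp (- (real j * real t)) else 0)"
      by (simp add: sum.delta)
    finally show ?thesis
      by (auto simp: D_def exp_of_nat_mult[symmetric] exp_add[symmetric] algebra_simps)
  qed
  have D_bound: "\<bar>D t x\<bar> \<le> 1" if "x \<in> insert top (range of_nat)" for t x
    using that by (auto simp: D_top D_nat power_le_one)
  have D_lim: "(\<lambda>t. D t x) \<longlonglongrightarrow> indicator {of_nat k} x" if x: "x \<in> insert top (range of_nat)" for x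
  proof (cases "x = top")
    case True
    have "eventually (\<lambda>t. 0 = D t x) sequentially"
      using eventually_gt_at_top[of 0] by eventually_elim (simp add: True D_top)
    then have "(\<lambda>t. D t x) \<longlonglongrightarrow> 0"
      by (rule Lim_transform_eventually[OF tendsto_const])
    then show ?thesis
      by (simp add: True)
  next
    case False
    then obtain j where j: "x = of_nat j" using x by blast
    consider "j < k" | "j = k" | "j > k" by linarith
    then show ?thesis
      by cases (auto simp: j D_nat intro!: LIMSEQ_power_zero)
  qed
  have [measurable]: "(\<lambda>x. D t x) \<in> borel_measurable borel" for t
    unfolding D_def by measurable
  have int: "integrable P (\<lambda>\<omega>. Z \<omega> * f (X \<omega>))"
    if [measurable]: "f \<in> borel_measurable borel" and "\<And>x. \<bar>f x\<bar> \<le> (1::real)" for f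
    using that(2) Z_bound
    by (intro P.integrable_const_bound[of _ 1]) (auto simp: abs_mult intro!: AE_I2 mult_le_one)
  have "(\<lambda>t. \<integral>\<omega>. Z \<omega> * D t (X \<omega>) \<partial>P) \<longlonglongrightarrow> (\<integral>\<omega>. Z \<omega> * indicator {of_nat k} (X \<omega>) \<partial>P)"
  proof (rule integral_dominated_convergence[where w = "\<lambda>_. 1"])
    show "AE \<omega> in P. (\<lambda>t. Z \<omega> * D t (X \<omega>)) \<longlonglongrightarrow> Z \<omega> * indicator {of_nat k} (X \<omega>)"
      by (intro AE_I2 tendsto_mult tendsto_const D_lim vals)
    show "AE \<omega> in P. norm (Z \<omega> * D t (X \<omega>)) \<le> 1" for t
      using D_bound vals Z_bound by (auto simp: abs_mult intro!: AE_I2 mult_le_one)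
  qed auto
  also have "(\<lambda>t. \<integral>\<omega>. Z \<omega> * D t (X \<omega>) \<partial>P) =
      (\<lambda>t. exp (real k * real t) * ((\<integral>\<omega>. Z \<omega> * exp_neg (X \<omega>) ^ t \<partial>P) -
      (\<Sum>l<k. exp (- (real l * real t)) * (\<integral>\<omega>. Z \<omega> * indicator {of_nat l} (X \<omega>) \<partial>P))))"
  proof
    fix t
    have "(\<integral>\<omega>. Z \<omega> * D t (X \<omega>) \<partial>P) = (\<integral>\<omega>. exp (real k * real t) * (Z \<omega> * exp_neg (X \<omega>) ^ t -
        (\<Sum>l<k. exp (- (real l * real t)) * (Z \<omega> * indicator {of_nat l} (X \<omega>)))) \<partial>P)"
      by (simp only: D_def right_diff_distrib sum_distrib_left mult_ac)
    also have "\<dots> = exp (real k * real t) * ((\<integral>\<omega>. Z \<omega> * exp_neg (X \<omega>) ^ t \<partial>P) -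
        (\<integral>\<omega>. (\<Sum>l<k. exp (- (real l * real t)) * (Z \<omega> * indicator {of_nat l} (X \<omega>))) \<partial>P))"
      by (subst integral_mult_right_zero, subst Bochner_Integration.integral_diff)
         (auto intro!: int Bochner_Integration.integrable_sum integrable_mult_right
           simp: power_abs power_le_one exp_neg_bounds)
    also have "(\<integral>\<omega>. (\<Sum>l<k. exp (- (real l * real t)) * (Z \<omega> * indicator {of_nat l} (X \<omega>))) \<partial>P) =
        (\<Sum>l<k. exp (- (real l * real t)) * (\<integral>\<omega>. Z \<omega> * indicator {of_nat l} (X \<omega>) \<partial>P))"
      by (subst Bochner_Integration.integral_sum) (auto intro!: int integrable_mult_right)
    finally show "(\<integral>\<omega>. Z \<omega> * D t (X \<omega>) \<partial>P) = exp (real k * real t) * ((\<integral>\<omega>. Z \<omega> * exp_neg (X \<omega>) ^ t \<partial>P) -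
      (\<Sum>l<k. exp (- (real l * real t)) * (\<integral>\<omega>. Z \<omega> * indicator {of_nat l} (X \<omega>) \<partial>P)))" .
  qed
  finally show ?thesis .
qed

text \<open>
  The weights of the finite values determine the rest of the weighted distribution, including the
  weight of \<open>\<infinity>\<close>, which is what the total weight leaves over.
\<close>

lemma point_masses_limit:
  assumes P: "prob_space P" and X [measurable]: "X \<in> borel_measurable P"
    and vals: "\<And>\<omega>. \<omega> \<in> space P \<Longrightarrow> X \<omega> \<in> insert top (range of_nat)"
    and Z [measurable]: "Z \<in> borel_measurable P" and Z_bound: "\<And>\<omega>. \<bar>Z \<omega>\<bar> \<le> (1::real)"
    and C [measurable]: "(C :: ennreal set) \<in> sets borel"
  shows "(\<lambda>k. indicator C top * (\<integral>\<omega>. Z \<omega> \<partial>P) + (\<Sum>l<k. (indicator C (of_nat l) - indicator C top) *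
      (\<integral>\<omega>. Z \<omega> * indicator {of_nat l} (X \<omega>) \<partial>P)))
    \<longlonglongrightarrow> (\<integral>\<omega>. Z \<omega> * indicator C (X \<omega>) \<partial>P)"
proof -
  interpret P: prob_space P by fact
  \<comment> \<open>\<open>H k\<close> is the indicator of \<open>C\<close> at the natural numbers below \<open>k\<close>, and treats all larger
    values like \<open>\<infinity>\<close>\<close>
  define H :: "nat \<Rightarrow> ennreal \<Rightarrow> real" where
    "H k x = indicator C top + (\<Sum>l<k. (indicator C (of_nat l) - indicator C top) *
      indicator {of_nat l} x)" for k x
  have H_top: "H k top = (indicator C top :: real)" for k
    by (simp add: H_def)
  have H_nat: "H k (of_nat j) = (if j < k then indicator C (of_nat j) else (indicator C top :: real))" for k j
  proof -
    have "(\<Sum>l<k. (indicator C (of_nat l) - indicator C top) * indicator {of_nat l} (of_nat j :: ennreal)) =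
        (\<Sum>l<k. if j = l then indicator C (of_nat l) - indicator C top else (0::real))"
      by (intro sum.cong) (auto simp: indicator_def)
    then show ?thesis
      by (simp add: H_def sum.delta)
  qed
  have H_bound: "\<bar>H k x\<bar> \<le> (1::real)" if "x \<in> insert top (range of_nat)" for k x
    using that by (auto simp: H_top H_nat)
  have H_lim: "(\<lambda>k. H k x) \<longlonglongrightarrow> indicator C x" if x: "x \<in> insert top (range of_nat)" for x
  proof (cases "x = top")
    case False
    then obtain j where j: "x = of_nat j" using x by blast
    have "eventually (\<lambda>k. indicator C x = H k x) sequentially"
      using eventually_gt_at_top[of j] by eventually_elim (simp add: j H_nat)
    then show ?thesis
      by (rule Lim_transform_eventually[OF tendsto_const])
  qed (simp add: H_top)
  have [measurable]: "(\<lambda>x. H k x :: real) \<in> borel_measurable borel" for k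
    unfolding H_def by measurable
  have int: "integrable P (\<lambda>\<omega>. Z \<omega> * f (X \<omega>))"
    if [measurable]: "f \<in> borel_measurable borel" and "\<And>x. \<bar>f x\<bar> \<le> (1::real)" for f
    using that(2) Z_bound
    by (intro P.integrable_const_bound[of _ 1]) (auto simp: abs_mult intro!: AE_I2 mult_le_one)
  have "(\<lambda>k. \<integral>\<omega>. Z \<omega> * H k (X \<omega>) \<partial>P) \<longlonglongrightarrow> (\<integral>\<omega>. Z \<omega> * indicator C (X \<omega>) \<partial>P)"
  proof (rule integral_dominated_convergence[where w = "\<lambda>_. 1"])
    show "AE \<omega> in P. (\<lambda>k. Z \<omega> * H k (X \<omega>)) \<longlonglongrightarrow> Z \<omega> * indicator C (X \<omega>)"
      by (intro AE_I2 tendsto_mult tendsto_const H_lim vals)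
    show "AE \<omega> in P. norm (Z \<omega> * H k (X \<omega>)) \<le> 1" for k
      using H_bound vals Z_bound by (auto simp: abs_mult intro!: AE_I2 mult_le_one)
  qed auto
  also have "(\<lambda>k. \<integral>\<omega>. Z \<omega> * H k (X \<omega>) \<partial>P) =
      (\<lambda>k. indicator C top * (\<integral>\<omega>. Z \<omega> \<partial>P) + (\<Sum>l<k. (indicator C (of_nat l) - indicator C top) *
      (\<integral>\<omega>. Z \<omega> * indicator {of_nat l} (X \<omega>) \<partial>P)))"
  proof
    fix k
    have intZ: "integrable P Z"
      using int[of "\<lambda>_. 1"] by simp
    have "(\<integral>\<omega>. Z \<omega> * H k (X \<omega>) \<partial>P) = (\<integral>\<omega>. indicator C top * Z \<omega> +
        (\<Sum>l<k. (indicator C (of_nat l) - indicator C top) * (Z \<omega> * indicator {of_nat l} (X \<omega>))) \<partial>P)"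
      by (simp add: H_def algebra_simps sum_distrib_left)
    also have "\<dots> = indicator C top * (\<integral>\<omega>. Z \<omega> \<partial>P) + (\<integral>\<omega>.
        (\<Sum>l<k. (indicator C (of_nat l) - indicator C top) * (Z \<omega> * indicator {of_nat l} (X \<omega>))) \<partial>P)"
      by (subst Bochner_Integration.integral_add)
         (auto intro!: int intZ Bochner_Integration.integrable_sum integrable_mult_right)
    also have "(\<integral>\<omega>. (\<Sum>l<k. (indicator C (of_nat l) - indicator C top) *
          (Z \<omega> * indicator {of_nat l} (X \<omega>))) \<partial>P) =
        (\<Sum>l<k. (indicator C (of_nat l) - indicator C top) * (\<integral>\<omega>. Z \<omega> * indicator {of_nat l} (X \<omega>) \<partial>P))"
      by (subst Bochner_Integration.integral_sum) (auto intro!: int integrable_mult_right)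
    finally show "(\<integral>\<omega>. Z \<omega> * H k (X \<omega>) \<partial>P) = indicator C top * (\<integral>\<omega>. Z \<omega> \<partial>P) +
        (\<Sum>l<k. (indicator C (of_nat l) - indicator C top) * (\<integral>\<omega>. Z \<omega> * indicator {of_nat l} (X \<omega>) \<partial>P))" .
  qed
  finally show ?thesis .
qed

lemma weighted_law_eq_from_exp_neg_moments:
  assumes P: "prob_space P" "X \<in> borel_measurable P" "\<And>\<omega>. \<omega> \<in> space P \<Longrightarrow> X \<omega> \<in> insert top (range of_nat)"
      "Z \<in> borel_measurable P" "\<And>\<omega>. \<bar>Z \<omega>\<bar> \<le> (1::real)"
    and P': "prob_space P'" "X' \<in> borel_measurable P'" "\<And>\<omega>. \<omega> \<in> space P' \<Longrightarrow> X' \<omega> \<in> insert top (range of_nat)"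
      "Z' \<in> borel_measurable P'" "\<And>\<omega>. \<bar>Z' \<omega>\<bar> \<le> (1::real)"
    and eq: "\<And>t. (\<integral>\<omega>. Z \<omega> * exp_neg (X \<omega>) ^ t \<partial>P) = (\<integral>\<omega>. Z' \<omega> * exp_neg (X' \<omega>) ^ t \<partial>P')"
    and C: "C \<in> sets borel"
  shows "(\<integral>\<omega>. Z \<omega> * indicator C (X \<omega>) \<partial>P) = (\<integral>\<omega>. Z' \<omega> * indicator C (X' \<omega>) \<partial>P')"
proof -
  have masses: "(\<integral>\<omega>. Z \<omega> * indicator {of_nat k} (X \<omega>) \<partial>P) = (\<integral>\<omega>. Z' \<omega> * indicator {of_nat k} (X' \<omega>) \<partial>P')"
    for k
  proof (induction k rule: less_induct)
    case (less k)
    have sums: "(\<Sum>l<k. exp (- (real l * real t)) * (\<integral>\<omega>. Z \<omega> * indicator {of_nat l} (X \<omega>) \<partial>P)) =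
        (\<Sum>l<k. exp (- (real l * real t)) * (\<integral>\<omega>. Z' \<omega> * indicator {of_nat l} (X' \<omega>) \<partial>P'))" for t
      using less.IH by (intro sum.cong) auto
    show ?case
      using exp_neg_moment_limit[OF P, of k] exp_neg_moment_limit[OF P', of k]
      unfolding sums eq by (rule LIMSEQ_unique)
  qed
  show ?thesis
    using point_masses_limit[OF P C] point_masses_limit[OF P' C]
    unfolding masses eq[of 0, simplified] by (rule LIMSEQ_unique)
qed

lemma integral_indicator_Collect:
  "(\<integral>\<omega>. indicator {\<omega>\<in>space M. Q \<omega>} \<omega> \<partial>M) = measure M {\<omega>\<in>space M. Q \<omega>}"
proof -
  have "{\<omega>\<in>space M. Q \<omega>} \<inter> space M = {\<omega>\<in>space M. Q \<omega>}"
    by blast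
  then show ?thesis
    using Bochner_Integration.integral_indicator[of M "{\<omega>\<in>space M. Q \<omega>}"] by simp
qed

text \<open>
  Functions of the form \<open>f = \<Sum>\<^sub>i t\<^sub>i 1\<^bsub>B\<^sub>i\<^esub>\<close> with natural coefficients yield the mixed moments
  \<open>E (\<Prod>\<^sub>i exp (- X B\<^sub>i) ^ t\<^sub>i)\<close>. These are turned into \<open>E (\<Prod>\<^sub>i 1\<^bsub>C\<^sub>i\<^esub> (X B\<^sub>i))\<close> by replacing one factor at a
  time, with the other factors as the weight \<open>Z\<close>.
\<close>

lemma distr_measure_algebra_eqI_Laplace:
  assumes P: "prob_space P" and P': "prob_space P'"
    and X [measurable]: "X \<in> P \<rightarrow>\<^sub>M measure_algebra K" and X' [measurable]: "X' \<in> P' \<rightarrow>\<^sub>M measure_algebra K"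
    and vals: "\<And>\<omega> B. \<omega> \<in> space P \<Longrightarrow> B \<in> sets K \<Longrightarrow> emeasure (X \<omega>) B \<in> insert top (range of_nat)"
    and vals': "\<And>\<omega> B. \<omega> \<in> space P' \<Longrightarrow> B \<in> sets K \<Longrightarrow> emeasure (X' \<omega>) B \<in> insert top (range of_nat)"
    and Laplace: "\<And>(f :: 'a \<Rightarrow> nat) m. f \<in> K \<rightarrow>\<^sub>M count_space UNIV \<Longrightarrow> range f \<subseteq> {..<m} \<Longrightarrow>
      (\<integral>\<omega>. exp_neg (\<integral>\<^sup>+x. of_nat (f x) \<partial>X \<omega>) \<partial>P) = (\<integral>\<omega>. exp_neg (\<integral>\<^sup>+x. of_nat (f x) \<partial>X' \<omega>) \<partial>P')"
  shows "distr P (measure_algebra K) X = distr P' (measure_algebra K) X'"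
proof (rule distr_measure_algebra_eqI[OF P P' X X'])
  interpret P: prob_space P by fact
  interpret P': prob_space P' by fact
  fix m :: nat and B\<^sub>0 :: "nat \<Rightarrow> 'a set" and C\<^sub>0 :: "nat \<Rightarrow> ennreal set"
  assume B\<^sub>0: "\<And>i. i < m \<Longrightarrow> B\<^sub>0 i \<in> sets K" and C\<^sub>0: "\<And>i. i < m \<Longrightarrow> C\<^sub>0 i \<in> sets borel"
  \<comment> \<open>extended to all indices, so that measurability holds without side conditions\<close>
  define B where "B i = (if i < m then B\<^sub>0 i else {})" for i
  define C where "C i = (if i < m then C\<^sub>0 i else {})" for i
  have B [measurable]: "B i \<in> sets K" and C [measurable]: "C i \<in> sets borel" for i
    using B\<^sub>0 C\<^sub>0 by (auto simp: B_def C_def)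
  \<comment> \<open>indicators for the indices below \<open>n\<close>, moments for those from \<open>l\<close> on; with \<open>l = Suc n\<close> the factor
    of index \<open>n\<close> is left out\<close>
  define R :: "nat \<Rightarrow> nat \<Rightarrow> (nat \<Rightarrow> nat) \<Rightarrow> 'a measure \<Rightarrow> real" where
    "R n l t \<nu> = (\<Prod>i<n. indicator (C i) (emeasure \<nu> (B i))) *
      (\<Prod>i\<in>{l..<m}. exp_neg (emeasure \<nu> (B i)) ^ t i)" for n l t \<nu>
  have R_measurable [measurable]: "R n l t \<in> borel_measurable (measure_algebra K)" for n l t
    unfolding R_def by measurable
  have R_bound: "\<bar>R n l t \<nu>\<bar> \<le> 1" for n l t \<nu>
    unfolding R_def abs_mult abs_prod
    by (intro mult_le_one prod_le_1 prod_nonneg) (auto simp: power_abs power_le_one exp_neg_bounds)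
  have R_start: "exp_neg (\<integral>\<^sup>+x. of_nat (\<Sum>i<m. if x \<in> B i then t i else 0) \<partial>\<nu>) = R 0 0 t \<nu>"
    if \<nu>: "sets \<nu> = sets K" for \<nu> t
  proof -
    have "(\<integral>\<^sup>+x. of_nat (\<Sum>i<m. if x \<in> B i then t i else 0) \<partial>\<nu>) =
        (\<integral>\<^sup>+x. (\<Sum>i<m. of_nat (t i) * indicator (B i) x) \<partial>\<nu>)"
      unfolding of_nat_sum by (intro nn_integral_cong sum.cong) (auto simp: indicator_def)
    also have "\<dots> = (\<Sum>i<m. of_nat (t i) * emeasure \<nu> (B i))"
    proof (subst nn_integral_sum)
      have [measurable]: "B i \<in> sets \<nu>" for i
        using B \<nu> by simp
      show "(\<lambda>x. of_nat (t i) * indicator (B i) x :: ennreal) \<in> borel_measurable \<nu>" for i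
        by measurable
    qed (simp add: B \<nu> nn_integral_cmult_indicator)
    finally show ?thesis
      by (simp add: R_def exp_neg_sum exp_neg_of_nat_mult lessThan_atLeast0)
  qed
  have sets_X: "sets (X \<omega>) = sets K" if "\<omega> \<in> space P" for \<omega>
    using measurable_measure_algebraD(1)[OF X that] .
  have sets_X': "sets (X' \<omega>) = sets K" if "\<omega> \<in> space P'" for \<omega>
    using measurable_measure_algebraD(1)[OF X' that] .
  have "n \<le> m \<Longrightarrow> (\<integral>\<omega>. R n n t (X \<omega>) \<partial>P) = (\<integral>\<omega>. R n n t (X' \<omega>) \<partial>P')" for n t
  proof (induction n arbitrary: t)
    case 0
    define f where "f x = (\<Sum>i<m. if x \<in> B i then t i else 0)" for x
    have "f x \<le> (\<Sum>i<m. t i)" for x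
      unfolding f_def by (intro sum_mono) auto
    then have f_range: "range f \<subseteq> {..<Suc (\<Sum>i<m. t i)}"
      by (auto simp: less_Suc_eq_le)
    have f_meas: "f \<in> K \<rightarrow>\<^sub>M count_space UNIV"
      unfolding f_def by measurable
    have "(\<integral>\<omega>. R 0 0 t (X \<omega>) \<partial>P) = (\<integral>\<omega>. exp_neg (\<integral>\<^sup>+x. of_nat (f x) \<partial>X \<omega>) \<partial>P)"
      unfolding f_def by (intro Bochner_Integration.integral_cong refl) (simp only: R_start[OF sets_X])
    also have "\<dots> = (\<integral>\<omega>. exp_neg (\<integral>\<^sup>+x. of_nat (f x) \<partial>X' \<omega>) \<partial>P')"
      by (rule Laplace[OF f_meas f_range])
    also have "\<dots> = (\<integral>\<omega>. R 0 0 t (X' \<omega>) \<partial>P')"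
      unfolding f_def by (intro Bochner_Integration.integral_cong refl) (simp only: R_start[OF sets_X'])
    finally show ?case .
  next
    case (Suc n)
    have split_moment: "R n n (t(n := s)) \<nu> = R n (Suc n) t \<nu> * exp_neg (emeasure \<nu> (B n)) ^ s" for s \<nu>
    proof -
      have "{n..<m} = insert n {Suc n..<m}"
        using Suc.prems by auto
      then have "(\<Prod>i\<in>{n..<m}. exp_neg (emeasure \<nu> (B i)) ^ (t(n := s)) i) =
          exp_neg (emeasure \<nu> (B n)) ^ s * (\<Prod>i\<in>{Suc n..<m}. exp_neg (emeasure \<nu> (B i)) ^ (t(n := s)) i)"
        by simp
      also have "(\<Prod>i\<in>{Suc n..<m}. exp_neg (emeasure \<nu> (B i)) ^ (t(n := s)) i) =
          (\<Prod>i\<in>{Suc n..<m}. exp_neg (emeasure \<nu> (B i)) ^ t i)"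
        by (intro prod.cong) auto
      finally show ?thesis
        by (simp add: R_def)
    qed
    have split_mass: "R (Suc n) (Suc n) t \<nu> = R n (Suc n) t \<nu> * indicator (C n) (emeasure \<nu> (B n))" for \<nu>
      by (simp add: R_def)
    show ?case
      unfolding split_mass
    proof (rule weighted_law_eq_from_exp_neg_moments[OF P _ _ _ _ P'])
      show "(\<integral>\<omega>. R n (Suc n) t (X \<omega>) * exp_neg (emeasure (X \<omega>) (B n)) ^ s \<partial>P) =
          (\<integral>\<omega>. R n (Suc n) t (X' \<omega>) * exp_neg (emeasure (X' \<omega>) (B n)) ^ s \<partial>P')" for s
        using Suc.IH[of "t(n := s)"] Suc.prems unfolding split_moment by simp
      show "emeasure (X \<omega>) (B n) \<in> insert top (range of_nat)" if "\<omega> \<in> space P" for \<omega>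
        by (rule vals[OF that B])
      show "emeasure (X' \<omega>) (B n) \<in> insert top (range of_nat)" if "\<omega> \<in> space P'" for \<omega>
        by (rule vals'[OF that B])
    qed (use R_bound in auto)
  qed
  from this[OF order_refl, of "\<lambda>_. 0"]
  have eq: "(\<integral>\<omega>. R m m (\<lambda>_. 0) (X \<omega>) \<partial>P) = (\<integral>\<omega>. R m m (\<lambda>_. 0) (X' \<omega>) \<partial>P')" .
  have R_end: "R m m t \<nu> = indicator {\<nu>. \<forall>i<m. emeasure \<nu> (B\<^sub>0 i) \<in> C\<^sub>0 i} \<nu>" for t \<nu>
    by (auto simp: R_def indicator_def B_def C_def)
  have "(\<integral>\<omega>. R m m (\<lambda>_. 0) (X \<omega>) \<partial>P) =
      (\<integral>\<omega>. indicator {\<omega>\<in>space P. \<forall>i<m. emeasure (X \<omega>) (B\<^sub>0 i) \<in> C\<^sub>0 i} \<omega> \<partial>P)"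
    by (intro Bochner_Integration.integral_cong) (simp_all add: R_end indicator_def)
  moreover have "(\<integral>\<omega>. R m m (\<lambda>_. 0) (X' \<omega>) \<partial>P') =
      (\<integral>\<omega>. indicator {\<omega>\<in>space P'. \<forall>i<m. emeasure (X' \<omega>) (B\<^sub>0 i) \<in> C\<^sub>0 i} \<omega> \<partial>P')"
    by (intro Bochner_Integration.integral_cong) (simp_all add: R_end indicator_def)
  ultimately show "measure P {\<omega>\<in>space P. \<forall>i<m. emeasure (X \<omega>) (B\<^sub>0 i) \<in> C\<^sub>0 i} =
      measure P' {\<omega>\<in>space P'. \<forall>i<m. emeasure (X' \<omega>) (B\<^sub>0 i) \<in> C\<^sub>0 i}"
    using eq by (simp only: integral_indicator_Collect)
qed

section \<open>Uniqueness in law of Poisson processes\<close>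

lemma emeasure_dirac_sum_values:
  assumes "B \<in> sets K" "x \<in> I \<rightarrow> space K"
  shows "emeasure (dirac_sum K I x) B \<in> insert top (range of_nat)"
  using assms by (cases "finite (x -` B \<inter> I)") (simp_all add: dirac_sum_def emeasure_distr emeasure_count_space_finite emeasure_count_space_infinite)

lemma sets_dirac_sum [simp]: "sets (dirac_sum K I x) = sets K"
  by (simp add: dirac_sum_def)

lemma nn_integral_dirac_sum:
  assumes "x \<in> I \<rightarrow> space K" "f \<in> borel_measurable K"
  shows "(\<integral>\<^sup>+y. f y \<partial>dirac_sum K I x) = (\<integral>\<^sup>+i. f (x i) \<partial>count_space I)"
  using assms by (simp add: dirac_sum_def nn_integral_distr)

lemma expectation_count_cong:
  fixes X :: "'w \<Rightarrow> ennreal" and X' :: "'v \<Rightarrow> ennreal"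
  assumes P: "prob_space P" "X \<in> borel_measurable P" "\<And>\<omega>. \<omega> \<in> space P \<Longrightarrow> X \<omega> \<in> insert top (range of_nat)"
    and P': "prob_space P'" "X' \<in> borel_measurable P'" "\<And>\<omega>. \<omega> \<in> space P' \<Longrightarrow> X' \<omega> \<in> insert top (range of_nat)"
    and eq: "\<And>k::nat. measure P {\<omega>\<in>space P. X \<omega> = of_nat k} = measure P' {\<omega>\<in>space P'. X' \<omega> = of_nat k}"
    and h [measurable]: "h \<in> borel_measurable borel"
  shows "(\<integral>\<omega>. h (X \<omega>) \<partial>P) = (\<integral>\<omega>. (h (X' \<omega>) :: real) \<partial>P')"
proof -
  interpret P: prob_space P by fact
  interpret P': prob_space P' by fact
  note [measurable] = P(2) P'(2)
  have point: "(\<integral>\<omega>. indicator C (Y \<omega>) \<partial>M) = measure M {\<omega>\<in>space M. Y \<omega> \<in> C}"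
    for M and Y :: "_ \<Rightarrow> ennreal" and C
  proof -
    have "(\<integral>\<omega>. indicator C (Y \<omega>) \<partial>M) = (\<integral>\<omega>. indicator {\<omega>\<in>space M. Y \<omega> \<in> C} \<omega> \<partial>M :: real)"
      by (intro Bochner_Integration.integral_cong) (auto simp: indicator_def)
    then show ?thesis by (simp only: integral_indicator_Collect)
  qed
  have "distr P borel X = distr P' borel X'"
  proof (rule measure_eqI)
    fix C assume "C \<in> sets (distr P borel X)"
    then have C: "C \<in> sets borel" by simp
    have "(\<integral>\<omega>. indicator C (X \<omega>) \<partial>P) = (\<integral>\<omega>. indicator C (X' \<omega>) \<partial>P' :: real)"
    proof (rule LIMSEQ_unique)
      show "(\<lambda>k. indicator C top + (\<Sum>l<k. (indicator C (of_nat l) - indicator C top) *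
          measure P {\<omega>\<in>space P. X \<omega> = of_nat l})) \<longlonglongrightarrow> (\<integral>\<omega>. indicator C (X \<omega>) \<partial>P)"
        using point_masses_limit[of P X "\<lambda>_. 1" C] P C by (simp add: point P.prob_space)
      show "(\<lambda>k. indicator C top + (\<Sum>l<k. (indicator C (of_nat l) - indicator C top) *
          measure P {\<omega>\<in>space P. X \<omega> = of_nat l})) \<longlonglongrightarrow> (\<integral>\<omega>. indicator C (X' \<omega>) \<partial>P')"
        using point_masses_limit[of P' X' "\<lambda>_. 1" C] P' C by (simp add: point eq P'.prob_space)
    qed
    then have "measure P {\<omega>\<in>space P. X \<omega> \<in> C} = measure P' {\<omega>\<in>space P'. X' \<omega> \<in> C}"
      by (simp only: point)
    then show "emeasure (distr P borel X) C = emeasure (distr P' borel X') C"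
      using C by (simp add: emeasure_distr P.emeasure_eq_measure P'.emeasure_eq_measure
          vimage_def Int_def conj_commute)
  qed simp
  then have "(\<integral>y. h y \<partial>distr P borel X) = (\<integral>y. h y \<partial>distr P' borel X')"
    by simp
  then show ?thesis
    by (simp add: integral_distr)
qed

lemma poisson_process_measurable: "poisson_process P \<mu> \<eta> \<Longrightarrow> \<eta> \<in> P \<rightarrow>\<^sub>M measure_algebra borel"
  by (simp add: poisson_process_def)

lemmas poisson_process_measurableD = measurable_measure_algebraD[OF poisson_process_measurable]

lemma poisson_process_count_expectation_eq:
  fixes h :: "ennreal \<Rightarrow> real"
  assumes P: "prob_space P" and P': "prob_space P'"
    and \<eta>: "poisson_process P \<mu> \<eta>" and \<eta>': "poisson_process P' \<mu> \<eta>'"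
    and vals: "\<And>\<omega> B. \<omega> \<in> space P \<Longrightarrow> B \<in> sets borel \<Longrightarrow> emeasure (\<eta> \<omega>) B \<in> insert top (range of_nat)"
    and vals': "\<And>\<omega> B. \<omega> \<in> space P' \<Longrightarrow> B \<in> sets borel \<Longrightarrow> emeasure (\<eta>' \<omega>) B \<in> insert top (range of_nat)"
    and B: "B \<in> sets borel" and h [measurable]: "h \<in> borel_measurable borel"
  shows "(\<integral>\<omega>. h (emeasure (\<eta> \<omega>) B) \<partial>P) = (\<integral>\<omega>. h (emeasure (\<eta>' \<omega>) B) \<partial>P')"
proof -
  interpret P: prob_space P by fact
  interpret P': prob_space P' by fact
  have meas [measurable]: "(\<lambda>\<omega>. emeasure (\<eta> \<omega>) B) \<in> borel_measurable P"
    by (rule poisson_process_measurableD(2)[OF \<eta> B])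
  have meas' [measurable]: "(\<lambda>\<omega>. emeasure (\<eta>' \<omega>) B) \<in> borel_measurable P'"
    by (rule poisson_process_measurableD(2)[OF \<eta>' B])
  show ?thesis
  proof (cases "emeasure \<mu> B = \<infinity>")
    case True
    then have "AE \<omega> in P. emeasure (\<eta> \<omega>) B = \<infinity>" "AE \<omega> in P'. emeasure (\<eta>' \<omega>) B = \<infinity>"
      using \<eta> \<eta>' B by (auto simp: poisson_process_def)
    then have "(\<integral>\<omega>. h (emeasure (\<eta> \<omega>) B) \<partial>P) = (\<integral>\<omega>. h \<infinity> \<partial>P)"
      "(\<integral>\<omega>. h (emeasure (\<eta>' \<omega>) B) \<partial>P') = (\<integral>\<omega>. h \<infinity> \<partial>P')"
      by (intro integral_cong_AE; force)+
    then show ?thesis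
      by (simp add: P.prob_space P'.prob_space)
  next
    case False
    then have "emeasure \<mu> B < \<infinity>" by (simp add: less_top)
    then have "measure P {\<omega>\<in>space P. emeasure (\<eta> \<omega>) B = of_nat k} =
        measure P' {\<omega>\<in>space P'. emeasure (\<eta>' \<omega>) B = of_nat k}" for k
      using \<eta> \<eta>' B by (simp add: poisson_process_def)
    then show ?thesis
      using vals[OF _ B] vals'[OF _ B] by (intro expectation_count_cong P P' meas meas' h)
  qed
qed

text \<open>
  The integral of \<open>f\<close> is a combination of the counts on the level sets of \<open>f\<close>. These sets are disjoint,
  so the counts are independent.
\<close>

lemma poisson_process_Laplace:
  assumes P: "prob_space P" and \<eta>: "poisson_process P \<mu> \<eta>"
    and f [measurable]: "f \<in> borel \<rightarrow>\<^sub>M count_space UNIV" and f_range: "range f \<subseteq> {..<m::nat}"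
  shows "(\<integral>\<omega>. exp_neg (\<integral>\<^sup>+x. of_nat (f x) \<partial>\<eta> \<omega>) \<partial>P) =
    (\<Prod>v<m. \<integral>\<omega>. exp_neg (emeasure (\<eta> \<omega>) (f -` {v})) ^ v \<partial>P)"
proof -
  interpret P: prob_space P by fact
  have sets_\<eta>: "sets (\<eta> \<omega>) = sets borel" if "\<omega> \<in> space P" for \<omega>
    by (rule poisson_process_measurableD(1)[OF \<eta> that])
  have level [measurable]: "f -` {v} \<in> sets borel" for v
    using measurable_sets[OF f, of "{v}"] by simp
  have "exp_neg (\<integral>\<^sup>+x. of_nat (f x) \<partial>\<eta> \<omega>) = (\<Prod>v<m. exp_neg (emeasure (\<eta> \<omega>) (f -` {v})) ^ v)"
    if "\<omega> \<in> space P" for \<omega>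
  proof -
    have "(\<integral>\<^sup>+x. of_nat (f x) \<partial>\<eta> \<omega>) = (\<integral>\<^sup>+x. (\<Sum>v<m. of_nat v * indicator (f -` {v}) x) \<partial>\<eta> \<omega>)"
    proof (rule nn_integral_cong)
      fix x
      have "(\<Sum>v<m. of_nat v * indicator (f -` {v}) x) = (\<Sum>v<m. if v = f x then of_nat v else (0::ennreal))"
        by (intro sum.cong) (auto simp: indicator_def)
      also have "\<dots> = of_nat (f x)"
        using f_range by (auto simp: sum.delta)
      finally show "of_nat (f x) = (\<Sum>v<m. of_nat v * indicator (f -` {v}) x :: ennreal)" ..
    qed
    also have "\<dots> = (\<Sum>v<m. of_nat v * emeasure (\<eta> \<omega>) (f -` {v}))"
    proof (subst nn_integral_sum)
      have [measurable]: "f -` {v} \<in> sets (\<eta> \<omega>)" for v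
        using level sets_\<eta>[OF that] by simp
      show "(\<lambda>x. of_nat v * indicator (f -` {v}) x :: ennreal) \<in> borel_measurable (\<eta> \<omega>)" for v
        by measurable
    qed (simp add: level sets_\<eta>[OF that] nn_integral_cmult_indicator)
    finally show ?thesis
      by (simp add: exp_neg_sum exp_neg_of_nat_mult)
  qed
  then have "(\<integral>\<omega>. exp_neg (\<integral>\<^sup>+x. of_nat (f x) \<partial>\<eta> \<omega>) \<partial>P) =
      (\<integral>\<omega>. (\<Prod>v<m. exp_neg (emeasure (\<eta> \<omega>) (f -` {v})) ^ v) \<partial>P)"
    by (intro Bochner_Integration.integral_cong refl)
  also have "\<dots> = (\<Prod>v<m. \<integral>\<omega>. exp_neg (emeasure (\<eta> \<omega>) (f -` {v})) ^ v \<partial>P)"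
  proof (rule P.indep_vars_lebesgue_integral)
    have "disjoint_family_on (\<lambda>v. f -` {v}) {..<m}"
      by (auto simp: disjoint_family_on_def)
    then have "P.indep_vars (\<lambda>_. borel) (\<lambda>v \<omega>. emeasure (\<eta> \<omega>) (f -` {v})) {..<m}"
      using \<eta> level unfolding poisson_process_def by simp
    then show "P.indep_vars (\<lambda>_. borel) (\<lambda>v \<omega>. exp_neg (emeasure (\<eta> \<omega>) (f -` {v})) ^ v) {..<m}"
      by (rule P.indep_vars_compose2) measurable
    show "integrable P (\<lambda>\<omega>. exp_neg (emeasure (\<eta> \<omega>) (f -` {v})) ^ v)" for v
      using poisson_process_measurableD(2)[OF \<eta> level]
      by (intro P.integrable_const_bound[of _ 1]) (auto simp: power_abs power_le_one exp_neg_bounds)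
  qed simp
  finally show ?thesis .
qed

text \<open>
  The Laplace functional is a product of expectations of functions of single counts, and the
  distribution of a single count is prescribed by the intensity.
\<close>

lemma poisson_process_law_unique:
  fixes \<mu> :: "'a::topological_space measure"
  assumes P: "prob_space P" and P': "prob_space P'"
    and \<eta>: "poisson_process P \<mu> \<eta>" and \<eta>': "poisson_process P' \<mu> \<eta>'"
    and vals: "\<And>\<omega> B. \<omega> \<in> space P \<Longrightarrow> B \<in> sets borel \<Longrightarrow> emeasure (\<eta> \<omega>) B \<in> insert top (range of_nat)"
    and vals': "\<And>\<omega> B. \<omega> \<in> space P' \<Longrightarrow> B \<in> sets borel \<Longrightarrow> emeasure (\<eta>' \<omega>) B \<in> insert top (range of_nat)"
  shows "distr P (measure_algebra borel) \<eta> = distr P' (measure_algebra borel) \<eta>'"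
proof (rule distr_measure_algebra_eqI_Laplace[OF P P' _ _ vals vals'])
  show "\<eta> \<in> P \<rightarrow>\<^sub>M measure_algebra borel" "\<eta>' \<in> P' \<rightarrow>\<^sub>M measure_algebra borel"
    using \<eta> \<eta>' by (auto intro: poisson_process_measurable)
  fix f :: "'a \<Rightarrow> nat" and m
  assume f: "f \<in> borel \<rightarrow>\<^sub>M count_space UNIV" and f_range: "range f \<subseteq> {..<m}"
  have "(\<integral>\<omega>. exp_neg (emeasure (\<eta> \<omega>) (f -` {v})) ^ v \<partial>P) =
      (\<integral>\<omega>. exp_neg (emeasure (\<eta>' \<omega>) (f -` {v})) ^ v \<partial>P')" for v
    using measurable_sets[OF f, of "{v}"]
    by (intro poisson_process_count_expectation_eq[OF P P' \<eta> \<eta>' vals vals', of "f -` {v}" "\<lambda>x. exp_neg x ^ v"]) auto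
  then show "(\<integral>\<omega>. exp_neg (\<integral>\<^sup>+x. of_nat (f x) \<partial>\<eta> \<omega>) \<partial>P) = (\<integral>\<omega>. exp_neg (\<integral>\<^sup>+x. of_nat (f x) \<partial>\<eta>' \<omega>) \<partial>P')"
    by (simp add: poisson_process_Laplace[OF P \<eta> f f_range] poisson_process_Laplace[OF P' \<eta>' f f_range])
qed

text \<open>
  The Poisson weights of the natural numbers add up to 1, so the value \<open>\<infinity>\<close> has probability 0.
\<close>

lemma poisson_process_AE_finite:
  assumes P: "prob_space P" and \<eta>: "poisson_process P \<mu> \<eta>"
    and vals: "\<And>\<omega>. \<omega> \<in> space P \<Longrightarrow> emeasure (\<eta> \<omega>) B \<in> insert top (range of_nat)"
    and B: "B \<in> sets borel" "emeasure \<mu> B < \<infinity>"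
  shows "AE \<omega> in P. emeasure (\<eta> \<omega>) B < \<infinity>"
proof -
  interpret P: prob_space P by fact
  have [measurable]: "(\<lambda>\<omega>. emeasure (\<eta> \<omega>) B) \<in> borel_measurable P"
    by (rule poisson_process_measurableD(2)[OF \<eta> B(1)])
  define r where "r = measure \<mu> B"
  let ?A = "\<lambda>k::nat. {\<omega>\<in>space P. emeasure (\<eta> \<omega>) B = of_nat k}"
  have "(\<lambda>k. measure P (?A k)) sums measure P (\<Union>k. ?A k)"
    by (rule P.finite_measure_UNION) (auto simp: disjoint_family_on_def)
  moreover have "(\<lambda>k. measure P (?A k)) sums 1"
  proof -
    have "(\<lambda>k. exp (- r) * (r ^ k / fact k)) sums (exp (- r) * exp r)"
      using exp_converges[of r] by (intro sums_mult) (simp add: scaleR_conv_of_real field_simps)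
    moreover have "measure P (?A k) = exp (- r) * (r ^ k / fact k)" for k
      using \<eta> B by (simp add: poisson_process_def r_def)
    ultimately show ?thesis
      by (simp add: exp_minus)
  qed
  ultimately have "P.prob (\<Union>k. ?A k) = 1"
    by (rule sums_unique2)
  then have "AE \<omega> in P. \<omega> \<in> (\<Union>k. ?A k)"
    by (intro P.AE_prob_1)
  then show ?thesis
    by eventually_elim (auto simp: of_nat_less_top)
qed

section \<open>Double integrals as functionals of a measure\<close>

lemma nn_integral_count_space_square:
  fixes q :: "nat \<times> nat \<Rightarrow> ennreal"
  shows "(\<lambda>m. \<Sum>p\<in>{..<m} \<times> {..<m}. q p) \<longlonglongrightarrow> (\<integral>\<^sup>+p. q p \<partial>count_space UNIV)"
proof -
  have "(\<lambda>m. \<integral>\<^sup>+p. q p * indicator ({..<m} \<times> {..<m}) p \<partial>count_space UNIV) \<longlonglongrightarrow>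
      (\<integral>\<^sup>+p. q p \<partial>count_space UNIV)"
  proof (rule nn_integral_LIMSEQ)
    show "incseq (\<lambda>m p. q p * indicator ({..<m} \<times> {..<m}) p)"
      by (auto simp: incseq_def le_fun_def indicator_def)
    show "(\<lambda>m. q p * indicator ({..<m} \<times> {..<m}) p) \<longlonglongrightarrow> q p" for p
    proof (rule Lim_transform_eventually[OF tendsto_const])
      show "eventually (\<lambda>m. q p = q p * indicator ({..<m} \<times> {..<m}) p) sequentially"
        using eventually_gt_at_top[of "max (fst p) (snd p)"]
        by eventually_elim (auto simp: indicator_def mem_Times_iff)
    qed
  qed simp
  also have "(\<lambda>m. \<integral>\<^sup>+p. q p * indicator ({..<m} \<times> {..<m}) p \<partial>count_space UNIV) =
      (\<lambda>m. \<Sum>p\<in>{..<m} \<times> {..<m}. q p)"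
  proof
    fix m :: nat
    have "(\<integral>\<^sup>+p. q p * indicator ({..<m} \<times> {..<m}) p \<partial>count_space UNIV) =
        (\<Sum>p\<in>{..<m} \<times> {..<m}. q p * indicator ({..<m} \<times> {..<m}) p)"
      by (rule nn_integral_count_space') auto
    then show "(\<integral>\<^sup>+p. q p * indicator ({..<m} \<times> {..<m}) p \<partial>count_space UNIV) =
        (\<Sum>p\<in>{..<m} \<times> {..<m}. q p)"
      by simp
  qed
  finally show ?thesis .
qed

text \<open>
  Passing to subprobability measures makes iterated integrals measurable in \<open>\<nu>\<close>, which may fail for
  measures that are not \<open>\<sigma>\<close>-finite. The factor vanishes if \<open>\<nu> K = \<infinity>\<close>, so the total mass is at most 1
  in all cases.
\<close>

definition normalized_restriction :: "'a::topological_space set \<Rightarrow> 'a measure \<Rightarrow> 'a measure" where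
  "normalized_restriction K \<nu> = density \<nu> (\<lambda>x. indicator K x * inverse (1 + emeasure \<nu> K))"

lemma nn_integral_normalized_restriction:
  assumes "sets \<nu> = sets borel" "K \<in> sets borel" "f \<in> borel_measurable borel"
  shows "(\<integral>\<^sup>+x. f x \<partial>normalized_restriction K \<nu>) =
    (\<integral>\<^sup>+x. indicator K x * inverse (1 + emeasure \<nu> K) * f x \<partial>\<nu>)"
proof -
  have [measurable]: "K \<in> sets \<nu>" "f \<in> borel_measurable \<nu>"
    using assms by (simp_all cong: measurable_cong_sets)
  show ?thesis
    unfolding normalized_restriction_def by (rule nn_integral_density) measurable
qed

lemma emeasure_normalized_restriction:
  assumes \<nu>: "sets \<nu> = sets borel" and K: "K \<in> sets borel" and B: "B \<in> sets borel"
  shows "emeasure (normalized_restriction K \<nu>) B = inverse (1 + emeasure \<nu> K) * emeasure \<nu> (K \<inter> B)"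
proof -
  have [measurable]: "K \<in> sets \<nu>" "B \<in> sets \<nu>"
    using assms by simp_all
  have "emeasure (normalized_restriction K \<nu>) B =
      (\<integral>\<^sup>+x. inverse (1 + emeasure \<nu> K) * indicator (K \<inter> B) x \<partial>\<nu>)"
    unfolding normalized_restriction_def
    by (subst emeasure_density) (auto simp: indicator_def intro!: nn_integral_cong)
  then show ?thesis
    by (simp add: nn_integral_cmult_indicator)
qed

lemma measurable_normalized_restriction:
  assumes K: "K \<in> sets borel"
  shows "normalized_restriction K \<in> measure_algebra borel \<rightarrow>\<^sub>M subprob_algebra borel"
proof (rule measurable_subprob_algebra)
  fix \<nu> :: "'a measure" assume "\<nu> \<in> space (measure_algebra borel)"
  then have \<nu>: "sets \<nu> = sets borel"
    by (simp add: space_measure_algebra)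
  then show sets: "sets (normalized_restriction K \<nu>) = sets borel"
    by (simp add: normalized_restriction_def)
  then have space: "space (normalized_restriction K \<nu>) = UNIV"
    using sets_eq_imp_space_eq by fastforce
  show "subprob_space (normalized_restriction K \<nu>)"
  proof
    have "emeasure (normalized_restriction K \<nu>) UNIV = inverse (1 + emeasure \<nu> K) * emeasure \<nu> K"
      using emeasure_normalized_restriction[OF \<nu> K, of UNIV] by simp
    also have "\<dots> \<le> 1"
    proof (cases "emeasure \<nu> K = top")
      case False
      have "inverse (1 + emeasure \<nu> K) * emeasure \<nu> K \<le> inverse (1 + emeasure \<nu> K) * (1 + emeasure \<nu> K)"
        by (intro mult_left_mono) auto
      also have "\<dots> = (1 + emeasure \<nu> K) / (1 + emeasure \<nu> K)"
        by (simp add: divide_ennreal_def mult.commute)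
      also have "\<dots> = 1"
        using False by (intro ennreal_divide_self) (auto simp: less_top)
      finally show ?thesis .
    qed simp
    finally show "emeasure (normalized_restriction K \<nu>) (space (normalized_restriction K \<nu>)) \<le> 1"
      by (simp add: space)
    show "space (normalized_restriction K \<nu>) \<noteq> {}"
      by (simp add: space)
  qed
next
  fix B :: "'a set" assume B [measurable]: "B \<in> sets borel"
  note K [measurable]
  have "(\<lambda>\<nu>. inverse (1 + emeasure \<nu> K) * emeasure \<nu> (K \<inter> B)) \<in> borel_measurable (measure_algebra borel)"
    by measurable
  then show "(\<lambda>\<nu>. emeasure (normalized_restriction K \<nu>) B) \<in> borel_measurable (measure_algebra borel)"
    by (rule measurable_cong[THEN iffD1, rotated])
      (simp add: emeasure_normalized_restriction K space_measure_algebra)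
qed

text \<open>
  A version of the iterated integral \<open>\<integral>\<integral> u d\<nu> d\<nu>\<close> that is measurable in \<open>\<nu>\<close>. The two integrals agree
  if \<open>K\<close> increases to the whole space and \<open>\<nu>\<close> is finite on each \<open>K n\<close>: the prefactor undoes both
  normalisations, and the supremum over \<open>n\<close> removes the restriction.
\<close>

definition pair_energy :: "('a::topological_space \<Rightarrow> 'a \<Rightarrow> ennreal) \<Rightarrow> (nat \<Rightarrow> 'a set) \<Rightarrow> 'a measure \<Rightarrow> ennreal" where
  "pair_energy u K \<nu> = (SUP n. (1 + emeasure \<nu> (K n))\<^sup>2 *
     (\<integral>\<^sup>+y. (\<integral>\<^sup>+x. u x y \<partial>normalized_restriction (K n) \<nu>) \<partial>normalized_restriction (K n) \<nu>))"

lemma measurable_pair_energy: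
  assumes K [measurable]: "\<And>n. K n \<in> sets borel"
    and u: "(\<lambda>(x, y). u x y) \<in> borel_measurable (borel \<Otimes>\<^sub>M borel)"
  shows "pair_energy u K \<in> borel_measurable (measure_algebra borel)"
proof -
  have T [measurable]: "normalized_restriction (K n) \<in> measure_algebra borel \<rightarrow>\<^sub>M subprob_algebra borel" for n
    by (rule measurable_normalized_restriction[OF K])
  have u' [measurable]: "(\<lambda>p. u (f p) (h p)) \<in> borel_measurable M"
    if "f \<in> M \<rightarrow>\<^sub>M borel" "h \<in> M \<rightarrow>\<^sub>M borel" for f h M
    using measurable_compose[OF measurable_Pair[OF that] u] by simp
  have inner: "(\<lambda>(\<nu>, y). \<integral>\<^sup>+x. u x y \<partial>normalized_restriction (K n) \<nu>)
      \<in> borel_measurable (measure_algebra borel \<Otimes>\<^sub>M borel)" for n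
    unfolding case_prod_beta
    by (rule nn_integral_measurable_subprob_algebra2[where N = borel]) measurable
  have "(\<lambda>\<nu>. \<integral>\<^sup>+y. (\<integral>\<^sup>+x. u x y \<partial>normalized_restriction (K n) \<nu>) \<partial>normalized_restriction (K n) \<nu>)
      \<in> borel_measurable (measure_algebra borel)" for n
    by (rule nn_integral_measurable_subprob_algebra2[OF inner T])
  then show ?thesis
    unfolding pair_energy_def by measurable
qed

lemma pair_energy_dirac_sum:
  fixes s :: "nat \<Rightarrow> 'a::topological_space"
  assumes K: "\<And>n. K n \<in> sets borel" "incseq K" "(\<Union>n. K n) = UNIV"
    and u: "(\<lambda>(x, y). u x y) \<in> borel_measurable (borel \<Otimes>\<^sub>M borel)"
    and finite: "\<And>n. emeasure (dirac_sum borel I s) (K n) < \<infinity>"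
  shows "pair_energy u K (dirac_sum borel I s) =
    (\<integral>\<^sup>+(i, j). (if i \<in> I \<and> j \<in> I then u (s i) (s j) else 0) \<partial>count_space UNIV)"
proof -
  let ?\<nu> = "dirac_sum borel I s"
  define \<kappa> where "\<kappa> n = 1 + emeasure ?\<nu> (K n)" for n
  define T where "T n = normalized_restriction (K n) ?\<nu>" for n
  have \<kappa>: "\<kappa> n * inverse (\<kappa> n) = 1" for n
  proof -
    have "\<kappa> n / \<kappa> n = 1"
      using finite[of n] by (intro ennreal_divide_self) (auto simp: \<kappa>_def)
    then show ?thesis
      by (simp add: divide_ennreal_def)
  qed
  have T_int: "(\<integral>\<^sup>+x. f x \<partial>T n) =
      (\<integral>\<^sup>+i. indicator I i * (indicator (K n) (s i) * inverse (\<kappa> n) * f (s i)) \<partial>count_space UNIV)"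
    if [measurable]: "f \<in> borel_measurable borel" for f n
  proof -
    note K(1) [measurable]
    have "(\<integral>\<^sup>+x. f x \<partial>T n) = (\<integral>\<^sup>+x. indicator (K n) x * inverse (\<kappa> n) * f x \<partial>?\<nu>)"
      unfolding T_def \<kappa>_def by (rule nn_integral_normalized_restriction) (simp_all add: K that)
    also have "\<dots> = (\<integral>\<^sup>+i. indicator (K n) (s i) * inverse (\<kappa> n) * f (s i) \<partial>count_space I)"
      by (subst nn_integral_dirac_sum) auto
    also have "\<dots> = (\<integral>\<^sup>+i. indicator (K n) (s i) * inverse (\<kappa> n) * f (s i) * indicator I i \<partial>count_space UNIV)"
      by (cases "I = UNIV") (simp_all add: nn_integral_count_space_indicator)
    finally show ?thesis
      by (simp add: mult_ac)
  qed
  have u': "(\<lambda>x. u x y) \<in> borel_measurable borel" for y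
    using measurable_compose[OF measurable_Pair[of "\<lambda>x. x" borel borel "\<lambda>_. y" borel] u] by simp
  have "T n \<in> space (subprob_algebra borel)" for n
    unfolding T_def using measurable_space[OF measurable_normalized_restriction[OF K(1)]]
    by (simp add: space_measure_algebra)
  then have "(\<lambda>y. \<integral>\<^sup>+x. u x y \<partial>T n) \<in> borel_measurable borel" for n
    by (intro nn_integral_measurable_subprob_algebra2[where N = borel] measurable_const)
      (use measurable_compose[OF measurable_pair_swap' u] in \<open>simp_all add: case_prod_beta\<close>)
  note u'' = this
  define q where "q = (\<lambda>(i, j). if i \<in> I \<and> j \<in> I then u (s i) (s j) else 0)"
  have level: "(\<kappa> n)\<^sup>2 * (\<integral>\<^sup>+y. (\<integral>\<^sup>+x. u x y \<partial>T n) \<partial>T n) =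
      (\<integral>\<^sup>+p. q p * indicator (K n \<times> K n) (s (fst p), s (snd p)) \<partial>count_space UNIV)" for n
  proof -
    have "(\<kappa> n)\<^sup>2 * (\<integral>\<^sup>+y. (\<integral>\<^sup>+x. u x y \<partial>T n) \<partial>T n) =
        (\<integral>\<^sup>+j. (\<integral>\<^sup>+i. (\<kappa> n)\<^sup>2 * (indicator I j * (indicator (K n) (s j) * inverse (\<kappa> n) *
          (indicator I i * (indicator (K n) (s i) * inverse (\<kappa> n) * u (s i) (s j))))) \<partial>count_space UNIV) \<partial>count_space UNIV)"
      unfolding T_int[OF u'']
      unfolding T_int[OF u']
      by (simp add: nn_integral_cmult)
    also have "\<dots> = (\<integral>\<^sup>+j. (\<integral>\<^sup>+i. q (i, j) * indicator (K n \<times> K n) (s i, s j) \<partial>count_space UNIV) \<partial>count_space UNIV)"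
    proof (intro nn_integral_cong)
      fix i j
      have "(\<kappa> n)\<^sup>2 * (indicator I j * (indicator (K n) (s j) * inverse (\<kappa> n) *
          (indicator I i * (indicator (K n) (s i) * inverse (\<kappa> n) * u (s i) (s j))))) =
          (\<kappa> n * inverse (\<kappa> n)) * (\<kappa> n * inverse (\<kappa> n)) *
          (indicator I i * indicator I j * (indicator (K n) (s i) * indicator (K n) (s j)) * u (s i) (s j))"
        by (simp add: power2_eq_square mult_ac)
      also have "\<dots> = q (i, j) * indicator (K n \<times> K n) (s i, s j)"
        unfolding \<kappa> by (auto simp: q_def indicator_def)
      finally show "(\<kappa> n)\<^sup>2 * (indicator I j * (indicator (K n) (s j) * inverse (\<kappa> n) *
          (indicator I i * (indicator (K n) (s i) * inverse (\<kappa> n) * u (s i) (s j))))) =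
          q (i, j) * indicator (K n \<times> K n) (s i, s j)" .
    qed
    also have "\<dots> = (\<integral>\<^sup>+p. q p * indicator (K n \<times> K n) (s (fst p), s (snd p)) \<partial>count_space UNIV)"
      using nn_integral_snd_count_space[of "\<lambda>p. q p * indicator (K n \<times> K n) (s (fst p), s (snd p))"]
      by simp
    finally show ?thesis .
  qed
  have "pair_energy u K ?\<nu> =
      (SUP n. \<integral>\<^sup>+p. q p * indicator (K n \<times> K n) (s (fst p), s (snd p)) \<partial>count_space UNIV)"
    unfolding pair_energy_def \<kappa>_def[symmetric] T_def[symmetric] level ..
  also have "\<dots> = (\<integral>\<^sup>+p. q p \<partial>count_space UNIV)"
  proof (rule LIMSEQ_unique[OF LIMSEQ_SUP])
    have inc: "incseq (\<lambda>n p. q p * indicator (K n \<times> K n) (s (fst p), s (snd p)))"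
      using K(2) by (auto simp: incseq_def le_fun_def indicator_def intro!: mult_left_mono)
    then show "incseq (\<lambda>n. \<integral>\<^sup>+p. q p * indicator (K n \<times> K n) (s (fst p), s (snd p)) \<partial>count_space UNIV)"
      by (auto simp: incseq_def le_fun_def intro!: nn_integral_mono)
    show "(\<lambda>n. \<integral>\<^sup>+p. q p * indicator (K n \<times> K n) (s (fst p), s (snd p)) \<partial>count_space UNIV)
        \<longlonglongrightarrow> (\<integral>\<^sup>+p. q p \<partial>count_space UNIV)"
    proof (rule nn_integral_LIMSEQ[OF inc])
      fix p
      obtain n1 n2 where n: "s (fst p) \<in> K n1" "s (snd p) \<in> K n2"
        using K(3) by blast
      have "eventually (\<lambda>n. q p = q p * indicator (K n \<times> K n) (s (fst p), s (snd p))) sequentially"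
        using eventually_ge_at_top[of "max n1 n2"]
      proof eventually_elim
        case (elim k)
        then have "K n1 \<subseteq> K k" "K n2 \<subseteq> K k"
          using K(2) by (auto simp: incseq_def)
        then show ?case
          using n by (auto simp: indicator_def)
      qed
      then show "(\<lambda>n. q p * indicator (K n \<times> K n) (s (fst p), s (snd p))) \<longlonglongrightarrow> q p"
        by (rule Lim_transform_eventually[OF tendsto_const])
    qed simp
  qed
  finally show ?thesis
    by (simp add: q_def)
qed

section \<open>Integrating out the edge marks\<close>

definition pairs_below :: "nat \<Rightarrow> (nat \<times> nat) set" where
  "pairs_below n = {(i, j). i < j \<and> j < n}"

lemma finite_pairs_below [simp]: "finite (pairs_below n)"
  by (rule finite_subset[of _ "{..<n} \<times> {..<n}"]) (auto simp: pairs_below_def)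

lemma sum_square_eq_diagonal_plus_pairs:
  fixes q :: "nat \<Rightarrow> nat \<Rightarrow> 'b::comm_monoid_add"
  shows "(\<Sum>i<n. \<Sum>j<n. q i j) = (\<Sum>i<n. q i i) + (\<Sum>(i, j)\<in>pairs_below n. q i j + q j i)"
proof (induction n)
  case 0
  show ?case by (simp add: pairs_below_def)
next
  case (Suc n)
  have "pairs_below (Suc n) = pairs_below n \<union> (\<lambda>i. (i, n)) ` {..<n}"
    by (auto simp: pairs_below_def less_Suc_eq)
  moreover have "pairs_below n \<inter> (\<lambda>i. (i, n)) ` {..<n} = {}"
    by (auto simp: pairs_below_def)
  ultimately have "(\<Sum>(i, j)\<in>pairs_below (Suc n). q i j + q j i) =
      (\<Sum>(i, j)\<in>pairs_below n. q i j + q j i) + (\<Sum>i<n. q i n + q n i)"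
    by (simp add: sum.union_disjoint sum.reindex inj_on_def)
  then show ?case
    by (simp add: Suc.IH sum.distrib ac_simps)
qed

text \<open>
  The expected contribution \<open>exp (- f (x, y, b) - f (y, x, b))\<close> of the two orientations of a pair of
  distinct points to \<open>exp (- \<integral> f d\<xi>)\<close>, where \<open>b\<close> is the random edge mark.
\<close>

definition pair_factor :: "('a \<Rightarrow> 'a \<Rightarrow> real) \<Rightarrow> ('a \<times> 'a \<times> bool \<Rightarrow> nat) \<Rightarrow> 'a \<Rightarrow> 'a \<Rightarrow> real" where
  "pair_factor W f x y =
     (\<Sum>b\<in>UNIV. pmf (bernoulli_pmf (W x y)) b * exp (- real (f (x, y, b) + f (y, x, b))))"

text \<open>
  The function \<open>u\<close> for which the sum of \<open>u (S\<^sub>i, S\<^sub>j)\<close> over all ordered pairs is minus the logarithm of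
  the conditional expectation of \<open>exp (- \<integral> f d\<xi>)\<close>. Each unordered pair of distinct points is counted
  twice, hence the factor \<open>1 / 2\<close>; on the diagonal there is no edge.
\<close>

definition pair_potential :: "('a \<Rightarrow> 'a \<Rightarrow> real) \<Rightarrow> ('a \<times> 'a \<times> bool \<Rightarrow> nat) \<Rightarrow> 'a \<Rightarrow> 'a \<Rightarrow> real" where
  "pair_potential W f x y = (if x = y then real (f (x, x, False)) else - ln (pair_factor W f x y) / 2)"

lemma symmetric_kernelD:
  assumes "symmetric_kernel W"
  shows "(\<lambda>(x, y). W x y) \<in> borel_measurable (borel \<Otimes>\<^sub>M borel)" "0 \<le> W x y" "W x y \<le> 1" "W x y = W y x"
  using assms by (auto simp: symmetric_kernel_def)

lemma pair_factor_eq: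
  assumes "symmetric_kernel W"
  shows "pair_factor W f x y = W x y * exp (- real (f (x, y, True) + f (y, x, True))) +
     (1 - W x y) * exp (- real (f (x, y, False) + f (y, x, False)))"
  using symmetric_kernelD(2-4)[OF assms, of x y] by (simp add: pair_factor_def UNIV_bool)

lemma pair_factor_bounds:
  assumes "symmetric_kernel W"
  shows "0 < pair_factor W f x y" "pair_factor W f x y \<le> 1"
proof -
  note W = symmetric_kernelD(2-4)[OF assms, of x y]
  define e where "e b = exp (- real (f (x, y, b) + f (y, x, b)))" for b
  have e: "0 < e b" "e b \<le> 1" for b
    by (simp_all add: e_def)
  have eq: "pair_factor W f x y = W x y * e True + (1 - W x y) * e False"
    by (simp add: pair_factor_eq[OF assms] e_def)
  show "pair_factor W f x y \<le> 1"
    unfolding eq by (rule convex_bound_le) (use e W in auto)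
  show "0 < pair_factor W f x y"
  proof (cases "W x y = 0")
    case False
    then show ?thesis
      unfolding eq using W e by (intro add_pos_nonneg mult_pos_pos mult_nonneg_nonneg) (auto intro: less_imp_le)
  qed (simp add: eq e)
qed

lemma pair_factor_commute:
  assumes "symmetric_kernel W"
  shows "pair_factor W f x y = pair_factor W f y x"
  using symmetric_kernelD(4)[OF assms, of x y] by (simp add: pair_factor_def add.commute)

lemma pair_potential_nonneg:
  assumes "symmetric_kernel W"
  shows "0 \<le> pair_potential W f x y"
  using pair_factor_bounds[OF assms, of f x y] by (simp add: pair_potential_def)

context
  fixes W :: "'a::{second_countable_topology, t2_space} \<Rightarrow> 'a \<Rightarrow> real" and f :: "'a \<times> 'a \<times> bool \<Rightarrow> nat"
  assumes W: "symmetric_kernel W" and f: "f \<in> edge_space \<rightarrow>\<^sub>M count_space UNIV"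
begin

lemma measurable_mark_function:
  assumes "g \<in> M \<rightarrow>\<^sub>M borel" "h \<in> M \<rightarrow>\<^sub>M borel" "b \<in> M \<rightarrow>\<^sub>M count_space UNIV"
  shows "(\<lambda>z. f (g z, h z, b z)) \<in> M \<rightarrow>\<^sub>M count_space UNIV"
  using measurable_compose[OF measurable_Pair[OF assms(1) measurable_Pair[OF assms(2,3)]] f] .

lemma measurable_pair_factor:
  assumes [measurable]: "g \<in> M \<rightarrow>\<^sub>M borel" "h \<in> M \<rightarrow>\<^sub>M borel"
  shows "(\<lambda>z. pair_factor W f (g z) (h z)) \<in> borel_measurable M"
proof -
  note [measurable (raw)] = measurable_mark_function
  have [measurable]: "(\<lambda>z. W (g z) (h z)) \<in> borel_measurable M"
    using measurable_compose[OF measurable_Pair[OF assms] symmetric_kernelD(1)[OF W]] by simp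
  show ?thesis
    unfolding pair_factor_eq[OF W] by measurable
qed

lemma measurable_pair_potential:
  "(\<lambda>(x, y). pair_potential W f x y) \<in> borel_measurable (borel \<Otimes>\<^sub>M borel)"
proof -
  note [measurable (raw)] = measurable_mark_function measurable_pair_factor
  have "{p \<in> space (borel \<Otimes>\<^sub>M borel). fst p = snd p} = {p :: 'a \<times> 'a. \<exists>x. p = (x, x)}"
    by (auto simp: space_pair_measure)
  then have [measurable]: "Measurable.pred (borel \<Otimes>\<^sub>M borel) (\<lambda>p :: 'a \<times> 'a. fst p = snd p)"
    using closed_diagonal[where 'a = 'a] by (simp add: pred_def borel_prod)
  show ?thesis
    unfolding pair_potential_def case_prod_beta by measurable
qed

lemma exp_neg_sum_pair_potential:
  assumes "inj_on s {..<n}"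
  shows "exp (- (\<Sum>i<n. \<Sum>j<n. pair_potential W f (s i) (s j))) =
    (\<Prod>i<n. exp (- real (f (s i, s i, False)))) * (\<Prod>(i, j)\<in>pairs_below n. pair_factor W f (s i) (s j))"
proof -
  have "exp (- (\<Sum>(i, j)\<in>pairs_below n. pair_potential W f (s i) (s j) + pair_potential W f (s j) (s i))) =
      (\<Prod>(i, j)\<in>pairs_below n. pair_factor W f (s i) (s j))"
    unfolding sum_negf[symmetric] exp_sum[OF finite_pairs_below]
  proof (rule prod.cong[OF refl], clarify)
    fix i j assume "(i, j) \<in> pairs_below n"
    then have "s i \<noteq> s j"
      using inj_onD[OF assms, of i j] by (auto simp: pairs_below_def)
    then show "exp (- (pair_potential W f (s i) (s j) + pair_potential W f (s j) (s i))) =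
        pair_factor W f (s i) (s j)"
      using pair_factor_bounds(1)[OF W, of f "s i" "s j"]
      by (simp add: pair_potential_def pair_factor_commute[OF W, of f "s j"])
  qed
  moreover have "exp (- (\<Sum>i<n. pair_potential W f (s i) (s i))) = (\<Prod>i<n. exp (- real (f (s i, s i, False))))"
    by (simp add: pair_potential_def sum_negf[symmetric] exp_sum)
  ultimately show ?thesis
    unfolding sum_square_eq_diagonal_plus_pairs minus_add_distrib exp_add by simp
qed

end

text \<open>
  The marks are integrated out conditionally on the points, whose joint law may be arbitrary here.
\<close>

locale marked_point_sequence = prob_space P for P :: "'w measure" +
  fixes N :: "'w \<Rightarrow> enat" and S :: "nat \<Rightarrow> 'w \<Rightarrow> 'a::{second_countable_topology, t2_space}"
    and A :: "nat \<Rightarrow> nat \<Rightarrow> 'w \<Rightarrow> bool" and W :: "'a \<Rightarrow> 'a \<Rightarrow> real"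
  assumes N [measurable]: "N \<in> P \<rightarrow>\<^sub>M count_space UNIV"
    and S [measurable]: "\<And>i. S i \<in> P \<rightarrow>\<^sub>M borel"
    and A [measurable]: "\<And>i j. A i j \<in> P \<rightarrow>\<^sub>M count_space UNIV"
    and W: "symmetric_kernel W"
    and distinct: "AE \<omega> in P. \<forall>i j. enat i < N \<omega> \<and> enat j < N \<omega> \<and> i \<noteq> j \<longrightarrow> S i \<omega> \<noteq> S j \<omega>"
    and marks_symmetric: "\<And>\<omega> i j. \<omega> \<in> space P \<Longrightarrow> \<not> A i i \<omega> \<and> A j i \<omega> = A i j \<omega>"
    and marks_conditional: "\<And>F a. finite F \<Longrightarrow> F \<subseteq> {(i, j). i < j} \<Longrightarrow>
      (AE \<omega> in P. (\<forall>(i, j)\<in>F. enat j < N \<omega>) \<longrightarrow>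
        real_cond_exp P (point_sigma P N S) (indicator {\<omega>\<in>space P. \<forall>(i, j)\<in>F. A i j \<omega> = a i j}) \<omega> =
        (\<Prod>(i, j)\<in>F. pmf (bernoulli_pmf (W (S i \<omega>) (S j \<omega>))) (a i j)))"
begin

abbreviation "\<sigma> \<equiv> point_sigma P N S"

lemma space_point_sigma: "space \<sigma> = space P"
  by (simp add: point_sigma_def)

lemma measurable_point_sigma [measurable]: "N \<in> \<sigma> \<rightarrow>\<^sub>M count_space UNIV" "S i \<in> \<sigma> \<rightarrow>\<^sub>M borel"
proof -
  have *: "(\<lambda>\<omega>. (N \<omega>, \<lambda>i. S i \<omega>)) \<in> \<sigma> \<rightarrow>\<^sub>M count_space UNIV \<Otimes>\<^sub>M Pi\<^sub>M UNIV (\<lambda>_. borel)"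
    unfolding point_sigma_def
    by (rule measurable_vimage_algebra1) (auto simp: space_pair_measure space_PiM)
  show "N \<in> \<sigma> \<rightarrow>\<^sub>M count_space UNIV"
    using measurable_compose[OF * measurable_fst] by simp
  show "S i \<in> \<sigma> \<rightarrow>\<^sub>M borel"
    using measurable_compose[OF measurable_compose[OF * measurable_snd] measurable_component_singleton[of i]]
    by simp
qed

lemma subalgebra_point_sigma: "subalgebra P \<sigma>"
proof -
  have "(\<lambda>\<omega>. (N \<omega>, \<lambda>i. S i \<omega>)) \<in> P \<rightarrow>\<^sub>M count_space UNIV \<Otimes>\<^sub>M Pi\<^sub>M UNIV (\<lambda>_. borel)"
    by (intro measurable_Pair N measurable_PiM_single') (auto simp: space_PiM)
  then have "sets \<sigma> \<subseteq> sets P"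
    unfolding point_sigma_def by (intro sets_image_in_sets) auto
  then show ?thesis
    by (simp add: subalgebra_def space_point_sigma)
qed

sublocale point_sigma: finite_measure_subalgebra P \<sigma>
  by unfold_locales (rule subalgebra_point_sigma)

text \<open>
  Integrating out the marks of the pairs formed by the first \<open>n\<close> points, on an event \<open>E\<close> that depends only
  on the points and on which there are at least \<open>n\<close> of them. The integrand is a finite sum, over the
  possible values \<open>a\<close> of the marks, of the indicator of these values times a function \<open>Z a\<close> of the points.
  The indicator may be replaced by its conditional expectation \<open>\<pi> a\<close>, and the sum then factorises.
\<close>

lemma integral_marks_given_points:
  assumes E: "E \<in> sets \<sigma>" and E_N: "\<And>\<omega> j. \<omega> \<in> E \<Longrightarrow> j < n \<Longrightarrow> enat j < N \<omega>"
    and f: "f \<in> edge_space \<rightarrow>\<^sub>M count_space UNIV"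
  shows "(\<integral>\<omega>. indicator E \<omega> * exp (- real (\<Sum>i<n. \<Sum>j<n. f (S i \<omega>, S j \<omega>, A i j \<omega>))) \<partial>P) =
    (\<integral>\<omega>. indicator E \<omega> * ((\<Prod>i<n. exp (- real (f (S i \<omega>, S i \<omega>, False)))) *
      (\<Prod>(i, j)\<in>pairs_below n. pair_factor W f (S i \<omega>) (S j \<omega>))) \<partial>P)"
proof -
  note [measurable (raw)] = measurable_mark_function[OF W f] measurable_pair_factor[OF W f]
  note [measurable] = E
  have [measurable]: "E \<in> sets P"
    using E subalgebra_point_sigma by (auto simp: subalgebra_def)
  let ?F = "pairs_below n"
  let ?As = "PiE ?F (\<lambda>_. UNIV :: bool set)"
  define w where "w \<omega> p b = exp (- real (f (S (fst p) \<omega>, S (snd p) \<omega>, b) + f (S (snd p) \<omega>, S (fst p) \<omega>, b)))"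
    for \<omega> p b
  define Z where "Z a \<omega> = indicator E \<omega> * (\<Prod>i<n. exp (- real (f (S i \<omega>, S i \<omega>, False)))) * (\<Prod>p\<in>?F. w \<omega> p (a p))"
    for a \<omega>
  define H where "H a = (indicator {\<omega>\<in>space P. \<forall>(i, j)\<in>?F. A i j \<omega> = a (i, j)} :: 'w \<Rightarrow> real)" for a
  define \<pi> where "\<pi> a \<omega> = (\<Prod>(i, j)\<in>?F. pmf (bernoulli_pmf (W (S i \<omega>) (S j \<omega>))) (a (i, j)))" for a \<omega>
  have Z_meas: "Z a \<in> borel_measurable \<sigma>" for a
    unfolding Z_def w_def by measurable
  then have Z_meas_P [measurable]: "Z a \<in> borel_measurable P" for a
    by (rule measurable_from_subalg[OF subalgebra_point_sigma])
  have Z_bounds: "0 \<le> Z a \<omega>" "Z a \<omega> \<le> 1" for a \<omega>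
    by (auto simp: Z_def w_def indicator_def intro!: mult_le_one prod_le_1 prod_nonneg mult_nonneg_nonneg)
  have H_meas [measurable]: "H a \<in> borel_measurable P" for a
    unfolding H_def case_prod_beta by measurable
  have H_bounds: "0 \<le> H a \<omega>" "H a \<omega> \<le> 1" for a \<omega>
    by (auto simp: H_def indicator_def)
  have int: "integrable P (\<lambda>\<omega>. Z a \<omega> * H a \<omega>)" for a
    using Z_bounds H_bounds
    by (intro integrable_const_bound[of _ 1]) (auto intro!: AE_I2 mult_le_one simp: abs_mult)
  have expand: "indicator E \<omega> * exp (- real (\<Sum>i<n. \<Sum>j<n. f (S i \<omega>, S j \<omega>, A i j \<omega>))) =
      (\<Sum>a\<in>?As. Z a \<omega> * H a \<omega>)" if \<omega>: "\<omega> \<in> space P" for \<omega>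
  proof -
    have "exp (- real (\<Sum>i<n. \<Sum>j<n. f (S i \<omega>, S j \<omega>, A i j \<omega>))) =
        (\<Prod>i<n. exp (- real (f (S i \<omega>, S i \<omega>, False)))) * (\<Prod>p\<in>?F. w \<omega> p (A (fst p) (snd p) \<omega>))"
    proof -
      have "A i i \<omega> = False" "A j i \<omega> = A i j \<omega>" for i j
        using marks_symmetric[OF \<omega>] by auto
      then show ?thesis
        unfolding sum_square_eq_diagonal_plus_pairs
        by (simp add: w_def exp_add[symmetric] exp_sum[symmetric] sum_negf case_prod_beta
            sum.distrib sum_subtractf del: exp_sum)
    qed
    moreover have "(\<Prod>p\<in>?F. w \<omega> p (A (fst p) (snd p) \<omega>)) =
        (\<Sum>a\<in>?As. (\<Prod>p\<in>?F. w \<omega> p (a p)) * H a \<omega>)"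
    proof -
      have "(\<Prod>p\<in>?F. w \<omega> p (A (fst p) (snd p) \<omega>)) =
          (\<Prod>p\<in>?F. \<Sum>b\<in>UNIV. w \<omega> p b * (if A (fst p) (snd p) \<omega> = b then 1 else 0))"
        by (intro prod.cong refl) (auto simp: UNIV_bool)
      also have "\<dots> = (\<Sum>a\<in>?As. \<Prod>p\<in>?F. w \<omega> p (a p) * (if A (fst p) (snd p) \<omega> = a p then 1 else 0))"
        by (rule prod_sum_PiE) auto
      also have "\<dots> = (\<Sum>a\<in>?As. (\<Prod>p\<in>?F. w \<omega> p (a p)) * H a \<omega>)"
      proof (rule sum.cong[OF refl])
        fix a
        have "(\<Prod>p\<in>?F. if A (fst p) (snd p) \<omega> = a p then 1 else 0 :: real) = H a \<omega>"
        proof (cases "\<forall>p\<in>?F. A (fst p) (snd p) \<omega> = a p")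
          case True
          then have "H a \<omega> = 1" using \<omega> by (simp add: H_def case_prod_beta)
          then show ?thesis using True by (simp add: prod.neutral)
        next
          case False
          then have "H a \<omega> = 0" by (simp add: H_def case_prod_beta)
          moreover have "(\<Prod>p\<in>?F. if A (fst p) (snd p) \<omega> = a p then 1 else 0 :: real) = 0"
            using False by (intro prod_zero) auto
          ultimately show ?thesis by simp
        qed
        then show "(\<Prod>p\<in>?F. w \<omega> p (a p) * (if A (fst p) (snd p) \<omega> = a p then 1 else 0)) =
            (\<Prod>p\<in>?F. w \<omega> p (a p)) * H a \<omega>"
          by (simp add: prod.distrib)
      qed
      finally show ?thesis .
    qed
    ultimately show ?thesis
      by (simp add: Z_def sum_distrib_left mult_ac)
  qed
  have cond: "AE \<omega> in P. Z a \<omega> * real_cond_exp P \<sigma> (H a) \<omega> = Z a \<omega> * \<pi> a \<omega>" for a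
  proof -
    have "?F \<subseteq> {(i, j). i < j}"
      by (auto simp: pairs_below_def)
    from marks_conditional[OF finite_pairs_below this, of "\<lambda>i j. a (i, j)"]
    show ?thesis
    proof eventually_elim
      case (elim \<omega>)
      show ?case
      proof (cases "\<omega> \<in> E")
        case True
        then have "\<forall>(i, j)\<in>?F. enat j < N \<omega>"
          using E_N by (auto simp: pairs_below_def)
        then show ?thesis
          using elim by (simp add: H_def \<pi>_def)
      qed (simp add: Z_def)
    qed
  qed
  have int': "integrable P (\<lambda>\<omega>. Z a \<omega> * \<pi> a \<omega>)" for a
  proof -
    have "integrable P (\<lambda>\<omega>. Z a \<omega> * real_cond_exp P \<sigma> (H a) \<omega>)"
      by (rule point_sigma.real_cond_exp_intg(1)[OF int Z_meas H_meas])
    moreover have "(\<lambda>\<omega>. W (S i \<omega>) (S j \<omega>)) \<in> borel_measurable P" for i j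
      using measurable_compose[OF measurable_Pair[OF S S] symmetric_kernelD(1)[OF W], of i j] by simp
    then have "(\<lambda>\<omega>. pmf (bernoulli_pmf (W (S i \<omega>) (S j \<omega>))) b) \<in> borel_measurable P" for i j b
      using symmetric_kernelD[OF W] by (cases b) simp_all
    then have "\<pi> a \<in> borel_measurable P"
      unfolding \<pi>_def case_prod_beta by (intro borel_measurable_prod)
    ultimately show ?thesis
      using cond by (subst integrable_cong_AE[symmetric, where f = "\<lambda>\<omega>. Z a \<omega> * real_cond_exp P \<sigma> (H a) \<omega>"]) auto
  qed
  have "(\<integral>\<omega>. indicator E \<omega> * exp (- real (\<Sum>i<n. \<Sum>j<n. f (S i \<omega>, S j \<omega>, A i j \<omega>))) \<partial>P) =
      (\<integral>\<omega>. (\<Sum>a\<in>?As. Z a \<omega> * H a \<omega>) \<partial>P)"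
    by (intro Bochner_Integration.integral_cong refl expand)
  also have "\<dots> = (\<Sum>a\<in>?As. \<integral>\<omega>. Z a \<omega> * H a \<omega> \<partial>P)"
    by (intro Bochner_Integration.integral_sum int)
  also have "\<dots> = (\<Sum>a\<in>?As. \<integral>\<omega>. Z a \<omega> * \<pi> a \<omega> \<partial>P)"
  proof (rule sum.cong[OF refl])
    fix a
    have "(\<integral>\<omega>. Z a \<omega> * H a \<omega> \<partial>P) = (\<integral>\<omega>. Z a \<omega> * real_cond_exp P \<sigma> (H a) \<omega> \<partial>P)"
      by (rule point_sigma.real_cond_exp_intg(2)[OF int Z_meas H_meas, symmetric])
    also have "\<dots> = (\<integral>\<omega>. Z a \<omega> * \<pi> a \<omega> \<partial>P)"
      using cond int' by (intro integral_cong_AE) (auto dest: borel_measurable_integrable)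
    finally show "(\<integral>\<omega>. Z a \<omega> * H a \<omega> \<partial>P) = (\<integral>\<omega>. Z a \<omega> * \<pi> a \<omega> \<partial>P)" .
  qed
  also have "\<dots> = (\<integral>\<omega>. (\<Sum>a\<in>?As. Z a \<omega> * \<pi> a \<omega>) \<partial>P)"
    by (intro Bochner_Integration.integral_sum[symmetric] int')
  also have "\<dots> = (\<integral>\<omega>. indicator E \<omega> * ((\<Prod>i<n. exp (- real (f (S i \<omega>, S i \<omega>, False)))) *
      (\<Prod>(i, j)\<in>?F. pair_factor W f (S i \<omega>) (S j \<omega>))) \<partial>P)"
  proof (intro Bochner_Integration.integral_cong refl)
    fix \<omega>
    have "(\<Prod>(i, j)\<in>?F. pair_factor W f (S i \<omega>) (S j \<omega>)) =
        (\<Prod>p\<in>?F. \<Sum>b\<in>UNIV. pmf (bernoulli_pmf (W (S (fst p) \<omega>) (S (snd p) \<omega>))) b * w \<omega> p b)"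
      by (simp add: pair_factor_def w_def case_prod_beta)
    also have "\<dots> = (\<Sum>a\<in>?As. \<Prod>p\<in>?F. pmf (bernoulli_pmf (W (S (fst p) \<omega>) (S (snd p) \<omega>))) (a p) * w \<omega> p (a p))"
      by (rule prod_sum_PiE) auto
    also have "\<dots> = (\<Sum>a\<in>?As. \<pi> a \<omega> * (\<Prod>p\<in>?F. w \<omega> p (a p)))"
      by (simp add: prod.distrib \<pi>_def case_prod_beta)
    finally show "(\<Sum>a\<in>?As. Z a \<omega> * \<pi> a \<omega>) = indicator E \<omega> * ((\<Prod>i<n. exp (- real (f (S i \<omega>, S i \<omega>, False)))) *
        (\<Prod>(i, j)\<in>?F. pair_factor W f (S i \<omega>) (S j \<omega>)))"
      by (simp add: Z_def sum_distrib_left mult_ac)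
  qed
  finally show ?thesis .
qed

end

lemma sum_square_below_min:
  fixes q :: "nat \<times> nat \<Rightarrow> 'b::comm_monoid_add"
  assumes n: "min k (enat m) = enat n"
  shows "(\<Sum>p\<in>{..<m} \<times> {..<m}. if enat (fst p) < k \<and> enat (snd p) < k then q p else 0) =
    (\<Sum>i<n. \<Sum>j<n. q (i, j))"
proof -
  have below: "i < m \<and> enat i < k \<longleftrightarrow> i < n" for i
  proof -
    have "i < m \<and> enat i < k \<longleftrightarrow> enat i < min k (enat m)" by auto
    then show ?thesis by (simp add: n)
  qed
  have "{p \<in> {..<m} \<times> {..<m}. enat (fst p) < k \<and> enat (snd p) < k} = {..<n} \<times> {..<n}"
  proof (rule set_eqI)
    fix p
    show "p \<in> {p \<in> {..<m} \<times> {..<m}. enat (fst p) < k \<and> enat (snd p) < k} \<longleftrightarrow> p \<in> {..<n} \<times> {..<n}"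
      using below[of "fst p"] below[of "snd p"] by (simp add: mem_Times_iff) blast
  qed
  then have "(\<Sum>p\<in>{..<m} \<times> {..<m}. if enat (fst p) < k \<and> enat (snd p) < k then q p else 0) =
      (\<Sum>p\<in>{..<n} \<times> {..<n}. q p)"
    by (simp add: sum.inter_filter[symmetric])
  then show ?thesis
    by (simp add: sum.cartesian_product)
qed

context marked_point_sequence
begin

lemma measurable_index_below [measurable]: "Measurable.pred P (\<lambda>\<omega>. enat i < N \<omega>)"
  using measurable_compose[OF N, of "\<lambda>k. enat i < k" "count_space UNIV"] by simp

lemma AE_inj_on_below: "AE \<omega> in P. \<forall>n. enat n \<le> N \<omega> \<longrightarrow> inj_on (\<lambda>i. S i \<omega>) {..<n}"
  using distinct
proof eventually_elim
  case (elim \<omega>)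
  have "enat i < N \<omega>" if "i < n" "enat n \<le> N \<omega>" for i n
    using that by (meson enat_ord_simps(2) less_le_trans)
  then show ?case
    using elim unfolding inj_on_def by blast
qed

text \<open>
  The version of \<open>integral_marks_given_points\<close> for all points. With indices restricted to \<open>i < m\<close>, the sample
  space splits into the events that exactly \<open>n \<le> m\<close> points have such an index, on each of which that
  lemma applies; then \<open>m \<rightarrow> \<infinity>\<close>. Because the points are almost surely distinct, the diagonal of \<open>M\<^sup>2\<close>
  corresponds to the pairs of equal indices.
\<close>

lemma integral_exp_neg_marked_pairs:
  assumes f: "f \<in> edge_space \<rightarrow>\<^sub>M count_space UNIV"
  shows "(\<integral>\<omega>. exp_neg (\<integral>\<^sup>+(i, j). (if enat i < N \<omega> \<and> enat j < N \<omega>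
      then of_nat (f (S i \<omega>, S j \<omega>, A i j \<omega>)) else 0) \<partial>count_space UNIV) \<partial>P) =
    (\<integral>\<omega>. exp_neg (\<integral>\<^sup>+(i, j). (if enat i < N \<omega> \<and> enat j < N \<omega>
      then ennreal (pair_potential W f (S i \<omega>) (S j \<omega>)) else 0) \<partial>count_space UNIV) \<partial>P)"
proof -
  note [measurable (raw)] = measurable_mark_function[OF W f] measurable_pair_factor[OF W f]
  have pot_meas [measurable]: "(\<lambda>\<omega>. pair_potential W f (S i \<omega>) (S j \<omega>)) \<in> borel_measurable P" for i j
    using measurable_compose[OF measurable_Pair[OF S S] measurable_pair_potential[OF W f], of i j] by simp
  define x where "x \<omega> p = (if enat (fst p) < N \<omega> \<and> enat (snd p) < N \<omega>
      then of_nat (f (S (fst p) \<omega>, S (snd p) \<omega>, A (fst p) (snd p) \<omega>)) else 0 :: ennreal)" for \<omega> p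
  define y where "y \<omega> p = (if enat (fst p) < N \<omega> \<and> enat (snd p) < N \<omega>
      then ennreal (pair_potential W f (S (fst p) \<omega>) (S (snd p) \<omega>)) else 0)" for \<omega> p
  have [measurable]: "(\<lambda>\<omega>. x \<omega> p) \<in> borel_measurable P" "(\<lambda>\<omega>. y \<omega> p) \<in> borel_measurable P" for p
    unfolding x_def y_def by measurable
  have finite: "(\<integral>\<omega>. exp_neg (\<Sum>p\<in>{..<m} \<times> {..<m}. x \<omega> p) \<partial>P) = (\<integral>\<omega>. exp_neg (\<Sum>p\<in>{..<m} \<times> {..<m}. y \<omega> p) \<partial>P)"
    for m
  proof -
    define E where "E n = {\<omega>\<in>space P. min (N \<omega>) (enat m) = enat n}" for n
    have E: "E n \<in> sets \<sigma>" for n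
    proof -
      have "{\<omega>\<in>space \<sigma>. min (N \<omega>) (enat m) = enat n} \<in> sets \<sigma>"
        using measurable_compose[OF measurable_point_sigma(1), of "\<lambda>k. min k (enat m) = enat n" "count_space UNIV"]
        by (simp add: pred_def)
      then show ?thesis
        by (simp add: E_def space_point_sigma)
    qed
    have E_P [measurable]: "E n \<in> sets P" for n
      using E subalgebra_point_sigma by (auto simp: subalgebra_def)
    have E_N: "enat j < N \<omega>" if "\<omega> \<in> E n" "j < n" for \<omega> n j
    proof -
      have "enat j < min (N \<omega>) (enat m)"
        using that by (simp add: E_def)
      then show ?thesis by simp
    qed
    \<comment> \<open>the events \<open>E n\<close> with \<open>n \<le> m\<close> form a partition\<close>
    have split: "g \<omega> = (\<Sum>n\<le>m. indicator (E n) \<omega> * h n \<omega>)"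
      if \<omega>: "\<omega> \<in> space P" and gh: "\<And>n. \<omega> \<in> E n \<Longrightarrow> g \<omega> = h n \<omega>" for g \<omega> and h :: "nat \<Rightarrow> 'w \<Rightarrow> real"
    proof -
      obtain n where n: "min (N \<omega>) (enat m) = enat n"
        by (metis enat_ile min.cobounded2)
      then have "n \<le> m"
        by (metis enat_ord_simps(1) min.cobounded2)
      moreover have "\<omega> \<in> E k \<longleftrightarrow> k = n" for k
        using \<omega> n by (auto simp: E_def)
      ultimately have "(\<Sum>n\<le>m. indicator (E n) \<omega> * h n \<omega>) = (\<Sum>k\<le>m. if k = n then h k \<omega> else 0)"
        by (intro sum.cong) (auto simp: indicator_def)
      also have "\<dots> = h n \<omega>"
        using \<open>n \<le> m\<close> by simp
      finally show ?thesis
        using gh[of n] \<open>\<And>k. \<omega> \<in> E k \<longleftrightarrow> k = n\<close> by simp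
    qed
    let ?g = "\<lambda>n \<omega>. exp (- real (\<Sum>i<n. \<Sum>j<n. f (S i \<omega>, S j \<omega>, A i j \<omega>)))"
    let ?h = "\<lambda>n \<omega>. (\<Prod>i<n. exp (- real (f (S i \<omega>, S i \<omega>, False)))) *
      (\<Prod>(i, j)\<in>pairs_below n. pair_factor W f (S i \<omega>) (S j \<omega>))"
    have x_eq: "exp_neg (\<Sum>p\<in>{..<m} \<times> {..<m}. x \<omega> p) = ?g n \<omega>" if "\<omega> \<in> E n" for \<omega> n
    proof -
      have "(\<Sum>p\<in>{..<m} \<times> {..<m}. x \<omega> p) = (\<Sum>i<n. \<Sum>j<n. of_nat (f (S i \<omega>, S j \<omega>, A i j \<omega>)))"
        unfolding x_def by (subst sum_square_below_min[where n = n]) (use that in \<open>simp_all add: E_def\<close>)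
      also have "\<dots> = of_nat (\<Sum>i<n. \<Sum>j<n. f (S i \<omega>, S j \<omega>, A i j \<omega>))"
        by simp
      finally show ?thesis
        by (simp only: exp_neg_of_nat)
    qed
    have y_eq: "exp_neg (\<Sum>p\<in>{..<m} \<times> {..<m}. y \<omega> p) = ?h n \<omega>"
      if "\<omega> \<in> E n" "\<forall>n. enat n \<le> N \<omega> \<longrightarrow> inj_on (\<lambda>i. S i \<omega>) {..<n}" for \<omega> n
    proof -
      have "enat n \<le> N \<omega>"
        using that(1) unfolding E_def by (metis (mono_tags, lifting) mem_Collect_eq min.cobounded1)
      then have inj: "inj_on (\<lambda>i. S i \<omega>) {..<n}"
        using that(2) by blast
      have "(\<Sum>p\<in>{..<m} \<times> {..<m}. y \<omega> p) = (\<Sum>i<n. \<Sum>j<n. ennreal (pair_potential W f (S i \<omega>) (S j \<omega>)))"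
        unfolding y_def by (subst sum_square_below_min[where n = n]) (use that in \<open>simp_all add: E_def\<close>)
      also have "\<dots> = ennreal (\<Sum>i<n. \<Sum>j<n. pair_potential W f (S i \<omega>) (S j \<omega>))"
        by (simp add: sum_nonneg pair_potential_nonneg[OF W])
      finally show ?thesis
        using exp_neg_sum_pair_potential[OF W f inj]
        by (simp add: sum_nonneg pair_potential_nonneg[OF W])
    qed
    have h_bounds: "0 \<le> ?h n \<omega>" "?h n \<omega> \<le> 1" for n \<omega>
    proof -
      have factor: "0 \<le> pair_factor W f (S i \<omega>) (S j \<omega>)" "pair_factor W f (S i \<omega>) (S j \<omega>) \<le> 1" for i j
        using pair_factor_bounds[OF W, of f "S i \<omega>" "S j \<omega>"] by simp_all
      show "0 \<le> ?h n \<omega>"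
        unfolding case_prod_beta by (intro mult_nonneg_nonneg prod_nonneg ballI factor) simp
      show "?h n \<omega> \<le> 1"
        unfolding case_prod_beta
        by (intro mult_le_one prod_le_1 prod_nonneg ballI conjI factor) simp_all
    qed
    have g_int: "integrable P (\<lambda>\<omega>. indicator (E n) \<omega> * ?g n \<omega>)" for n
    proof (rule integrable_const_bound[of _ 1])
      show "AE \<omega> in P. norm (indicator (E n) \<omega> * ?g n \<omega>) \<le> 1"
        by (intro AE_I2) (simp add: indicator_def sum_nonneg)
    qed measurable
    have h_int: "integrable P (\<lambda>\<omega>. indicator (E n) \<omega> * ?h n \<omega>)" for n
    proof (rule integrable_const_bound[of _ 1])
      show "AE \<omega> in P. norm (indicator (E n) \<omega> * ?h n \<omega>) \<le> 1"
        using h_bounds by (intro AE_I2) (auto simp: indicator_def)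
      show "(\<lambda>\<omega>. indicator (E n) \<omega> * ?h n \<omega>) \<in> borel_measurable P"
        unfolding case_prod_beta by measurable
    qed
    have "(\<integral>\<omega>. exp_neg (\<Sum>p\<in>{..<m} \<times> {..<m}. x \<omega> p) \<partial>P) = (\<integral>\<omega>. (\<Sum>n\<le>m. indicator (E n) \<omega> * ?g n \<omega>) \<partial>P)"
      by (intro Bochner_Integration.integral_cong refl split[of _ "\<lambda>\<omega>. exp_neg (\<Sum>p\<in>{..<m} \<times> {..<m}. x \<omega> p)"] x_eq)
    also have "\<dots> = (\<Sum>n\<le>m. \<integral>\<omega>. indicator (E n) \<omega> * ?g n \<omega> \<partial>P)"
      by (intro Bochner_Integration.integral_sum g_int)
    also have "\<dots> = (\<Sum>n\<le>m. \<integral>\<omega>. indicator (E n) \<omega> * ?h n \<omega> \<partial>P)"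
      by (intro sum.cong refl integral_marks_given_points E E_N f)
    also have "\<dots> = (\<integral>\<omega>. (\<Sum>n\<le>m. indicator (E n) \<omega> * ?h n \<omega>) \<partial>P)"
      by (intro Bochner_Integration.integral_sum[symmetric] h_int)
    also have "\<dots> = (\<integral>\<omega>. exp_neg (\<Sum>p\<in>{..<m} \<times> {..<m}. y \<omega> p) \<partial>P)"
    proof (rule integral_cong_AE)
      show "(\<lambda>\<omega>. \<Sum>n\<le>m. indicator (E n) \<omega> * ?h n \<omega>) \<in> borel_measurable P"
        using h_int by (intro borel_measurable_sum) auto
      show "AE \<omega> in P. (\<Sum>n\<le>m. indicator (E n) \<omega> * ?h n \<omega>) = exp_neg (\<Sum>p\<in>{..<m} \<times> {..<m}. y \<omega> p)"
        using AE_inj_on_below AE_space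
      proof eventually_elim
        case (elim \<omega>)
        show ?case
          using split[OF elim(2), of "\<lambda>\<omega>. exp_neg (\<Sum>p\<in>{..<m} \<times> {..<m}. y \<omega> p)" ?h] y_eq[OF _ elim(1)]
          by simp
      qed
    qed measurable
    finally show ?thesis .
  qed
  have limit: "(\<lambda>m. \<integral>\<omega>. exp_neg (\<Sum>p\<in>{..<m} \<times> {..<m}. z \<omega> p) \<partial>P) \<longlonglongrightarrow>
      (\<integral>\<omega>. exp_neg (\<integral>\<^sup>+p. z \<omega> p \<partial>count_space UNIV) \<partial>P)"
    if [measurable]: "\<And>p. (\<lambda>\<omega>. z \<omega> p) \<in> borel_measurable P" for z
  proof (rule integral_dominated_convergence[where w = "\<lambda>_. 1"])
    have "(\<lambda>\<omega>. \<integral>\<^sup>+p. z \<omega> p \<partial>count_space UNIV) \<in> borel_measurable P"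
      by (rule borel_measurable_LIMSEQ_order[OF nn_integral_count_space_square]) measurable
    then show "(\<lambda>\<omega>. exp_neg (\<integral>\<^sup>+p. z \<omega> p \<partial>count_space UNIV)) \<in> borel_measurable P"
      by measurable
  qed (auto intro!: tendsto_exp_neg nn_integral_count_space_square)
  have "(\<integral>\<omega>. exp_neg (\<integral>\<^sup>+p. x \<omega> p \<partial>count_space UNIV) \<partial>P) =
      (\<integral>\<omega>. exp_neg (\<integral>\<^sup>+p. y \<omega> p \<partial>count_space UNIV) \<partial>P)"
    by (rule LIMSEQ_unique[OF limit]) (use limit[of y] in \<open>simp_all add: finite\<close>)
  then show ?thesis
    by (simp add: x_def y_def case_prod_beta')
qed

lemma nn_integral_dirac_sum_marked_pairs:
  assumes F: "F \<in> borel_measurable edge_space"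
  shows "(\<integral>\<^sup>+z. F z \<partial>dirac_sum edge_space {(i, j). enat i < N \<omega> \<and> enat j < N \<omega>}
      (\<lambda>(i, j). (S i \<omega>, S j \<omega>, A i j \<omega>))) =
    (\<integral>\<^sup>+(i, j). (if enat i < N \<omega> \<and> enat j < N \<omega> then F (S i \<omega>, S j \<omega>, A i j \<omega>) else 0) \<partial>count_space UNIV)"
  using F
  by (subst nn_integral_dirac_sum)
     (auto simp: nn_integral_count_space_indicator space_pair_measure indicator_def intro!: nn_integral_cong)

lemma measurable_dirac_sum_marked_pairs:
  "(\<lambda>\<omega>. dirac_sum edge_space {(i, j). enat i < N \<omega> \<and> enat j < N \<omega>}
      (\<lambda>(i, j). (S i \<omega>, S j \<omega>, A i j \<omega>))) \<in> P \<rightarrow>\<^sub>M measure_algebra edge_space"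
proof (rule measurable_measure_algebra)
  fix B :: "('a \<times> 'a \<times> bool) set" assume B [measurable]: "B \<in> sets edge_space"
  let ?x = "\<lambda>\<omega> (i, j). if enat i < N \<omega> \<and> enat j < N \<omega> then indicator B (S i \<omega>, S j \<omega>, A i j \<omega>) else 0 :: ennreal"
  have [measurable]: "(\<lambda>\<omega>. ?x \<omega> p) \<in> borel_measurable P" for p
    unfolding case_prod_beta by measurable
  have "(\<lambda>\<omega>. \<integral>\<^sup>+p. ?x \<omega> p \<partial>count_space UNIV) \<in> borel_measurable P"
    by (rule borel_measurable_LIMSEQ_order[OF nn_integral_count_space_square]) measurable
  also have "(\<lambda>\<omega>. \<integral>\<^sup>+p. ?x \<omega> p \<partial>count_space UNIV) =
      (\<lambda>\<omega>. emeasure (dirac_sum edge_space {(i, j). enat i < N \<omega> \<and> enat j < N \<omega>}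
        (\<lambda>(i, j). (S i \<omega>, S j \<omega>, A i j \<omega>))) B)"
    by (subst nn_integral_dirac_sum_marked_pairs[symmetric]) simp_all
  finally show "(\<lambda>\<omega>. emeasure (dirac_sum edge_space {(i, j). enat i < N \<omega> \<and> enat j < N \<omega>}
        (\<lambda>(i, j). (S i \<omega>, S j \<omega>, A i j \<omega>))) B) \<in> borel_measurable P" .
qed simp

end

text \<open>
  The Laplace functional of the graph process is the expectation of a functional of the point process
  \<open>\<eta>\<close> alone, built from \<open>f\<close>, the kernel and the sets \<open>K n\<close>.
\<close>

lemma poisson_graph_process_Laplace:
  fixes \<mu> :: "'a::{second_countable_topology, t2_space} measure"
  assumes \<xi>: "poisson_graph_process d P \<mu> W \<xi>"
    and K: "\<And>n. K n \<in> sets borel" "incseq K" "(\<Union>n. K n) = UNIV" "\<And>n. emeasure \<mu> (K n) < \<infinity>"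
  obtains \<eta> where "poisson_process P \<mu> \<eta>"
    "\<And>\<omega> B. B \<in> sets borel \<Longrightarrow> emeasure (\<eta> \<omega>) B \<in> insert top (range of_nat)"
    "\<And>f. f \<in> edge_space \<rightarrow>\<^sub>M count_space UNIV \<Longrightarrow>
      (\<integral>\<omega>. exp_neg (\<integral>\<^sup>+z. of_nat (f z) \<partial>\<xi> \<omega>) \<partial>P) =
      (\<integral>\<omega>. exp_neg (pair_energy (\<lambda>x y. ennreal (pair_potential W f x y)) K (\<eta> \<omega>)) \<partial>P)"
    "\<xi> \<in> P \<rightarrow>\<^sub>M measure_algebra edge_space"
    "\<And>\<omega> B. \<omega> \<in> space P \<Longrightarrow> B \<in> sets edge_space \<Longrightarrow> emeasure (\<xi> \<omega>) B \<in> insert top (range of_nat)"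
proof -
  from \<xi> obtain N S A where P: "prob_space P" and W: "symmetric_kernel W" and
    meas: "N \<in> P \<rightarrow>\<^sub>M count_space UNIV" "\<forall>i. S i \<in> P \<rightarrow>\<^sub>M borel" "\<forall>i j. A i j \<in> P \<rightarrow>\<^sub>M count_space UNIV" and
    \<xi>_eq: "\<forall>\<omega>\<in>space P. \<xi> \<omega> = dirac_sum edge_space {(i, j). enat i < N \<omega> \<and> enat j < N \<omega>}
      (\<lambda>(i, j). (S i \<omega>, S j \<omega>, A i j \<omega>))" and
    \<eta>: "poisson_process P \<mu> (\<lambda>\<omega>. dirac_sum borel {i. enat i < N \<omega>} (\<lambda>i. S i \<omega>))" and
    rest: "AE \<omega> in P. \<forall>i j. enat i < N \<omega> \<and> enat j < N \<omega> \<and> i \<noteq> j \<longrightarrow> S i \<omega> \<noteq> S j \<omega>"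
      "\<forall>\<omega>\<in>space P. \<forall>i j. \<not> A i i \<omega> \<and> A j i \<omega> = A i j \<omega>"
      "\<forall>F a. finite F \<and> F \<subseteq> {(i, j). i < j} \<longrightarrow>
         (AE \<omega> in P. (\<forall>(i, j)\<in>F. enat j < N \<omega>) \<longrightarrow>
            real_cond_exp P (point_sigma P N S)
              (indicator {\<omega>\<in>space P. \<forall>(i, j)\<in>F. A i j \<omega> = a i j}) \<omega> =
            (\<Prod>(i, j)\<in>F. pmf (bernoulli_pmf (W (S i \<omega>) (S j \<omega>))) (a i j)))"
    unfolding poisson_graph_process_def by (elim conjE exE) (rule that; assumption)
  interpret marked_point_sequence P N S A W
    by (intro marked_point_sequence.intro marked_point_sequence_axioms.intro P W rest(1))
       (use meas rest(2,3) in simp_all)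
  define \<eta> where "\<eta> \<omega> = dirac_sum borel {i. enat i < N \<omega>} (\<lambda>i. S i \<omega>)" for \<omega>
  have \<eta>_poisson: "poisson_process P \<mu> \<eta>"
    using \<eta> unfolding \<eta>_def .
  have \<eta>_vals: "emeasure (\<eta> \<omega>) B \<in> insert top (range of_nat)" if "B \<in> sets borel" for \<omega> B
    unfolding \<eta>_def using that by (rule emeasure_dirac_sum_values) simp
  have \<xi>_meas: "\<xi> \<in> P \<rightarrow>\<^sub>M measure_algebra edge_space"
    using measurable_dirac_sum_marked_pairs by (rule measurable_cong[THEN iffD1, rotated]) (simp add: \<xi>_eq)
  have \<xi>_vals: "emeasure (\<xi> \<omega>) B \<in> insert top (range of_nat)" if "\<omega> \<in> space P" "B \<in> sets edge_space" for \<omega> B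
    unfolding bspec[OF \<xi>_eq that(1)] using that(2)
    by (rule emeasure_dirac_sum_values) (auto simp: space_pair_measure)
  have "AE \<omega> in P. emeasure (\<eta> \<omega>) (K n) < \<infinity>" for n
    by (rule poisson_process_AE_finite[OF P \<eta>_poisson \<eta>_vals[OF K(1)] K(1,4)])
  then have finite: "AE \<omega> in P. \<forall>n. emeasure (\<eta> \<omega>) (K n) < \<infinity>"
    by (simp add: AE_all_countable)
  have "(\<integral>\<omega>. exp_neg (\<integral>\<^sup>+z. of_nat (f z) \<partial>\<xi> \<omega>) \<partial>P) =
      (\<integral>\<omega>. exp_neg (pair_energy (\<lambda>x y. ennreal (pair_potential W f x y)) K (\<eta> \<omega>)) \<partial>P)"
    if f: "f \<in> edge_space \<rightarrow>\<^sub>M count_space UNIV" for f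
  proof -
    let ?u = "\<lambda>x y. ennreal (pair_potential W f x y)"
    have u: "(\<lambda>(x, y). ?u x y) \<in> borel_measurable (borel \<Otimes>\<^sub>M borel)"
      using measurable_pair_potential[OF W f] by (simp add: case_prod_beta)
    have energy_meas: "(\<lambda>\<omega>. pair_energy ?u K (\<eta> \<omega>)) \<in> borel_measurable P"
      by (rule measurable_compose[OF poisson_process_measurable[OF \<eta>_poisson] measurable_pair_energy[OF K(1) u]])
    let ?J = "\<lambda>\<omega>. \<integral>\<^sup>+(i, j). (if enat i < N \<omega> \<and> enat j < N \<omega> then ?u (S i \<omega>) (S j \<omega>) else 0) \<partial>count_space UNIV"
    have J: "AE \<omega> in P. pair_energy ?u K (\<eta> \<omega>) = ?J \<omega>"
      using finite
    proof eventually_elim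
      case (elim \<omega>)
      show ?case
        using pair_energy_dirac_sum[OF K(1-3) u, of "{i. enat i < N \<omega>}" "\<lambda>i. S i \<omega>"] elim
        by (simp add: \<eta>_def)
    qed
    have [measurable]: "(\<lambda>\<omega>. ?u (S i \<omega>) (S j \<omega>)) \<in> borel_measurable P" for i j
      using measurable_compose[OF measurable_Pair[OF S S] u, of i j] by simp
    have [measurable]: "(\<lambda>\<omega>. case p of (i, j) \<Rightarrow> if enat i < N \<omega> \<and> enat j < N \<omega> then ?u (S i \<omega>) (S j \<omega>) else 0)
        \<in> borel_measurable P" for p
      unfolding case_prod_beta by measurable
    have J_meas: "?J \<in> borel_measurable P"
      by (rule borel_measurable_LIMSEQ_order[OF nn_integral_count_space_square]) measurable
    have of_nat_f: "(\<lambda>z. of_nat (f z) :: ennreal) \<in> borel_measurable edge_space"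
      using measurable_compose[OF f, of of_nat "borel :: ennreal measure"] by simp
    have "(\<integral>\<omega>. exp_neg (\<integral>\<^sup>+z. of_nat (f z) \<partial>\<xi> \<omega>) \<partial>P) =
        (\<integral>\<omega>. exp_neg (\<integral>\<^sup>+(i, j). (if enat i < N \<omega> \<and> enat j < N \<omega>
          then of_nat (f (S i \<omega>, S j \<omega>, A i j \<omega>)) else 0) \<partial>count_space UNIV) \<partial>P)"
      by (intro Bochner_Integration.integral_cong refl)
        (simp only: bspec[OF \<xi>_eq] nn_integral_dirac_sum_marked_pairs[OF of_nat_f])
    also have "\<dots> = (\<integral>\<omega>. exp_neg (?J \<omega>) \<partial>P)"
      by (rule integral_exp_neg_marked_pairs[OF f])
    also have "\<dots> = (\<integral>\<omega>. exp_neg (pair_energy ?u K (\<eta> \<omega>)) \<partial>P)"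
      using J J_meas energy_meas by (intro integral_cong_AE) auto
    finally show ?thesis .
  qed
  then show thesis
    by (intro that[OF \<eta>_poisson \<eta>_vals _ \<xi>_meas \<xi>_vals])
qed

text \<open>
  Both Laplace functionals are expectations of one and the same functional of the underlying Poisson
  processes, which agree in law.
\<close>

lemma poisson_graph_process_law_unique:
  fixes \<mu> :: "'a::{second_countable_topology, t2_space} measure"
  assumes \<xi>: "poisson_graph_process d P \<mu> W \<xi>" and \<xi>': "poisson_graph_process d' P' \<mu> W \<xi>'"
    and \<mu>: "sigma_finite_measure \<mu>"
  shows "distr P (measure_algebra edge_space) \<xi> = distr P' (measure_algebra edge_space) \<xi>'"
proof -
  have P: "prob_space P" and P': "prob_space P'" and W: "symmetric_kernel W" and sets_\<mu>: "sets \<mu> = sets borel"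
    using \<xi> \<xi>' by (auto simp: poisson_graph_process_def locally_finite_measure_def)
  obtain K :: "nat \<Rightarrow> 'a set" where K: "range K \<subseteq> sets \<mu>" "(\<Union>n. K n) = space \<mu>"
    "\<And>n. emeasure \<mu> (K n) \<noteq> \<infinity>" "incseq K"
    using sigma_finite_measure.sigma_finite_incseq[OF \<mu>] by metis
  have K': "\<And>n. K n \<in> sets borel" "incseq K" "(\<Union>n. K n) = UNIV" "\<And>n. emeasure \<mu> (K n) < \<infinity>"
    using K sets_\<mu> sets_eq_imp_space_eq[OF sets_\<mu>] by (auto simp: less_top)
  obtain \<eta> where \<eta>: "poisson_process P \<mu> \<eta>"
      "\<And>\<omega> B. B \<in> sets borel \<Longrightarrow> emeasure (\<eta> \<omega>) B \<in> insert top (range of_nat)"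
      "\<And>f. f \<in> edge_space \<rightarrow>\<^sub>M count_space UNIV \<Longrightarrow>
      (\<integral>\<omega>. exp_neg (\<integral>\<^sup>+z. of_nat (f z) \<partial>\<xi> \<omega>) \<partial>P) =
      (\<integral>\<omega>. exp_neg (pair_energy (\<lambda>x y. ennreal (pair_potential W f x y)) K (\<eta> \<omega>)) \<partial>P)"
      "\<xi> \<in> P \<rightarrow>\<^sub>M measure_algebra edge_space"
      "\<And>\<omega> B. \<omega> \<in> space P \<Longrightarrow> B \<in> sets edge_space \<Longrightarrow> emeasure (\<xi> \<omega>) B \<in> insert top (range of_nat)"
    by (rule poisson_graph_process_Laplace[OF \<xi> K']) blast
  obtain \<eta>' where \<eta>': "poisson_process P' \<mu> \<eta>'"
      "\<And>\<omega> B. B \<in> sets borel \<Longrightarrow> emeasure (\<eta>' \<omega>) B \<in> insert top (range of_nat)"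
      "\<And>f. f \<in> edge_space \<rightarrow>\<^sub>M count_space UNIV \<Longrightarrow>
      (\<integral>\<omega>. exp_neg (\<integral>\<^sup>+z. of_nat (f z) \<partial>\<xi>' \<omega>) \<partial>P') =
      (\<integral>\<omega>. exp_neg (pair_energy (\<lambda>x y. ennreal (pair_potential W f x y)) K (\<eta>' \<omega>)) \<partial>P')"
      "\<xi>' \<in> P' \<rightarrow>\<^sub>M measure_algebra edge_space"
      "\<And>\<omega> B. \<omega> \<in> space P' \<Longrightarrow> B \<in> sets edge_space \<Longrightarrow> emeasure (\<xi>' \<omega>) B \<in> insert top (range of_nat)"
    by (rule poisson_graph_process_Laplace[OF \<xi>' K']) blast
  have law: "distr P (measure_algebra borel) \<eta> = distr P' (measure_algebra borel) \<eta>'"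
    by (rule poisson_process_law_unique[OF P P' \<eta>(1) \<eta>'(1) \<eta>(2) \<eta>'(2)])
  show ?thesis
  proof (rule distr_measure_algebra_eqI_Laplace[OF P P' \<eta>(4) \<eta>'(4) \<eta>(5) \<eta>'(5)])
    fix f :: "'a \<times> 'a \<times> bool \<Rightarrow> nat" and m :: nat
    assume f: "f \<in> edge_space \<rightarrow>\<^sub>M count_space UNIV"
    let ?\<Phi> = "\<lambda>\<nu>. exp_neg (pair_energy (\<lambda>x y. ennreal (pair_potential W f x y)) K \<nu>)"
    have u: "(\<lambda>(x, y). ennreal (pair_potential W f x y)) \<in> borel_measurable (borel \<Otimes>\<^sub>M borel)"
      using measurable_pair_potential[OF W f] by (simp add: case_prod_beta)
    have \<Phi>: "?\<Phi> \<in> borel_measurable (measure_algebra borel)"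
      by (rule measurable_compose[OF measurable_pair_energy[OF K'(1) u] measurable_exp_neg])
    have "(\<integral>\<omega>. ?\<Phi> (\<eta> \<omega>) \<partial>P) = (\<integral>\<nu>. ?\<Phi> \<nu> \<partial>distr P (measure_algebra borel) \<eta>)"
      by (rule integral_distr[OF poisson_process_measurable[OF \<eta>(1)] \<Phi>, symmetric])
    also have "\<dots> = (\<integral>\<omega>. ?\<Phi> (\<eta>' \<omega>) \<partial>P')"
      unfolding law by (rule integral_distr[OF poisson_process_measurable[OF \<eta>'(1)] \<Phi>])
    finally show "(\<integral>\<omega>. exp_neg (\<integral>\<^sup>+z. of_nat (f z) \<partial>\<xi> \<omega>) \<partial>P) =
        (\<integral>\<omega>. exp_neg (\<integral>\<^sup>+z. of_nat (f z) \<partial>\<xi>' \<omega>) \<partial>P')"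
      by (simp add: \<eta>(3)[OF f] \<eta>'(3)[OF f])
  qed
qed

section \<open>Invariance under scaling\<close>

lemma sigma_finite_scale_measure:
  assumes "sigma_finite_measure M"
  shows "sigma_finite_measure (scale_measure (ennreal r) M)"
proof
  obtain A where A: "countable A" "A \<subseteq> sets M" "\<Union> A = space M" "\<forall>a\<in>A. emeasure M a \<noteq> \<infinity>"
    using sigma_finite_measure.sigma_finite_countable[OF assms] by auto
  then have "\<forall>a\<in>A. emeasure (scale_measure (ennreal r) M) a \<noteq> \<infinity>"
    by (simp add: ennreal_mult_eq_top_iff)
  with A show "\<exists>A. countable A \<and> A \<subseteq> sets (scale_measure (ennreal r) M) \<and>
      \<Union> A = space (scale_measure (ennreal r) M) \<and> (\<forall>a\<in>A. emeasure (scale_measure (ennreal r) M) a \<noteq> \<infinity>)"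
    by (intro exI[of _ A]) (simp add: space_scale_measure)
qed

theorem theorem29:
  fixes A :: "('a::{second_countable_topology, t2_space}, 'n::finite) chart set"
    and g g' :: "('a, 'n) tensor2"
    and \<delta> \<delta>' c :: real
    and h h' :: "real \<Rightarrow> real"
    and P :: "'w measure" and P' :: "'v measure"
    and \<xi> :: "'w \<Rightarrow> ('a \<times> 'a \<times> bool) measure"
    and \<xi>' :: "'v \<Rightarrow> ('a \<times> 'a \<times> bool) measure"
  assumes "smooth_atlas A" and "riemannian_metric A g"
    and "connected (UNIV :: 'a set)" and "geodesically_complete A g"
    and "\<delta> > 0"
    and "h \<in> borel_measurable (restrict_space borel {0..})"
    and "antimono_on {0..} h" and "\<And>r. r \<ge> 0 \<Longrightarrow> 0 \<le> h r \<and> h r \<le> 1"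
    and "poisson_graph_process (riemannian_dist A g) P
           (scale_measure (ennreal \<delta>) (riemannian_volume A g))
           (\<lambda>x y. h (riemannian_dist A g x y)) \<xi>"
    and "c > 0"
    and "g' = (\<lambda>k x. c\<^sup>2 *\<^sub>R g k x)"
    and "\<delta>' = c powi (- int CARD('n)) * \<delta>"
    and "h' = (\<lambda>r. h (r / c))"
    and "poisson_graph_process (riemannian_dist A g') P'
           (scale_measure (ennreal \<delta>') (riemannian_volume A g'))
           (\<lambda>x y. h' (riemannian_dist A g' x y)) \<xi>'"
  shows "distr P' (measure_algebra edge_space) \<xi>' = distr P (measure_algebra edge_space) \<xi>"
  proof -
  let ?V = "riemannian_volume A g"
  have dist: "riemannian_dist A g' x y = c * riemannian_dist A g x y" for x y
    unfolding assms(11) by (rule riemannian_dist_scale[OF assms(10)])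
  have kernel: "(\<lambda>x y. h' (riemannian_dist A g' x y)) = (\<lambda>x y. h (riemannian_dist A g x y))"
    using assms(10) by (simp add: dist assms(13))
  have "riemannian_volume A g' = scale_measure (ennreal (c ^ CARD('n))) ?V"
    unfolding assms(11) by (rule riemannian_volume_scale[OF assms(1,2,10)])
  moreover have "ennreal \<delta>' * ennreal (c ^ CARD('n)) = ennreal \<delta>"
    using assms(5,10) by (simp add: assms(12) ennreal_mult''[symmetric] power_int_minus)
  ultimately have intensity:
    "scale_measure (ennreal \<delta>') (riemannian_volume A g') = scale_measure (ennreal \<delta>) ?V"
    by simp
  have "sigma_finite_measure ?V"
    using riemannian_volume_exists[OF assms(1,2)] riemannian_volume_eqI[OF assms(1)]
      sigma_finite_riemannian_volume[OF assms(1,2)] by metis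
  then show ?thesis
    using poisson_graph_process_law_unique[OF assms(14)[unfolded intensity kernel] assms(9)]
      sigma_finite_scale_measure by blast
qed

end
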